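(* Let $\nabla$ be a torsion-free connection on a smooth manifold $M$ and $X,Y\in\mathfrak{X}(M)$. All of the six relations (of operators on $\Upsilon^\bullet(M)$) $$[\iota_X,\iota_Y]=0,\qquad[\nabla^s,\nabla^s]=0,\qquad[\iota_X,\nabla^s]=L^s_X,$$ $$[L^s_X,\iota_Y]=\iota_{[X,Y]_s},\qquad[L^s_X,L^s_Y]=L^s_{[X,Y]_s},\qquad[\nabla^s,L^s_X]=0$$ are satisfied if and only if the complete lift $X^c$ is a gradient Killing vector field for the Patterson-Walker metric $g_\nabla$ on $T^*M$.
   Context: $M$ is a smooth manifold of positive dimension; a connection on $M$ is an affine connection on $TM$, extended to tensor fields. $\Upsilon^r(M)=\Gamma(\mathrm{Sym}^rT^*M)$ is the space of totally symmetric covariant $r$-tensor fields, $\Upsilon^0(M)=C^\infty(M)$, $\Upsilon^\bullet(M)=\bigoplus_r\Upsilon^r(M)$. Brackets of operators are ordinary commutators $[D,D']=D\circ D'-D'\circ D$. $\iota_X$ is the contraction with $X$ in the first argument (zero on functions). The symmetric derivative is $\nabla^sf=df$ and $(\nabla^s\varphi)(X_1,\dots,X_{r+1})=\sum_j(\nabla_{X_j}\varphi)(X_1,\dots,\hat X_j,\dots,X_{r+1})$ for $\varphi\in\Upsilon^r(M)$. The symmetric Lie derivative is defined by $L^s_X=\iota_X\circ\nabla^s-\nabla^s\circ\iota_X$, and the symmetric bracket is $[X,Y]_s=\nabla_XY+\nabla_YX$. Let $\mathrm{pr}:T^*M\to M$. For $Y\in\mathfrak{X}(M)$, $Y^v\in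 C^\infty(T^*M)$ is $Y^v(\zeta)=\zeta(Y_{\mathrm{pr}(\zeta)})$; a vector field on $T^*M$ is determined by its action on all functions $Y^v$. The horizontal lift $X^{\mathrm h}$ of $X\in\mathfrak{X}(M)$ (for the dual connection on $T^*M$), the vertical lift $\alpha^{\mathrm v}$ of $\alpha\in\Omega^1(M)$ and the complete lift $X^c$ are the vector fields on $T^*M$ determined by $X^{\mathrm h}Y^v=(\nabla_XY)^v$, $\alpha^{\mathrm v}Y^v=\mathrm{pr}^*(\alpha(Y))$ and $X^cY^v=[X,Y]^v$ (Lie bracket). The Patterson-Walker metric $g_\nabla$ is the split-signature metric on $T^*M$ determined by $g_\nabla(X^{\mathrm h}+\alpha^{\mathrm v},Y^{\mathrm h}+\beta^{\mathrm v})=\mathrm{pr}^*(\alpha(Y)+\beta(X))$. A vector field $Q$ on $T^*M$ is a gradient Killing vector field for $g_\nabla$ if it is a Killing vector field for $g_\nabla$ and $Q=g_\nabla^{-1}(dF)$ for some $F\in C^\infty(T^*M)$. *)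

theory Defs
  imports "HOL-Analysis.Analysis" "HOL-Library.Multiset"
begin

section \<open>Smooth manifolds\<close>

primrec Ck_on :: "nat \<Rightarrow> 'e::real_normed_vector set \<Rightarrow> ('e \<Rightarrow> 'f::real_normed_vector) \<Rightarrow> bool" where
  "Ck_on 0 S f \<longleftrightarrow> continuous_on S f"
| "Ck_on (Suc k) S f \<longleftrightarrow> (\<forall>x\<in>S. f differentiable (at x)) \<and>
     (\<forall>v. Ck_on k S (\<lambda>x. frechet_derivative f (at x) v))"

text \<open>Only used for open sets of definition.\<close>

definition smooth_on :: "'e::real_normed_vector set \<Rightarrow> ('e \<Rightarrow> 'f::real_normed_vector) \<Rightarrow> bool" where
  "smooth_on S f \<longleftrightarrow> (\<forall>k. Ck_on k S f)"

text \<open>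
  A manifold is given by its atlas; the underlying set is the union of the chart domains and its
  topology is the one induced by the charts. The model space has type class
  \<open>euclidean_space\<close>, so its dimension is positive.
\<close>

type_synonym ('a, 'e) atlas = "('a set \<times> ('a \<Rightarrow> 'e)) set"

definition points :: "('a, 'e) atlas \<Rightarrow> 'a set" where
  "points A = (\<Union>(U, \<phi>)\<in>A. U)"

definition compatible_atlas :: "('a, 'e::euclidean_space) atlas \<Rightarrow> bool" where
  "compatible_atlas A \<longleftrightarrow>
     (\<forall>(U, \<phi>)\<in>A. inj_on \<phi> U \<and> open (\<phi> ` U)) \<and>
     (\<forall>(U, \<phi>)\<in>A. \<forall>(V, \<psi>)\<in>A. open (\<phi> ` (U \<inter> V)) \<and> smooth_on (\<phi> ` (U \<inter> V)) (\<psi> \<circ> inv_into U \<phi>))"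

definition atlas_open :: "('a, 'e::euclidean_space) atlas \<Rightarrow> 'a set \<Rightarrow> bool" where
  "atlas_open A W \<longleftrightarrow> W \<subseteq> points A \<and> (\<forall>(U, \<phi>)\<in>A. open (\<phi> ` (W \<inter> U)))"

definition atlas_topology :: "('a, 'e::euclidean_space) atlas \<Rightarrow> 'a topology" where
  "atlas_topology A = topology (atlas_open A)"

lemma openin_atlas_topology:
  assumes "compatible_atlas A"
  shows "openin (atlas_topology A) = atlas_open A"
proof -
  have "atlas_open A (S \<inter> T)" if S: "atlas_open A S" and T: "atlas_open A T" for S T
    unfolding atlas_open_def
  proof (intro conjI ballI, goal_cases)
    case 1
    show ?case
      using S by (auto simp: atlas_open_def)
  next
    case (2 c)
    obtain U \<phi> where c: "c = (U, \<phi>)" "(U, \<phi>) \<in> A"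
      using 2 by (cases c) auto
    then have "inj_on \<phi> U"
      using assms by (auto simp: compatible_atlas_def)
    then have "\<phi> ` (S \<inter> T \<inter> U) = \<phi> ` (S \<inter> U) \<inter> \<phi> ` (T \<inter> U)"
      unfolding inj_on_def by blast
    moreover have "open (\<phi> ` (S \<inter> U))" "open (\<phi> ` (T \<inter> U))"
      using S T c unfolding atlas_open_def by blast+
    ultimately show ?case
      using c by (simp add: open_Int)
  qed
  moreover have "atlas_open A (\<Union>K)" if K: "\<forall>S\<in>K. atlas_open A S" for K
    unfolding atlas_open_def
  proof (intro conjI ballI, goal_cases)
    case 1
    show ?case
      using K unfolding atlas_open_def by blast
  next
    case (2 c)
    obtain U \<phi> where c: "c = (U, \<phi>)" "(U, \<phi>) \<in> A"
      using 2 by (cases c) auto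
    have "\<phi> ` (\<Union>K \<inter> U) = (\<Union>S\<in>K. \<phi> ` (S \<inter> U))"
      by blast
    moreover have "open (\<phi> ` (S \<inter> U))" if "S \<in> K" for S
      using K c that unfolding atlas_open_def by blast
    ultimately show ?case
      using c by (simp add: open_UN)
  qed
  ultimately have "istopology (atlas_open A)"
    unfolding istopology_def by blast
  then show ?thesis
    by (simp add: atlas_topology_def)
qed

definition smooth_manifold :: "('a, 'e::euclidean_space) atlas \<Rightarrow> bool" where
  "smooth_manifold A \<longleftrightarrow> compatible_atlas A \<and>
     Hausdorff_space (atlas_topology A) \<and> second_countable (atlas_topology A)"

text \<open>
  All objects on a manifold (functions, tangent vectors, tensors) are total HOL functions that take
  the value 0 outside their domain of definition, so that equality in HOL is
  equality of the mathematical objects.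
\<close>

definition smooth_functions :: "('a, 'e::euclidean_space) atlas \<Rightarrow> ('a \<Rightarrow> real) set" where
  "smooth_functions A = {f. (\<forall>p. p \<notin> points A \<longrightarrow> f p = 0) \<and>
     (\<forall>(U, \<phi>)\<in>A. smooth_on (\<phi> ` U) (f \<circ> inv_into U \<phi>))}"


section \<open>Vector fields and symmetric tensor fields\<close>

type_synonym 'a tangent = "('a \<Rightarrow> real) \<Rightarrow> real"
type_synonym 'a covector = "'a tangent \<Rightarrow> real"
type_synonym 'a vfield = "'a \<Rightarrow> 'a tangent"
type_synonym 'a tensor = "'a \<Rightarrow> 'a tangent list \<Rightarrow> real"

text \<open>Tangent vectors at a point are the derivations of the algebra of smooth functions there.\<close>

definition tangent_space :: "('a, 'e::euclidean_space) atlas \<Rightarrow> 'a \<Rightarrow> 'a tangent set" where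
  "tangent_space A p = {v.
     (\<forall>f. f \<notin> smooth_functions A \<longrightarrow> v f = 0) \<and>
     (\<forall>f\<in>smooth_functions A. \<forall>h\<in>smooth_functions A. \<forall>a b.
        v (\<lambda>x. a * f x + b * h x) = a * v f + b * v h) \<and>
     (\<forall>f\<in>smooth_functions A. \<forall>h\<in>smooth_functions A.
        v (\<lambda>x. f x * h x) = f p * v h + h p * v f)}"

definition deriv_along :: "'a vfield \<Rightarrow> ('a \<Rightarrow> real) \<Rightarrow> 'a \<Rightarrow> real" where
  "deriv_along X f = (\<lambda>p. X p f)"

definition vector_fields :: "('a, 'e::euclidean_space) atlas \<Rightarrow> 'a vfield set" where
  "vector_fields A = {X.
     (\<forall>p\<in>points A. X p \<in> tangent_space A p) \<and>
     (\<forall>p. p \<notin> points A \<longrightarrow> X p = (\<lambda>_. 0)) \<and>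
     (\<forall>f\<in>smooth_functions A. deriv_along X f \<in> smooth_functions A)}"

definition vf_add :: "'a vfield \<Rightarrow> 'a vfield \<Rightarrow> 'a vfield" where
  "vf_add X Y = (\<lambda>p f. X p f + Y p f)"

definition vf_scale :: "('a \<Rightarrow> real) \<Rightarrow> 'a vfield \<Rightarrow> 'a vfield" where
  "vf_scale h X = (\<lambda>p f. h p * X p f)"

definition lie_bracket :: "'a vfield \<Rightarrow> 'a vfield \<Rightarrow> 'a vfield" where
  "lie_bracket X Y = (\<lambda>p f. X p (deriv_along Y f) - Y p (deriv_along X f))"

text \<open>
  A tensor is evaluated on a list of tangent vectors at a point; a covariant tensor
  of degree \<open>r\<close> vanishes on lists of any length other than \<open>r\<close>.
\<close>

definition apply_tensor :: "'a tensor \<Rightarrow> 'a vfield list \<Rightarrow> 'a \<Rightarrow> real" where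
  "apply_tensor \<phi> Xs = (\<lambda>p. \<phi> p (map (\<lambda>X. X p) Xs))"

definition sym_tensors :: "('a, 'e::euclidean_space) atlas \<Rightarrow> nat \<Rightarrow> 'a tensor set" where
  "sym_tensors A r = {\<phi>.
     (\<forall>p vs. \<not> (p \<in> points A \<and> length vs = r \<and> set vs \<subseteq> tangent_space A p) \<longrightarrow> \<phi> p vs = 0) \<and>
     (\<forall>p\<in>points A. \<forall>vs\<in>lists (tangent_space A p). \<forall>i<length vs.
        \<forall>v\<in>tangent_space A p. \<forall>w\<in>tangent_space A p. \<forall>a b.
          \<phi> p (vs[i := (\<lambda>f. a * v f + b * w f)]) = a * \<phi> p (vs[i := v]) + b * \<phi> p (vs[i := w])) \<and>
     (\<forall>p\<in>points A. \<forall>vs\<in>lists (tangent_space A p). \<forall>ws.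
        mset ws = mset vs \<longrightarrow> \<phi> p ws = \<phi> p vs) \<and>
     (\<forall>Xs\<in>lists (vector_fields A). apply_tensor \<phi> Xs \<in> smooth_functions A)}"

text \<open>
  The direct sum of the spaces of symmetric tensor fields of all degrees: the component of degree
  \<open>r\<close> of an element is its restriction to lists of length \<open>r\<close>. In degree 0 a function
  \<open>f\<close> is the tensor sending the empty list at \<open>p\<close> to \<open>f p\<close>.
\<close>

definition sym_tensor_algebra :: "('a, 'e::euclidean_space) atlas \<Rightarrow> 'a tensor set" where
  "sym_tensor_algebra A = {\<phi>. \<exists>n \<psi>. (\<forall>r<n. \<psi> r \<in> sym_tensors A r) \<and>
     \<phi> = (\<lambda>p vs. \<Sum>r<n. \<psi> r p vs)}"


section \<open>Connections and operators on symmetric tensor fields\<close>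

definition affine_connection ::
    "('a, 'e::euclidean_space) atlas \<Rightarrow> ('a vfield \<Rightarrow> 'a vfield \<Rightarrow> 'a vfield) \<Rightarrow> bool" where
  "affine_connection A nab \<longleftrightarrow>
     (\<forall>X\<in>vector_fields A. \<forall>Y\<in>vector_fields A. nab X Y \<in> vector_fields A) \<and>
     (\<forall>X\<in>vector_fields A. \<forall>Y\<in>vector_fields A. \<forall>Z\<in>vector_fields A.
        nab (vf_add X Y) Z = vf_add (nab X Z) (nab Y Z) \<and>
        nab X (vf_add Y Z) = vf_add (nab X Y) (nab X Z)) \<and>
     (\<forall>h\<in>smooth_functions A. \<forall>X\<in>vector_fields A. \<forall>Y\<in>vector_fields A.
        nab (vf_scale h X) Y = vf_scale h (nab X Y) \<and>
        nab X (vf_scale h Y) = vf_add (vf_scale (deriv_along X h) Y) (vf_scale h (nab X Y)))"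

definition torsion_free ::
    "('a, 'e::euclidean_space) atlas \<Rightarrow> ('a vfield \<Rightarrow> 'a vfield \<Rightarrow> 'a vfield) \<Rightarrow> bool" where
  "torsion_free A nab \<longleftrightarrow> (\<forall>X\<in>vector_fields A. \<forall>Y\<in>vector_fields A.
     (\<lambda>p f. nab X Y p f - nab Y X p f) = lie_bracket X Y)"

definition sym_bracket ::
    "('a vfield \<Rightarrow> 'a vfield \<Rightarrow> 'a vfield) \<Rightarrow> 'a vfield \<Rightarrow> 'a vfield \<Rightarrow> 'a vfield" where
  "sym_bracket nab X Y = vf_add (nab X Y) (nab Y X)"

text \<open>The contraction kills functions, since it never evaluates the tensor on the empty list.\<close>

definition contraction :: "'a vfield \<Rightarrow> 'a tensor \<Rightarrow> 'a tensor" where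
  "contraction X \<phi> = (\<lambda>p vs. \<phi> p (X p # vs))"

text \<open>The function \<open>(\<nabla>\<^sub>X \<phi>)(X\<^sub>1, \<dots>, X\<^sub>r)\<close>.\<close>

definition cov_deriv_apply ::
    "('a vfield \<Rightarrow> 'a vfield \<Rightarrow> 'a vfield) \<Rightarrow> 'a vfield \<Rightarrow> 'a tensor \<Rightarrow> 'a vfield list \<Rightarrow> 'a \<Rightarrow> real" where
  "cov_deriv_apply nab X \<phi> Xs = (\<lambda>p. deriv_along X (apply_tensor \<phi> Xs) p -
     (\<Sum>i<length Xs. apply_tensor \<phi> (Xs[i := nab X (Xs ! i)]) p))"

text \<open>
  The formula below specifies a tensor through its values on vector fields. On the empty list the
  sum is 0, and on a list with one element \<open>X\<close> the degree 0 part \<open>f\<close> of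
  \<open>\<phi>\<close> contributes \<open>X f\<close>, so that the symmetric derivative of \<open>f\<close>
  is its differential.
\<close>

definition sym_deriv ::
    "('a, 'e::euclidean_space) atlas \<Rightarrow> ('a vfield \<Rightarrow> 'a vfield \<Rightarrow> 'a vfield) \<Rightarrow> 'a tensor \<Rightarrow> 'a tensor" where
  "sym_deriv A nab \<phi> = (THE \<psi>. \<psi> \<in> sym_tensor_algebra A \<and>
     (\<forall>Xs\<in>lists (vector_fields A). apply_tensor \<psi> Xs =
        (\<lambda>p. \<Sum>j<length Xs. cov_deriv_apply nab (Xs ! j) \<phi> (take j Xs @ drop (Suc j) Xs) p)))"

definition commutator ::
    "('a tensor \<Rightarrow> 'a tensor) \<Rightarrow> ('a tensor \<Rightarrow> 'a tensor) \<Rightarrow> 'a tensor \<Rightarrow> 'a tensor" where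
  "commutator D E \<phi> = (\<lambda>p vs. D (E \<phi>) p vs - E (D \<phi>) p vs)"

definition zero_operator :: "'a tensor \<Rightarrow> 'a tensor" where
  "zero_operator \<phi> = (\<lambda>p vs. 0)"

definition sym_lie_deriv ::
    "('a, 'e::euclidean_space) atlas \<Rightarrow> ('a vfield \<Rightarrow> 'a vfield \<Rightarrow> 'a vfield) \<Rightarrow>
     'a vfield \<Rightarrow> 'a tensor \<Rightarrow> 'a tensor" where
  "sym_lie_deriv A nab X \<phi> = (\<lambda>p vs.
     contraction X (sym_deriv A nab \<phi>) p vs - sym_deriv A nab (contraction X \<phi>) p vs)"

definition operators_eq ::
    "('a, 'e::euclidean_space) atlas \<Rightarrow> ('a tensor \<Rightarrow> 'a tensor) \<Rightarrow> ('a tensor \<Rightarrow> 'a tensor) \<Rightarrow> bool" where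
  "operators_eq A D E \<longleftrightarrow> (\<forall>\<phi>\<in>sym_tensor_algebra A. D \<phi> = E \<phi>)"


section \<open>The cotangent bundle\<close>

definition cotangent_space :: "('a, 'e::euclidean_space) atlas \<Rightarrow> 'a \<Rightarrow> 'a covector set" where
  "cotangent_space A p = {\<zeta>.
     (\<forall>v. v \<notin> tangent_space A p \<longrightarrow> \<zeta> v = 0) \<and>
     (\<forall>v\<in>tangent_space A p. \<forall>w\<in>tangent_space A p. \<forall>a b.
        \<zeta> (\<lambda>f. a * v f + b * w f) = a * \<zeta> v + b * \<zeta> w)}"

definition cotangent_over :: "('a, 'e::euclidean_space) atlas \<Rightarrow> 'a set \<Rightarrow> ('a \<times> 'a covector) set" where
  "cotangent_over A U = (SIGMA p:U. cotangent_space A p)"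

text \<open>The partial derivative at \<open>p\<close> in the coordinate direction \<open>b\<close> of a chart.\<close>

definition coord_vector ::
    "('a, 'e::euclidean_space) atlas \<Rightarrow> 'a set \<times> ('a \<Rightarrow> 'e) \<Rightarrow> 'e \<Rightarrow> 'a \<Rightarrow> 'a tangent" where
  "coord_vector A c b p = (\<lambda>f. if f \<in> smooth_functions A
     then frechet_derivative (f \<circ> inv_into (fst c) (snd c)) (at (snd c p)) b else 0)"

text \<open>Each chart of the manifold induces one of the cotangent bundle, with model space the product
  of the model space with itself: a covector has fibre coordinates its values on the coordinate
  vectors.\<close>

definition cotangent_chart ::
    "('a, 'e::euclidean_space) atlas \<Rightarrow> 'a set \<times> ('a \<Rightarrow> 'e) \<Rightarrow> 'a \<times> 'a covector \<Rightarrow> 'e \<times> 'e" where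
  "cotangent_chart A c = (\<lambda>(p, \<zeta>). (snd c p, \<Sum>b\<in>Basis. \<zeta> (coord_vector A c b p) *\<^sub>R b))"

definition cotangent_atlas ::
    "('a, 'e::euclidean_space) atlas \<Rightarrow> ('a \<times> 'a covector, 'e \<times> 'e) atlas" where
  "cotangent_atlas A = (\<lambda>c. (cotangent_over A (fst c), cotangent_chart A c)) ` A"

definition pullback_function ::
    "('a, 'e::euclidean_space) atlas \<Rightarrow> ('a \<Rightarrow> real) \<Rightarrow> 'a \<times> 'a covector \<Rightarrow> real" where
  "pullback_function A f = (\<lambda>(p, \<zeta>). if (p, \<zeta>) \<in> cotangent_over A (points A) then f p else 0)"

definition vertical_function ::
    "('a, 'e::euclidean_space) atlas \<Rightarrow> 'a vfield \<Rightarrow> 'a \<times> 'a covector \<Rightarrow> real" where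
  "vertical_function A Y = (\<lambda>(p, \<zeta>). if (p, \<zeta>) \<in> cotangent_over A (points A) then \<zeta> (Y p) else 0)"

definition horizontal_lift ::
    "('a, 'e::euclidean_space) atlas \<Rightarrow> ('a vfield \<Rightarrow> 'a vfield \<Rightarrow> 'a vfield) \<Rightarrow>
     'a vfield \<Rightarrow> ('a \<times> 'a covector) vfield" where
  "horizontal_lift A nab X = (THE Q. Q \<in> vector_fields (cotangent_atlas A) \<and>
     (\<forall>Y\<in>vector_fields A.
        deriv_along Q (vertical_function A Y) = vertical_function A (nab X Y)))"

definition vertical_lift ::
    "('a, 'e::euclidean_space) atlas \<Rightarrow> 'a tensor \<Rightarrow> ('a \<times> 'a covector) vfield" where
  "vertical_lift A \<alpha> = (THE Q. Q \<in> vector_fields (cotangent_atlas A) \<and>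
     (\<forall>Y\<in>vector_fields A.
        deriv_along Q (vertical_function A Y) = pullback_function A (apply_tensor \<alpha> [Y])))"

definition complete_lift ::
    "('a, 'e::euclidean_space) atlas \<Rightarrow> 'a vfield \<Rightarrow> ('a \<times> 'a covector) vfield" where
  "complete_lift A X = (THE Q. Q \<in> vector_fields (cotangent_atlas A) \<and>
     (\<forall>Y\<in>vector_fields A.
        deriv_along Q (vertical_function A Y) = vertical_function A (lie_bracket X Y)))"


section \<open>The Patterson-Walker metric and Killing vector fields\<close>

definition pseudo_riemannian_metric :: "('a, 'e::euclidean_space) atlas \<Rightarrow> 'a tensor \<Rightarrow> bool" where
  "pseudo_riemannian_metric A g \<longleftrightarrow> g \<in> sym_tensors A 2 \<and>
     (\<forall>p\<in>points A. \<forall>v\<in>tangent_space A p.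
        (\<forall>w\<in>tangent_space A p. g p [v, w] = 0) \<longrightarrow> v = (\<lambda>_. 0))"

text \<open>At each point there is an orthonormal basis with as many positive as negative vectors.\<close>

definition split_signature :: "('a, 'e::euclidean_space) atlas \<Rightarrow> 'a tensor \<Rightarrow> bool" where
  "split_signature A g \<longleftrightarrow> (\<forall>p\<in>points A. \<exists>m e f. 2 * m = DIM('e) \<and>
     (\<forall>i<m::nat. e i \<in> tangent_space A p \<and> f i \<in> tangent_space A p) \<and>
     (\<forall>i<m. \<forall>j<m.
        g p [e i, e j] = (if i = j then 1 else 0) \<and>
        g p [f i, f j] = (if i = j then -1 else 0) \<and>
        g p [e i, f j] = 0))"

definition patterson_walker_metric ::
    "('a, 'e::euclidean_space) atlas \<Rightarrow> ('a vfield \<Rightarrow> 'a vfield \<Rightarrow> 'a vfield) \<Rightarrow> ('a \<times> 'a covector) tensor" where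
  "patterson_walker_metric A nab = (THE g.
     pseudo_riemannian_metric (cotangent_atlas A) g \<and> split_signature (cotangent_atlas A) g \<and>
     (\<forall>X\<in>vector_fields A. \<forall>Y\<in>vector_fields A. \<forall>\<alpha>\<in>sym_tensors A 1. \<forall>\<beta>\<in>sym_tensors A 1.
        apply_tensor g [vf_add (horizontal_lift A nab X) (vertical_lift A \<alpha>),
                        vf_add (horizontal_lift A nab Y) (vertical_lift A \<beta>)] =
        pullback_function A (\<lambda>p. apply_tensor \<alpha> [Y] p + apply_tensor \<beta> [X] p)))"

text \<open>The Lie derivative of \<open>g\<close> along \<open>Q\<close> vanishes.\<close>

definition killing :: "('a, 'e::euclidean_space) atlas \<Rightarrow> 'a tensor \<Rightarrow> 'a vfield \<Rightarrow> bool" where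
  "killing A g Q \<longleftrightarrow> Q \<in> vector_fields A \<and>
     (\<forall>P\<in>vector_fields A. \<forall>R\<in>vector_fields A. \<forall>p.
        deriv_along Q (apply_tensor g [P, R]) p
          - apply_tensor g [lie_bracket Q P, R] p - apply_tensor g [P, lie_bracket Q R] p = 0)"

definition differential :: "('a, 'e::euclidean_space) atlas \<Rightarrow> ('a \<Rightarrow> real) \<Rightarrow> 'a tensor" where
  "differential A F = (\<lambda>p vs.
     if p \<in> points A \<and> length vs = 1 \<and> set vs \<subseteq> tangent_space A p then hd vs F else 0)"

definition gradient_killing :: "('a, 'e::euclidean_space) atlas \<Rightarrow> 'a tensor \<Rightarrow> 'a vfield \<Rightarrow> bool" where
  "gradient_killing A g Q \<longleftrightarrow> killing A g Q \<and>
     (\<exists>F\<in>smooth_functions A. contraction Q g = differential A F)"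

end

theory Submission
  imports Defs "HOL-Combinatorics.List_Permutation"
begin

text \<open>
The six relations hold together exactly when the last one, \<open>[\<nabla>\<^sup>s, L\<^sup>s\<^sub>X] = 0\<close>, does.
The first three hold by symmetry and by definition. The fourth is a computation with the formula
\<open>(L\<^sup>s\<^sub>X \<phi>)(X\<^sub>1, \<dots>) = (\<nabla>\<^sub>X \<phi>)(X\<^sub>1, \<dots>) - (\<Sum>j. \<phi>(\<nabla>\<^bsub>X\<^sub>j\<^esub>X, \<dots>))\<close>
(\<open>apply_sym_lie_deriv\<close>, \<open>commutator_lie_contraction\<close>), and the fifth follows from the fourth and
the sixth by the Jacobi identity for commutators (\<open>commutator_lie_lie\<close>).

Both sides of the equivalence turn out to say that \<open>X\<close> is parallel and that \<open>R(X, Y)Z = 0\<close> for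
all \<open>Y\<close> and \<open>Z\<close>. On a function \<open>f\<close> the sixth commutator is \<open>Y \<mapsto> 2 (\<nabla>\<^sub>Y X) f\<close>, so the relation
forces \<open>\<nabla>X = 0\<close>. For a parallel field \<open>L\<^sup>s\<^sub>X = \<nabla>\<^sub>X\<close>, and by the Ricci identity the commutator inserts
\<open>R(X, X\<^sub>j)\<close> into the other arguments of \<open>\<phi>\<close>. On one-forms this gives \<open>R(X, Y)Z + R(X, Z)Y = 0\<close>, while
torsion-freeness and \<open>\<nabla>X = 0\<close> give \<open>R(X, Y)Z = R(X, Z)Y\<close>; hence the curvature term vanishes
(\<open>commutator_deriv_lie_iff\<close>).

On the cotangent bundle, suppose that the one-form \<open>g(X\<^sup>c, -)\<close> is exact. Evaluating the vanishing of its
exterior derivative on a horizontal lift \<open>Y\<^sup>h\<close> and a vertical lift \<open>\<beta>\<^sup>v\<close> gives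
\<open>2 \<beta>(\<nabla>\<^sub>Y X) = 0\<close>, so \<open>X\<close> is parallel (\<open>gradient_imp_parallel\<close>). Conversely, if \<open>X\<close> is parallel then
\<open>X\<^sup>c = X\<^sup>h\<close> is the gradient of the function \<open>X\<^sup>v\<close>. For such \<open>X\<close> the Lie derivative of \<open>g\<close> along \<open>X\<^sup>h\<close>
has a single component that can be nonzero, namely \<open>-\<zeta>(R(X, Y)Z + R(X, Z)Y)\<close> on \<open>Y\<^sup>h, Z\<^sup>h\<close>, and the
symmetry of \<open>R(X, Y)Z\<close> in \<open>Y\<close> and \<open>Z\<close> again turns its vanishing into \<open>R(X, Y)Z = 0\<close>
(\<open>gradient_killing_iff\<close>).

The symmetric derivative, the lifts and the metric are specified by descriptions, so their
existence and uniqueness has to be established. The tool for this is a local frame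
(\<open>frame_expansion\<close>): near every point there are global vector fields \<open>E\<^sub>b\<close>, global functions \<open>x\<^sub>b\<close> and a
bump function \<open>\<eta>\<close> with \<open>\<eta> v = (\<Sum>b. v(x\<^sub>b) E\<^sub>b)\<close> for all tangent vectors \<open>v\<close> at all points. It rests on the
Hadamard lemma and on bump functions, which come from the Hausdorff property. With frames,
tensoriality and smoothness become algebra with globally defined objects (\<open>linear_at_cong\<close>,
\<open>tensor_from_fields\<close>, \<open>smooth_local\<close>). Bump functions pull back along the projection, so the
cotangent bundle has frames too (\<open>cotangent_bump_atlas\<close>, \<open>chart_bump_lifted_frame\<close>), and a vector
field on it can be prescribed by its values on the functions \<open>Y\<^sup>v\<close> (\<open>lift_exists\<close>, \<open>lift_unique\<close>).
\<close>


section \<open>Smooth maps between open sets of normed spaces\<close>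

lemma has_derivative_cong_open:
  assumes "open S" "x \<in> S" "\<And>y. y \<in> S \<Longrightarrow> f y = g y"
  shows "(f has_derivative D) (at x) \<longleftrightarrow> (g has_derivative D) (at x)"
  using assms has_derivative_transform_within_open[of f D x UNIV S g]
    has_derivative_transform_within_open[of g D x UNIV S f] by auto

lemma frechet_derivative_cong_open:
  assumes "open S" "x \<in> S" "\<And>y. y \<in> S \<Longrightarrow> f y = g y"
  shows "frechet_derivative f (at x) = frechet_derivative g (at x)"
  unfolding frechet_derivative_def using has_derivative_cong_open[OF assms] by simp

lemma differentiable_cong_open:
  assumes "open S" "x \<in> S" "\<And>y. y \<in> S \<Longrightarrow> f y = g y"
  shows "f differentiable (at x) \<longleftrightarrow> g differentiable (at x)"
  unfolding differentiable_def using has_derivative_cong_open[OF assms] by simp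

lemma Ck_on_cong:
  assumes "open S" "\<And>x. x \<in> S \<Longrightarrow> f x = g x"
  shows "Ck_on k S f \<longleftrightarrow> Ck_on k S g"
  using assms(2)
proof (induction k arbitrary: f g)
  case 0
  then show ?case by (simp cong: continuous_on_cong)
next
  case (Suc k)
  have "Ck_on k S (\<lambda>x. frechet_derivative f (at x) v) \<longleftrightarrow> Ck_on k S (\<lambda>x. frechet_derivative g (at x) v)" for v
    by (intro Suc.IH) (simp add: frechet_derivative_cong_open[OF assms(1) _ Suc.prems])
  then show ?case
    using differentiable_cong_open[OF assms(1) _ Suc.prems] by simp
qed

text \<open>
Lets an explicit formula for the derivative stand in for the one that \<open>frechet_derivative\<close> picks.
\<close>

lemma Ck_on_SucI:
  assumes "open S" "\<And>x. x \<in> S \<Longrightarrow> (f has_derivative f' x) (at x)"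
    and "\<And>v. Ck_on k S (\<lambda>x. f' x v)"
  shows "Ck_on (Suc k) S f"
proof -
  have "Ck_on k S (\<lambda>x. frechet_derivative f (at x) v)" for v
    using assms(3)[of v] frechet_derivative_at[OF assms(2)]
    by (subst Ck_on_cong[OF assms(1), where g = "\<lambda>x. f' x v"]) auto
  then show ?thesis
    using assms(2) by (auto simp: differentiable_def)
qed

lemma Ck_on_SucD:
  assumes "Ck_on (Suc k) S f"
  shows "x \<in> S \<Longrightarrow> (f has_derivative frechet_derivative f (at x)) (at x)"
    and "Ck_on k S (\<lambda>x. frechet_derivative f (at x) v)"
  using assms by (auto simp: frechet_derivative_works)

lemma Ck_on_Suc_imp: "Ck_on (Suc k) S f \<Longrightarrow> Ck_on k S f"
proof (induction k arbitrary: f)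
  case 0
  then show ?case
    by (auto simp: continuous_on_eq_continuous_within intro: differentiable_imp_continuous_within
        differentiable_at_withinI)
next
  case (Suc k)
  have "Ck_on (Suc k) S (\<lambda>x. frechet_derivative f (at x) v)" for v
    using Suc.prems by (subst (asm) Ck_on.simps) blast
  then show ?case
    using Suc by auto
qed

lemma Ck_on_subset: "Ck_on k S f \<Longrightarrow> T \<subseteq> S \<Longrightarrow> Ck_on k T f"
  by (induction k arbitrary: f) (auto intro: continuous_on_subset)

lemma Ck_on_local:
  assumes "\<And>x. x \<in> S \<Longrightarrow> \<exists>T. open T \<and> x \<in> T \<and> Ck_on k T f"
  shows "Ck_on k S f"
  using assms
proof (induction k arbitrary: f)
  case 0
  then show ?case
    by (metis Ck_on.simps(1) continuous_at_imp_continuous_on continuous_on_eq_continuous_at)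
next
  case (Suc k)
  have "Ck_on k S (\<lambda>x. frechet_derivative f (at x) v)" for v
  proof (rule Suc.IH)
    fix x assume "x \<in> S"
    then obtain T where "open T" "x \<in> T" "Ck_on (Suc k) T f"
      using Suc.prems by blast
    then show "\<exists>T. open T \<and> x \<in> T \<and> Ck_on k T (\<lambda>x. frechet_derivative f (at x) v)"
      using Ck_on_SucD(2)[of k T f v] by auto
  qed
  moreover have "f differentiable (at x)" if x: "x \<in> S" for x
  proof -
    obtain T where "x \<in> T" "Ck_on (Suc k) T f"
      using Suc.prems[OF x] by blast
    then show ?thesis
      using Ck_on_SucD(1) differentiableI by blast
  qed
  ultimately show ?case
    unfolding Ck_on.simps(2) by blast
qed

lemma Ck_on_const: "open S \<Longrightarrow> Ck_on k S (\<lambda>_. c)"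
  by (induction k arbitrary: c) auto

lemma Ck_on_bounded_linear:
  assumes "open S" "bounded_linear L" "Ck_on k S f"
  shows "Ck_on k S (\<lambda>x. L (f x))"
  using assms(3)
proof (induction k arbitrary: f)
  case 0
  then show ?case
    using assms(2) by (auto intro: bounded_linear.continuous_on)
next
  case (Suc k)
  show ?case
  proof (rule Ck_on_SucI[OF assms(1)])
    show "((\<lambda>x. L (f x)) has_derivative (\<lambda>v. L (frechet_derivative f (at x) v))) (at x)" if "x \<in> S" for x
      using bounded_linear.has_derivative[OF assms(2) Ck_on_SucD(1)[OF Suc.prems that]] .
    show "Ck_on k S (\<lambda>x. L (frechet_derivative f (at x) v))" for v
      by (intro Suc.IH Ck_on_SucD(2)[OF Suc.prems])
  qed
qed

lemma Ck_on_linear: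
  assumes "open S" "bounded_linear L"
  shows "Ck_on k S L"
proof (cases k)
  case 0
  then show ?thesis
    using assms(2) by (simp add: linear_continuous_on)
next
  case (Suc k)
  then show ?thesis
    using Ck_on_SucI[OF assms(1) bounded_linear_imp_has_derivative[OF assms(2)] Ck_on_const[OF assms(1)]]
    by simp
qed

lemma Ck_on_add:
  assumes "open S" "Ck_on k S f" "Ck_on k S g"
  shows "Ck_on k S (\<lambda>x. f x + g x)"
  using assms(2,3)
proof (induction k arbitrary: f g)
  case 0
  then show ?case by (auto intro: continuous_on_add)
next
  case (Suc k)
  show ?case
    by (rule Ck_on_SucI[OF assms(1) has_derivative_add[OF Ck_on_SucD(1)[OF Suc.prems(1)]
              Ck_on_SucD(1)[OF Suc.prems(2)]] Suc.IH[OF Ck_on_SucD(2)[OF Suc.prems(1)]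
              Ck_on_SucD(2)[OF Suc.prems(2)]]])
qed

lemma Ck_on_sum:
  assumes "open S" "\<And>i. i \<in> I \<Longrightarrow> Ck_on k S (f i)"
  shows "Ck_on k S (\<lambda>x. \<Sum>i\<in>I. f i x)"
  using assms(2)
  by (induction I rule: infinite_finite_induct) (auto intro: Ck_on_const Ck_on_add assms(1))

lemma Ck_on_scaleR:
  fixes f :: "'e::real_normed_vector \<Rightarrow> real"
  assumes "open S" "Ck_on k S f" "Ck_on k S g"
  shows "Ck_on k S (\<lambda>x. f x *\<^sub>R g x)"
  using assms(2,3)
proof (induction k arbitrary: f g)
  case 0
  then show ?case by (auto intro: continuous_on_scaleR)
next
  case (Suc k)
  show ?case
  proof (rule Ck_on_SucI[OF assms(1) has_derivative_scaleR[OF Ck_on_SucD(1)[OF Suc.prems(1)]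
            Ck_on_SucD(1)[OF Suc.prems(2)]]])
    show "Ck_on k S (\<lambda>x. f x *\<^sub>R frechet_derivative g (at x) v + frechet_derivative f (at x) v *\<^sub>R g x)" for v
      by (intro Ck_on_add[OF assms(1)] Suc.IH Ck_on_SucD(2)[OF Suc.prems(1)]
          Ck_on_SucD(2)[OF Suc.prems(2)] Ck_on_Suc_imp[OF Suc.prems(1)] Ck_on_Suc_imp[OF Suc.prems(2)])
  qed
qed

lemma Ck_on_mult:
  fixes f g :: "'e::real_normed_vector \<Rightarrow> real"
  assumes "open S" "Ck_on k S f" "Ck_on k S g"
  shows "Ck_on k S (\<lambda>x. f x * g x)"
  using Ck_on_scaleR[OF assms] by simp

text \<open>
By the chain rule a directional derivative of the composite is the sum, over a basis of the middle
space, of products of a component of the derivative of \<open>f\<close> with a partial derivative of \<open>g\<close> at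
\<open>f x\<close>. These factors are one order less smooth, so the induction hypothesis covers them.
\<close>

lemma Ck_on_compose:
  fixes f :: "'e::real_normed_vector \<Rightarrow> 'f::euclidean_space" and g :: "'f \<Rightarrow> 'g::real_normed_vector"
  assumes "open S" "open T" "f ` S \<subseteq> T" "Ck_on k S f" "Ck_on k T g"
  shows "Ck_on k S (\<lambda>x. g (f x))"
  using assms(4,5)
proof (induction k arbitrary: g)
  case 0
  then show ?case using assms(3) by (auto intro: continuous_on_compose2)
next
  case (Suc k)
  let ?f = "\<lambda>x. frechet_derivative f (at x)" and ?g = "\<lambda>y. frechet_derivative g (at y)"
  have g: "(g has_derivative ?g (f x)) (at (f x))" if "x \<in> S" for x
    using Ck_on_SucD(1)[OF Suc.prems(2)] that assms(3) by blast
  show ?case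
  proof (rule Ck_on_SucI[OF assms(1)])
    fix x assume x: "x \<in> S"
    have *: "?g (f x) w = (\<Sum>b\<in>Basis. (w \<bullet> b) *\<^sub>R ?g (f x) b)" for w
    proof -
      interpret bounded_linear "?g (f x)"
        using g[OF x] by (rule has_derivative_bounded_linear)
      show ?thesis
        by (subst (1) euclidean_representation[of w, symmetric]) (simp add: sum scaleR)
    qed
    show "((\<lambda>x. g (f x)) has_derivative (\<lambda>v. \<Sum>b\<in>Basis. (?f x v \<bullet> b) *\<^sub>R ?g (f x) b)) (at x)"
      unfolding *[symmetric]
      by (rule has_derivative_compose[OF Ck_on_SucD(1)[OF Suc.prems(1) x] g[OF x]])
  next
    fix v
    show "Ck_on k S (\<lambda>x. \<Sum>b\<in>Basis. (?f x v \<bullet> b) *\<^sub>R ?g (f x) b)"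
      by (intro Ck_on_sum assms(1) Ck_on_scaleR
          Ck_on_bounded_linear[OF assms(1) bounded_linear_inner_left] Ck_on_SucD(2)[OF Suc.prems(1)]
          Suc.IH[OF Ck_on_Suc_imp[OF Suc.prems(1)] Ck_on_SucD(2)[OF Suc.prems(2)]])
  qed
qed

lemma Ck_on_inverse: "Ck_on k (- {0}) (inverse :: real \<Rightarrow> real)"
proof (induction k)
  case 0
  show ?case by (auto intro!: continuous_intros)
next
  case (Suc k)
  have o: "open (- {0::real})" by auto
  show ?case
  proof (rule Ck_on_SucI[OF o])
    show "(inverse has_derivative (\<lambda>v. - (inverse x * v * inverse x))) (at x)" if "x \<in> - {0::real}" for x
      using has_derivative_inverse'[of x UNIV] that by simp
    show "Ck_on k (- {0::real}) (\<lambda>x. - (inverse x * v * inverse x))" for v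
      by (intro Ck_on_bounded_linear[OF o bounded_linear_minus[OF bounded_linear_ident]]
            Ck_on_mult[OF o] Suc.IH Ck_on_const[OF o])
  qed
qed

lemma smooth_on_cong: "open S \<Longrightarrow> (\<And>x. x \<in> S \<Longrightarrow> f x = g x) \<Longrightarrow> smooth_on S f \<longleftrightarrow> smooth_on S g"
  by (simp add: smooth_on_def Ck_on_cong[of S f g])

lemma smooth_on_subset: "smooth_on S f \<Longrightarrow> T \<subseteq> S \<Longrightarrow> smooth_on T f"
  by (auto simp: smooth_on_def intro: Ck_on_subset)

lemma smooth_on_local:
  "(\<And>x. x \<in> S \<Longrightarrow> \<exists>T. open T \<and> x \<in> T \<and> smooth_on T f) \<Longrightarrow> smooth_on S f"
  unfolding smooth_on_def by (intro allI Ck_on_local) meson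

lemma smooth_on_frechet: "smooth_on S f \<Longrightarrow> smooth_on S (\<lambda>x. frechet_derivative f (at x) v)"
  by (simp add: smooth_on_def Ck_on_SucD(2))

lemma smooth_on_has_derivative:
  "smooth_on S f \<Longrightarrow> x \<in> S \<Longrightarrow> (f has_derivative frechet_derivative f (at x)) (at x)"
  using Ck_on_SucD(1)[of 0 S f x] by (simp only: smooth_on_def)

lemma smooth_on_imp_continuous_on: "smooth_on S f \<Longrightarrow> continuous_on S f"
  by (metis smooth_on_def Ck_on.simps(1))

lemma smooth_on_const: "open S \<Longrightarrow> smooth_on S (\<lambda>_. c)"
  by (simp add: smooth_on_def Ck_on_const)

lemma smooth_on_bounded_linear:
  "open S \<Longrightarrow> bounded_linear L \<Longrightarrow> smooth_on S f \<Longrightarrow> smooth_on S (\<lambda>x. L (f x))"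
  by (simp add: smooth_on_def Ck_on_bounded_linear)

lemma smooth_on_add:
  "open S \<Longrightarrow> smooth_on S f \<Longrightarrow> smooth_on S g \<Longrightarrow> smooth_on S (\<lambda>x. f x + g x)"
  by (simp add: smooth_on_def Ck_on_add)

lemma smooth_on_sum:
  "open S \<Longrightarrow> (\<And>i. i \<in> I \<Longrightarrow> smooth_on S (f i)) \<Longrightarrow> smooth_on S (\<lambda>x. \<Sum>i\<in>I. f i x)"
  by (simp add: smooth_on_def Ck_on_sum)

lemma smooth_on_mult:
  fixes f g :: "'e::real_normed_vector \<Rightarrow> real"
  shows "open S \<Longrightarrow> smooth_on S f \<Longrightarrow> smooth_on S g \<Longrightarrow> smooth_on S (\<lambda>x. f x * g x)"
  by (simp add: smooth_on_def Ck_on_mult)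

lemma smooth_on_linear: "open S \<Longrightarrow> bounded_linear L \<Longrightarrow> smooth_on S L"
  unfolding smooth_on_def using Ck_on_linear by blast

lemma smooth_on_compose:
  fixes f :: "'e::real_normed_vector \<Rightarrow> 'f::euclidean_space" and g :: "'f \<Rightarrow> 'g::real_normed_vector"
  assumes "open S" "open T" "f ` S \<subseteq> T" "smooth_on S f" "smooth_on T g"
  shows "smooth_on S (\<lambda>x. g (f x))"
  unfolding smooth_on_def
proof
  show "Ck_on k S (\<lambda>x. g (f x))" for k
    using assms(4,5) unfolding smooth_on_def by - (rule Ck_on_compose[OF assms(1-3), of k g], blast+)
qed

lemma smooth_on_Pair:
  assumes "open S" "smooth_on S f" "smooth_on S g"
  shows "smooth_on S (\<lambda>x. (f x, g x))"
proof -
  have "smooth_on S (\<lambda>x. (f x, 0) + (0, g x))"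
    by (rule smooth_on_add[OF assms(1)
          smooth_on_bounded_linear[OF assms(1) bounded_linear_Pair[OF bounded_linear_ident bounded_linear_zero] assms(2)]
          smooth_on_bounded_linear[OF assms(1) bounded_linear_Pair[OF bounded_linear_zero bounded_linear_ident] assms(3)]])
  then show ?thesis by simp
qed

lemma smooth_on_divide:
  fixes f g :: "'e::real_normed_vector \<Rightarrow> real"
  assumes "open S" "smooth_on S f" "smooth_on S g" "\<And>x. x \<in> S \<Longrightarrow> g x \<noteq> 0"
  shows "smooth_on S (\<lambda>x. f x / g x)"
  unfolding divide_inverse
proof (rule smooth_on_mult[OF assms(1,2)])
  have "smooth_on (- {0}) (inverse :: real \<Rightarrow> real)"
    by (simp add: smooth_on_def Ck_on_inverse)
  moreover have "open (- {0 :: real})" "g ` S \<subseteq> - {0}"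
    using assms(4) by auto
  ultimately show "smooth_on S (\<lambda>x. inverse (g x))"
    using smooth_on_compose[OF assms(1) _ _ assms(3)] by blast
qed


section \<open>Smooth step functions and the Hadamard lemma\<close>

text \<open>
The powers of \<open>x\<close> in the denominator make the family closed under differentiation up to linear
combinations, so that the smoothness of \<open>flat_exp 0\<close> can be proved for the whole family by induction.
\<close>

definition flat_exp :: "nat \<Rightarrow> real \<Rightarrow> real" where
  "flat_exp m x = (if x > 0 then exp (- (1 / x)) / x ^ m else 0)"

lemma flat_exp_limit: "((\<lambda>x::real. exp (- (1 / x)) / x ^ m) \<longlongrightarrow> 0) (at_right 0)"
proof -
  have "((\<lambda>x::real. inverse x ^ m / exp (inverse x)) \<longlongrightarrow> 0) (at_right 0)"
    by (rule filterlim_compose[OF tendsto_power_div_exp_0 filterlim_inverse_at_top_right])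
  then show ?thesis
    by (simp add: exp_minus divide_simps power_inverse mult.commute)
qed

lemma flat_exp_has_derivative:
  "(flat_exp m has_real_derivative flat_exp (m + 2) x - real m * flat_exp (m + 1) x) (at x)"
proof -
  consider "x > 0" | "x < 0" | "x = 0" by linarith
  then show ?thesis
  proof cases
    case 1
    have "((\<lambda>x. exp (- (1 / x)) / x ^ m) has_real_derivative
        flat_exp (m + 2) x - real m * flat_exp (m + 1) x) (at x)"
      using 1 by (auto intro!: derivative_eq_intros simp: flat_exp_def field_simps power2_eq_square)
        (cases m; simp add: field_simps)
    then show ?thesis
      by (rule has_field_derivative_transform_within_open[where S = "{0<..}"])
        (use 1 in \<open>auto simp: flat_exp_def\<close>)
  next
    case 2
    have "((\<lambda>x. 0) has_real_derivative flat_exp (m + 2) x - real m * flat_exp (m + 1) x) (at x)"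
      using 2 by (simp add: flat_exp_def)
    then show ?thesis
      by (rule has_field_derivative_transform_within_open[where S = "{..<0}"])
        (use 2 in \<open>auto simp: flat_exp_def\<close>)
  next
    case 3
    have "((\<lambda>h. (flat_exp m (0 + h) - flat_exp m 0) / h) \<longlongrightarrow> 0) (at_right 0)"
      by (rule Lim_transform_eventually[OF flat_exp_limit[of "Suc m"]])
        (auto simp: eventually_at_right_field flat_exp_def intro!: exI[of _ 1])
    moreover have "((\<lambda>h. (flat_exp m (0 + h) - flat_exp m 0) / h) \<longlongrightarrow> 0) (at_left 0)"
      by (rule Lim_transform_eventually[OF tendsto_const])
        (auto simp: eventually_at_left_field flat_exp_def intro!: exI[of _ "-1"])
    ultimately show ?thesis
      using 3 by (simp add: DERIV_def filterlim_split_at flat_exp_def)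
  qed
qed

lemma smooth_flat_exp: "smooth_on UNIV (flat_exp m)"
proof -
  have "Ck_on k UNIV (flat_exp m)" for k
  proof (induction k arbitrary: m)
    case 0
    show ?case
      using DERIV_isCont[OF flat_exp_has_derivative] by (simp add: continuous_on_eq_continuous_at)
  next
    case (Suc k)
    show ?case
    proof (rule Ck_on_SucI[OF open_UNIV])
      show "(flat_exp m has_derivative (\<lambda>v. (flat_exp (m + 2) x + (- real m) * flat_exp (m + 1) x) * v)) (at x)" for x
        using flat_exp_has_derivative[of m x] by (simp add: has_field_derivative_def)
      show "Ck_on k UNIV (\<lambda>x. (flat_exp (m + 2) x + (- real m) * flat_exp (m + 1) x) * v)" for v
        by (intro Ck_on_mult[OF open_UNIV] Ck_on_add[OF open_UNIV] Ck_on_const[OF open_UNIV] Suc.IH)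
    qed
  qed
  then show ?thesis
    by (simp add: smooth_on_def)
qed

text \<open>
The quotient of \<open>flat_exp 0 t\<close> by \<open>flat_exp 0 t + flat_exp 0 (1 - t)\<close>: of the two summands the first
vanishes exactly for \<open>t \<le> 0\<close> and the second exactly for \<open>t \<ge> 1\<close>, so the denominator is never zero.
\<close>

lemma smooth_step:
  obtains h :: "real \<Rightarrow> real" where
    "smooth_on UNIV h" "\<And>t. t \<le> 0 \<Longrightarrow> h t = 0" "\<And>t. t \<ge> 1 \<Longrightarrow> h t = 1"
proof
  let ?h = "\<lambda>t. flat_exp 0 t / (flat_exp 0 t + flat_exp 0 (1 - t))"
  have "smooth_on UNIV (\<lambda>t. (1 :: real) + (- 1) * t)"
    by (intro smooth_on_add smooth_on_mult smooth_on_const smooth_on_linear[OF _ bounded_linear_ident] open_UNIV)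
  from smooth_on_compose[OF open_UNIV open_UNIV _ this smooth_flat_exp]
  have "smooth_on UNIV (\<lambda>t. flat_exp 0 (1 + (- 1) * t))"
    by auto
  then have "smooth_on UNIV (\<lambda>t. flat_exp 0 t + flat_exp 0 (1 - t))"
    by (intro smooth_on_add smooth_flat_exp open_UNIV) simp
  moreover have "flat_exp 0 t + flat_exp 0 (1 - t) \<noteq> 0" for t
    by (cases "t > 0"; cases "t < 1") (auto simp: flat_exp_def add_pos_pos add_pos_nonneg add_nonneg_pos
        intro!: less_imp_neq[symmetric])
  ultimately show "smooth_on UNIV ?h"
    by (intro smooth_on_divide open_UNIV smooth_flat_exp)
qed (auto simp: flat_exp_def)

lemma smooth_bump:
  fixes a :: "'e::euclidean_space"
  assumes "0 < r" "r < R"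
  shows "\<exists>h :: 'e \<Rightarrow> real. smooth_on UNIV h \<and>
    (\<forall>y. dist a y \<le> r \<longrightarrow> h y = 1) \<and> (\<forall>y. dist a y \<ge> R \<longrightarrow> h y = 0)"
proof -
  obtain s :: "real \<Rightarrow> real" where s: "smooth_on UNIV s" "\<And>t. t \<le> 0 \<Longrightarrow> s t = 0" "\<And>t. t \<ge> 1 \<Longrightarrow> s t = 1"
    using smooth_step by blast
  \<comment> \<open>The affine function of the squared distance with value 1 at radius \<open>r\<close> and 0 at radius \<open>R\<close>.\<close>
  define q where "q y = R\<^sup>2 / (R\<^sup>2 - r\<^sup>2) + (- 1 / (R\<^sup>2 - r\<^sup>2)) *
      (\<Sum>b\<in>Basis. (- (a \<bullet> b) + y \<bullet> b) * (- (a \<bullet> b) + y \<bullet> b))" for y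
  have pos: "R\<^sup>2 - r\<^sup>2 > 0"
    using assms by (simp add: power_strict_mono)
  have q: "q y = (R\<^sup>2 - (dist a y)\<^sup>2) / (R\<^sup>2 - r\<^sup>2)" for y
  proof -
    have "(\<Sum>b\<in>Basis. (- (a \<bullet> b) + y \<bullet> b) * (- (a \<bullet> b) + y \<bullet> b)) = (y - a) \<bullet> (y - a)"
      by (subst euclidean_inner) (simp add: inner_diff_left)
    also have "\<dots> = (dist a y)\<^sup>2"
      by (simp add: dist_norm norm_minus_commute[of a] power2_norm_eq_inner)
    finally show ?thesis
      by (simp only: q_def) (simp add: diff_divide_distrib)
  qed
  have "smooth_on UNIV q"
    unfolding q_def
    by (intro smooth_on_add smooth_on_mult smooth_on_sum smooth_on_const open_UNIV
        smooth_on_linear[OF open_UNIV bounded_linear_inner_left])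
  from smooth_on_compose[OF open_UNIV open_UNIV _ this s(1)]
  have "smooth_on UNIV (\<lambda>y. s (q y))"
    by auto
  moreover have "s (q y) = 1" if "dist a y \<le> r" for y
  proof (rule s(3))
    have "(dist a y)\<^sup>2 \<le> r\<^sup>2"
      using that by (simp add: power_mono)
    then show "1 \<le> q y"
      using pos by (simp add: q)
  qed
  moreover have "s (q y) = 0" if "dist a y \<ge> R" for y
  proof (rule s(2))
    have "(dist a y)\<^sup>2 \<ge> R\<^sup>2"
      using that assms by (intro power_mono) auto
    then show "q y \<le> 0"
      using pos by (simp add: q divide_nonpos_pos)
  qed
  ultimately show ?thesis
    by blast
qed

lemma convex_segment_mem:
  assumes "convex C" "a \<in> C" "y \<in> C" "t \<in> {0..1::real}"
  shows "a + t *\<^sub>R (y - a) \<in> C"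
  using convexD_alt[OF assms(1-3), of t] assms(4) by (simp add: algebra_simps)

text \<open>
Differentiation under the integral sign replaces \<open>F\<close> by a directional derivative of \<open>F\<close> and raises the
exponent of \<open>t\<close> by one; with an arbitrary exponent the statement reproduces itself in the induction.
\<close>

lemma Ck_on_segment_integral:
  fixes F :: "'e::euclidean_space \<Rightarrow> real"
  assumes "open C" "convex C" "a \<in> C"
  shows "smooth_on C F \<Longrightarrow> Ck_on k C (\<lambda>y. integral (cbox 0 1) (\<lambda>t. t ^ m * F (a + t *\<^sub>R (y - a))))"
proof (induction k arbitrary: m F)
  have cont: "continuous_on (C \<times> cbox 0 1) (\<lambda>z. snd z ^ m * G (a + snd z *\<^sub>R (fst z - a)))"
    if "smooth_on C G" for m and G :: "'e \<Rightarrow> real"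
  proof -
    have "continuous_on (C \<times> cbox 0 1) (\<lambda>z. G (a + snd z *\<^sub>R (fst z - a)))"
      by (rule continuous_on_compose2[OF smooth_on_imp_continuous_on[OF that]])
        (use convex_segment_mem[OF assms(2,3)] in \<open>auto intro!: continuous_intros\<close>)
    then show ?thesis
      by (intro continuous_intros)
  qed
  {
    case 0
    show ?case
      using integral_continuous_on_param[where f = "\<lambda>y t. t ^ m * F (a + t *\<^sub>R (y - a))" and U = C and a = 0 and b = "1::real"]
        cont[OF 0, of m] by (simp add: case_prod_beta')
  next
    case (Suc k)
    let ?D = "\<lambda>z. frechet_derivative F (at z)"
    let ?f = "\<lambda>y t. t ^ m * F (a + t *\<^sub>R (y - a))"
    let ?f' = "\<lambda>y t. \<Sum>b\<in>Basis. (t ^ Suc m * ?D (a + t *\<^sub>R (y - a)) b) *\<^sub>R blinfun_inner_left b"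
    have D: "?D z v = (\<Sum>b\<in>Basis. (v \<bullet> b) * ?D z b)" if "z \<in> C" for z v
    proof -
      interpret bounded_linear "?D z"
        by (rule has_derivative_bounded_linear[OF smooth_on_has_derivative[OF Suc.prems that]])
      show ?thesis
        by (subst (1) euclidean_representation[of v, symmetric]) (simp add: sum scaleR)
    qed
    have f'_apply: "blinfun_apply (?f' y t) v = t ^ Suc m * ?D (a + t *\<^sub>R (y - a)) v"
      if "y \<in> C" "t \<in> cbox 0 1" for y t v
    proof -
      have "a + t *\<^sub>R (y - a) \<in> C"
        using convex_segment_mem[OF assms(2,3)] that by auto
      then show ?thesis
        by (simp add: D[of _ v] blinfun.sum_left blinfun.scaleR_left sum_distrib_left mult_ac)
    qed
    have f: "((\<lambda>y. ?f y t) has_derivative blinfun_apply (?f' y t)) (at y within C)"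
      if "y \<in> C" "t \<in> cbox 0 1" for y t
    proof -
      have mem: "a + t *\<^sub>R (y - a) \<in> C"
        using convex_segment_mem[OF assms(2,3)] that by auto
      interpret bounded_linear "?D (a + t *\<^sub>R (y - a))"
        by (rule has_derivative_bounded_linear[OF smooth_on_has_derivative[OF Suc.prems mem]])
      have "((\<lambda>y. a + t *\<^sub>R (y - a)) has_derivative (\<lambda>v. t *\<^sub>R v)) (at y within C)"
        by (auto intro!: derivative_eq_intros)
      from has_derivative_compose[OF this smooth_on_has_derivative[OF Suc.prems mem]]
      have "((\<lambda>y. F (a + t *\<^sub>R (y - a))) has_derivative (\<lambda>v. ?D (a + t *\<^sub>R (y - a)) (t *\<^sub>R v))) (at y within C)" .
      from has_derivative_mult_right[OF this, of "t ^ m"] show ?thesis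
        by (rule has_derivative_eq_rhs) (rule ext, simp only: f'_apply[OF that], simp add: scaleR mult_ac)
    qed
    have cont': "continuous_on (C \<times> cbox 0 1) (\<lambda>(y, t). ?f' y t)"
      unfolding case_prod_beta'
      by (intro continuous_on_sum continuous_on_scaleR continuous_on_const cont smooth_on_frechet Suc.prems)
    have slice: "continuous_on (cbox 0 1) (Pair y)" "Pair y ` cbox 0 (1::real) \<subseteq> C \<times> cbox 0 1"
      if "y \<in> C" for y
      using that by (auto intro!: continuous_intros)
    have int: "?f y integrable_on cbox 0 1" if "y \<in> C" for y
      using continuous_on_compose2[OF cont[OF Suc.prems, of m] slice[OF that]]
      by (intro integrable_continuous) simp
    have int': "?f' y integrable_on cbox 0 1" if "y \<in> C" for y
      using continuous_on_compose2[OF cont' slice[OF that]]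
      by (intro integrable_continuous) simp
    show ?case
    proof (rule Ck_on_SucI[OF assms(1)])
      fix y assume y: "y \<in> C"
      have "((\<lambda>y. integral (cbox 0 1) (?f y)) has_derivative integral (cbox 0 1) (?f' y)) (at y within C)"
        using leibniz_rule[OF f int cont' y assms(2)] by blast
      moreover have "blinfun_apply (integral (cbox 0 1) (?f' y)) v =
          integral (cbox 0 1) (\<lambda>t. t ^ Suc m * ?D (a + t *\<^sub>R (y - a)) v)" for v
        unfolding blinfun_apply_integral[OF int'[OF y]]
        by (rule integral_cong) (use f'_apply[OF y] in auto)
      ultimately show "((\<lambda>y. integral (cbox 0 1) (?f y)) has_derivative
          (\<lambda>v. integral (cbox 0 1) (\<lambda>t. t ^ Suc m * ?D (a + t *\<^sub>R (y - a)) v))) (at y)"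
        using at_within_open[OF y assms(1)] by (metis (no_types, lifting) ext)
    next
      show "Ck_on k C (\<lambda>y. integral (cbox 0 1) (\<lambda>t. t ^ Suc m * ?D (a + t *\<^sub>R (y - a)) v))" for v
        by (rule Suc.IH[OF smooth_on_frechet[OF Suc.prems]])
    qed
  }
qed

text \<open>
The fundamental theorem of calculus on the segment from \<open>a\<close> to \<open>y\<close>: the functions \<open>g b\<close> are the averages
of the partial derivatives of \<open>f\<close> over that segment.
\<close>

lemma hadamard:
  fixes f :: "'e::euclidean_space \<Rightarrow> real"
  assumes "open C" "convex C" "a \<in> C" "smooth_on C f"
  obtains g where "\<And>b. smooth_on C (g b)" "\<And>b. g b a = frechet_derivative f (at a) b"
    "\<And>y. y \<in> C \<Longrightarrow> f y = f a + (\<Sum>b\<in>Basis. ((y - a) \<bullet> b) * g b y)"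
proof
  let ?D = "\<lambda>z. frechet_derivative f (at z)"
  let ?g = "\<lambda>b y. integral (cbox 0 1) (\<lambda>t. t ^ 0 * ?D (a + t *\<^sub>R (y - a)) b)"
  show "smooth_on C (?g b)" for b
    unfolding smooth_on_def by (intro allI Ck_on_segment_integral assms smooth_on_frechet)
  show "?g b a = ?D a b" for b
    by simp
  fix y assume y: "y \<in> C"
  have mem: "a + t *\<^sub>R (y - a) \<in> C" if "t \<in> {0..1}" for t
    using convex_segment_mem[OF assms(2,3) y that] .
  have D: "?D z v = (\<Sum>b\<in>Basis. (v \<bullet> b) * ?D z b)" if "z \<in> C" for z v
  proof -
    interpret bounded_linear "?D z"
      by (rule has_derivative_bounded_linear[OF smooth_on_has_derivative[OF assms(4) that]])
    show ?thesis
      by (subst (1) euclidean_representation[of v, symmetric]) (simp add: sum scaleR)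
  qed
  have "((\<lambda>t. f (a + t *\<^sub>R (y - a))) has_vector_derivative ?D (a + t *\<^sub>R (y - a)) (y - a)) (at t within {0..1})"
    if t: "t \<in> {0..1}" for t
  proof -
    interpret bounded_linear "?D (a + t *\<^sub>R (y - a))"
      by (rule has_derivative_bounded_linear[OF smooth_on_has_derivative[OF assms(4) mem[OF t]]])
    have "((\<lambda>t. a + t *\<^sub>R (y - a)) has_derivative (\<lambda>s. s *\<^sub>R (y - a))) (at t within {0..1})"
      by (auto intro!: derivative_eq_intros)
    from has_derivative_compose[OF this smooth_on_has_derivative[OF assms(4) mem[OF t]]]
    show ?thesis
      by (simp add: has_vector_derivative_def scaleR)
  qed
  then have "((\<lambda>t. ?D (a + t *\<^sub>R (y - a)) (y - a)) has_integral f (a + 1 *\<^sub>R (y - a)) - f (a + 0 *\<^sub>R (y - a))) {0..1}"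
    by (intro fundamental_theorem_of_calculus) auto
  then have "f y - f a = integral {0..1} (\<lambda>t. ?D (a + t *\<^sub>R (y - a)) (y - a))"
    by (simp add: integral_unique)
  also have "\<dots> = integral {0..1} (\<lambda>t. \<Sum>b\<in>Basis. ((y - a) \<bullet> b) * ?D (a + t *\<^sub>R (y - a)) b)"
    by (rule integral_cong) (use D[OF mem] in blast)
  also have "\<dots> = (\<Sum>b\<in>Basis. integral {0..1} (\<lambda>t. ((y - a) \<bullet> b) * ?D (a + t *\<^sub>R (y - a)) b))"
  proof (rule integral_sum)
    fix b :: 'e
    have "continuous_on {0..1} (\<lambda>t. ?D (a + t *\<^sub>R (y - a)) b)"
      by (rule continuous_on_compose2[OF smooth_on_imp_continuous_on[OF smooth_on_frechet[OF assms(4)]]])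
        (use mem in \<open>auto intro!: continuous_intros\<close>)
    then show "(\<lambda>t. ((y - a) \<bullet> b) * ?D (a + t *\<^sub>R (y - a)) b) integrable_on {0..1}"
      by (intro integrable_continuous_real continuous_intros)
  qed simp
  finally show "f y = f a + (\<Sum>b\<in>Basis. ((y - a) \<bullet> b) * ?g b y)"
    by simp
qed


section \<open>Functions, tangent vectors and vector fields of an atlas\<close>

locale charted =
  fixes A :: "('a, 'e::euclidean_space) atlas"
  assumes compatible: "compatible_atlas A"
begin

lemma chart_inj: "(U, \<phi>) \<in> A \<Longrightarrow> inj_on \<phi> U"
  and chart_open: "(U, \<phi>) \<in> A \<Longrightarrow> open (\<phi> ` U)"
  and transition_open: "(U, \<phi>) \<in> A \<Longrightarrow> (V, \<psi>) \<in> A \<Longrightarrow> open (\<phi> ` (U \<inter> V))"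
  and transition_smooth:
    "(U, \<phi>) \<in> A \<Longrightarrow> (V, \<psi>) \<in> A \<Longrightarrow> smooth_on (\<phi> ` (U \<inter> V)) (\<psi> \<circ> inv_into U \<phi>)"
  using compatible unfolding compatible_atlas_def by fast+

lemma chart_inv: "(U, \<phi>) \<in> A \<Longrightarrow> p \<in> U \<Longrightarrow> inv_into U \<phi> (\<phi> p) = p"
  using chart_inj by simp

lemma chart_points: "(U, \<phi>) \<in> A \<Longrightarrow> p \<in> U \<Longrightarrow> p \<in> points A"
  by (auto simp: points_def)

lemma pointsE:
  assumes "p \<in> points A"
  obtains U \<phi> where "(U, \<phi>) \<in> A" "p \<in> U"
  using assms by (auto simp: points_def)

lemma smoothD: "f \<in> smooth_functions A \<Longrightarrow> (U, \<phi>) \<in> A \<Longrightarrow> smooth_on (\<phi> ` U) (\<lambda>y. f (inv_into U \<phi> y))"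
  and smooth_outside: "f \<in> smooth_functions A \<Longrightarrow> p \<notin> points A \<Longrightarrow> f p = 0"
  by (auto simp: smooth_functions_def o_def)

lemma smoothI:
  assumes "\<And>p. p \<notin> points A \<Longrightarrow> f p = 0"
    and "\<And>U \<phi>. (U, \<phi>) \<in> A \<Longrightarrow> smooth_on (\<phi> ` U) (\<lambda>y. f (inv_into U \<phi> y))"
  shows "f \<in> smooth_functions A"
  using assms by (auto simp: smooth_functions_def o_def)

lemma smooth_add:
  "f \<in> smooth_functions A \<Longrightarrow> g \<in> smooth_functions A \<Longrightarrow> (\<lambda>p. f p + g p) \<in> smooth_functions A"
  by (rule smoothI) (auto simp: smooth_outside intro: smooth_on_add smoothD chart_open)

lemma smooth_mult:
  "f \<in> smooth_functions A \<Longrightarrow> g \<in> smooth_functions A \<Longrightarrow> (\<lambda>p. f p * g p) \<in> smooth_functions A"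
  by (rule smoothI) (auto simp: smooth_outside intro: smooth_on_mult smoothD chart_open)

lemma smooth_const: "(\<lambda>p. if p \<in> points A then k else 0) \<in> smooth_functions A"
proof (rule smoothI)
  fix U \<phi> assume c: "(U, \<phi>) \<in> A"
  have "smooth_on (\<phi> ` U) (\<lambda>_. k)"
    by (rule smooth_on_const[OF chart_open[OF c]])
  then show "smooth_on (\<phi> ` U) (\<lambda>y. if inv_into U \<phi> y \<in> points A then k else 0)"
    by (rule smooth_on_cong[OF chart_open[OF c], THEN iffD1, rotated])
      (use chart_points[OF c] inv_into_into[of _ \<phi> U] in auto)
qed auto

lemma smooth_zero: "(\<lambda>p. 0) \<in> smooth_functions A"
  using smooth_const[of 0] by simp

lemma smooth_scale: "f \<in> smooth_functions A \<Longrightarrow> (\<lambda>p. k * f p) \<in> smooth_functions A"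
proof -
  assume f: "f \<in> smooth_functions A"
  have "(\<lambda>p. k * f p) = (\<lambda>p. (if p \<in> points A then k else 0) * f p)"
    using smooth_outside[OF f] by auto
  then show ?thesis
    using smooth_mult[OF smooth_const f, of k] by simp
qed

lemma smooth_minus: "f \<in> smooth_functions A \<Longrightarrow> (\<lambda>p. - f p) \<in> smooth_functions A"
  using smooth_scale[of f "-1"] by simp

lemma smooth_diff:
  "f \<in> smooth_functions A \<Longrightarrow> g \<in> smooth_functions A \<Longrightarrow> (\<lambda>p. f p - g p) \<in> smooth_functions A"
  using smooth_add[of f "\<lambda>p. - g p"] smooth_minus[of g] by simp

lemma smooth_sum:
  "(\<And>i. i \<in> I \<Longrightarrow> f i \<in> smooth_functions A) \<Longrightarrow> (\<lambda>p. \<Sum>i\<in>I. f i p) \<in> smooth_functions A"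
  by (induction I rule: infinite_finite_induct) (auto intro: smooth_add smooth_zero)

text \<open>
Locality of smoothness in a form that mentions no neighbourhoods: near \<open>p\<close> the function is the quotient
of the smooth functions \<open>\<eta> f\<close> and \<open>\<eta>\<close>. With the factor \<open>\<eta>\<close> of a frame, the smoothness of an object reduces to
that of its components.
\<close>

lemma smooth_local:
  assumes "\<And>p. p \<notin> points A \<Longrightarrow> f p = 0"
    and "\<And>p. p \<in> points A \<Longrightarrow>
      \<exists>\<eta>\<in>smooth_functions A. \<eta> p \<noteq> 0 \<and> (\<lambda>q. \<eta> q * f q) \<in> smooth_functions A"
  shows "f \<in> smooth_functions A"
proof (rule smoothI[OF assms(1)])
  fix U \<phi> assume c: "(U, \<phi>) \<in> A"
  let ?i = "inv_into U \<phi>"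
  show "smooth_on (\<phi> ` U) (\<lambda>y. f (?i y))"
  proof (rule smooth_on_local)
    fix x assume x: "x \<in> \<phi> ` U"
    then have "?i x \<in> points A"
      using chart_points[OF c] inv_into_into by metis
    then obtain \<eta> where \<eta>: "\<eta> \<in> smooth_functions A" "\<eta> (?i x) \<noteq> 0"
        "(\<lambda>q. \<eta> q * f q) \<in> smooth_functions A"
      using assms(2) by blast
    let ?T = "\<phi> ` U \<inter> (\<lambda>y. \<eta> (?i y)) -` (- {0})"
    have T: "open ?T"
      by (rule continuous_open_preimage[OF smooth_on_imp_continuous_on[OF smoothD[OF \<eta>(1) c]] chart_open[OF c]]) auto
    have "smooth_on ?T (\<lambda>y. \<eta> (?i y) * f (?i y) / \<eta> (?i y))"
      by (rule smooth_on_divide[OF T smooth_on_subset[OF smoothD[OF \<eta>(3) c]] smooth_on_subset[OF smoothD[OF \<eta>(1) c]]])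
        auto
    then have "smooth_on ?T (\<lambda>y. f (?i y))"
      by (rule smooth_on_cong[OF T, THEN iffD1, rotated]) auto
    then show "\<exists>T. open T \<and> x \<in> T \<and> smooth_on T (\<lambda>y. f (?i y))"
      using T x \<eta>(2) by (intro exI[of _ ?T]) simp
  qed
qed

text \<open>
A function that is smooth in one chart over the region \<open>C\<close> is smooth on the manifold if it vanishes on an
open set which covers the complement of that region.
\<close>

lemma smooth_chart_extension:
  assumes c: "(U, \<phi>) \<in> A" and C: "open C" "C \<subseteq> \<phi> ` U" and h: "smooth_on C (\<lambda>y. h (inv_into U \<phi> y))"
    and V: "atlas_open A V" "V \<union> {q \<in> U. \<phi> q \<in> C} = points A" "\<And>q. q \<in> V \<Longrightarrow> h q = 0"
    and out: "\<And>q. q \<notin> points A \<Longrightarrow> h q = 0"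
  shows "h \<in> smooth_functions A"
proof (rule smoothI[OF out])
  fix U' \<psi> assume c': "(U', \<psi>) \<in> A"
  let ?i = "inv_into U' \<psi>"
  show "smooth_on (\<psi> ` U') (\<lambda>y. h (?i y))"
  proof (rule smooth_on_local)
    fix x assume "x \<in> \<psi> ` U'"
    then obtain q where q: "q \<in> U'" "x = \<psi> q" by auto
    then have "q \<in> V \<union> {q \<in> U. \<phi> q \<in> C}"
      using V(2) chart_points[OF c'] by auto
    then show "\<exists>T. open T \<and> x \<in> T \<and> smooth_on T (\<lambda>y. h (?i y))"
    proof
      assume "q \<in> V"
      have T: "open (\<psi> ` (V \<inter> U'))"
        using V(1) c' by (auto simp: atlas_open_def)
      have "smooth_on (\<psi> ` (V \<inter> U')) (\<lambda>y. h (?i y))"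
        by (rule smooth_on_cong[OF T, THEN iffD1, OF _ smooth_on_const[OF T, of 0]])
          (auto simp: chart_inv[OF c'] V(3))
      with T show ?thesis
        using \<open>q \<in> V\<close> q by blast
    next
      assume "q \<in> {q \<in> U. \<phi> q \<in> C}"
      then have qU: "q \<in> U" "\<phi> q \<in> C" by auto
      let ?T = "\<psi> ` (U' \<inter> U) \<inter> (\<phi> \<circ> ?i) -` C"
      have T: "open ?T"
        by (rule continuous_open_preimage[OF smooth_on_imp_continuous_on[OF transition_smooth[OF c' c]]
              transition_open[OF c' c] C(1)])
      have "smooth_on ?T (\<phi> \<circ> ?i)"
        by (rule smooth_on_subset[OF transition_smooth[OF c' c]]) auto
      from smooth_on_compose[OF T C(1) _ this h]
      have "smooth_on ?T (\<lambda>y. h (inv_into U \<phi> ((\<phi> \<circ> ?i) y)))"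
        by blast
      then have "smooth_on ?T (\<lambda>y. h (?i y))"
        by (rule smooth_on_cong[OF T, THEN iffD1, rotated])
          (auto simp: chart_inv[OF c'] chart_inv[OF c])
      with T show ?thesis
        using q qU chart_inv[OF c' q(1)] by (intro exI[of _ ?T]) auto
    qed
  qed
qed

lemma tangent_vanish: "v \<in> tangent_space A p \<Longrightarrow> f \<notin> smooth_functions A \<Longrightarrow> v f = 0"
  and tangent_linear: "v \<in> tangent_space A p \<Longrightarrow> f \<in> smooth_functions A \<Longrightarrow> h \<in> smooth_functions A \<Longrightarrow>
     v (\<lambda>x. a * f x + b * h x) = a * v f + b * v h"
  and tangent_mult: "v \<in> tangent_space A p \<Longrightarrow> f \<in> smooth_functions A \<Longrightarrow> h \<in> smooth_functions A \<Longrightarrow>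
     v (\<lambda>x. f x * h x) = f p * v h + h p * v f"
  by (auto simp: tangent_space_def)

lemma tangent_add: "v \<in> tangent_space A p \<Longrightarrow> f \<in> smooth_functions A \<Longrightarrow> h \<in> smooth_functions A \<Longrightarrow>
     v (\<lambda>x. f x + h x) = v f + v h"
  using tangent_linear[of v p f h 1 1] by simp

lemma tangent_diff: "v \<in> tangent_space A p \<Longrightarrow> f \<in> smooth_functions A \<Longrightarrow> h \<in> smooth_functions A \<Longrightarrow>
     v (\<lambda>x. f x - h x) = v f - v h"
  using tangent_linear[of v p f h 1 "-1"] by simp

lemma tangent_scale: "v \<in> tangent_space A p \<Longrightarrow> f \<in> smooth_functions A \<Longrightarrow> v (\<lambda>x. k * f x) = k * v f"
  using tangent_linear[of v p f f k 0] by simp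

lemma tangent_zero: "v \<in> tangent_space A p \<Longrightarrow> v (\<lambda>x. 0) = 0"
  using tangent_scale[of v p "\<lambda>x. 0" 0] smooth_zero by simp

lemma tangent_sum: "v \<in> tangent_space A p \<Longrightarrow> (\<And>i. i \<in> I \<Longrightarrow> f i \<in> smooth_functions A) \<Longrightarrow>
     v (\<lambda>x. \<Sum>i\<in>I. f i x) = (\<Sum>i\<in>I. v (f i))"
  proof (induction I rule: infinite_finite_induct)
  case (insert i I)
  then show ?case
    using tangent_add[OF insert.prems(1), of "f i" "\<lambda>x. \<Sum>i\<in>I. f i x"] by (simp add: smooth_sum)
qed (auto simp: tangent_zero)

text \<open>
The constant function 1 is its own square, so the product rule gives \<open>v 1 = 2 v 1\<close>.
\<close>

lemma tangent_const:
  assumes "v \<in> tangent_space A p" "p \<in> points A"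
  shows "v (\<lambda>x. if x \<in> points A then k else 0) = 0"
proof -
  let ?c = "\<lambda>k x. if x \<in> points A then k else (0::real)"
  have "v (\<lambda>x. ?c 1 x * ?c 1 x) = v (?c 1) + v (?c 1)"
    using tangent_mult[OF assms(1) smooth_const smooth_const, of 1 1] assms(2) by simp
  moreover have "(\<lambda>x. ?c 1 x * ?c 1 x) = ?c 1" by auto
  ultimately have "v (?c 1) = 0" by simp
  moreover have "?c k = (\<lambda>x. k * ?c 1 x)" by auto
  ultimately show ?thesis
    using tangent_scale[OF assms(1) smooth_const, of k 1] by simp
qed

lemma tangent_space_combination:
  assumes "v \<in> tangent_space A p" "w \<in> tangent_space A p"
  shows "(\<lambda>f. a * v f + b * w f) \<in> tangent_space A p"
  using assms by (auto simp: tangent_space_def algebra_simps)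

lemma tangent_space_zero: "(\<lambda>f. 0) \<in> tangent_space A p"
  by (auto simp: tangent_space_def)

lemma tangent_space_scale: "v \<in> tangent_space A p \<Longrightarrow> (\<lambda>f. a * v f) \<in> tangent_space A p"
  using tangent_space_combination[of v p v a 0] by simp

lemma tangent_space_sum:
  "(\<And>i. i \<in> I \<Longrightarrow> v i \<in> tangent_space A p) \<Longrightarrow> (\<lambda>f. \<Sum>i\<in>I. k i * v i f) \<in> tangent_space A p"
proof (induction I rule: infinite_finite_induct)
  case (insert i I)
  then show ?case
    using tangent_space_combination[of "v i" p "\<lambda>f. \<Sum>i\<in>I. k i * v i f" "k i" 1] by simp
qed (auto simp: tangent_space_zero)

lemma coord_vector_tangent:
  assumes c: "(U, \<phi>) \<in> A" and p: "p \<in> U"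
  shows "coord_vector A (U, \<phi>) b p \<in> tangent_space A p"
proof -
  let ?i = "inv_into U \<phi>" and ?x = "\<phi> p"
  have x: "?x \<in> \<phi> ` U" using p by simp
  have D: "((\<lambda>y. f (?i y)) has_derivative frechet_derivative (\<lambda>y. f (?i y)) (at ?x)) (at ?x)"
    if "f \<in> smooth_functions A" for f
    by (rule smooth_on_has_derivative[OF smoothD[OF that c] x])
  have lin: "frechet_derivative (\<lambda>y. k * f (?i y) + l * h (?i y)) (at ?x) =
      (\<lambda>v. k * frechet_derivative (\<lambda>y. f (?i y)) (at ?x) v + l * frechet_derivative (\<lambda>y. h (?i y)) (at ?x) v)"
    if "f \<in> smooth_functions A" "h \<in> smooth_functions A" for f h k l
    by (rule frechet_derivative_at[symmetric])
      (intro has_derivative_add has_derivative_mult_right D that)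
  have mult: "frechet_derivative (\<lambda>y. f (?i y) * h (?i y)) (at ?x) =
      (\<lambda>v. f (?i ?x) * frechet_derivative (\<lambda>y. h (?i y)) (at ?x) v +
           frechet_derivative (\<lambda>y. f (?i y)) (at ?x) v * h (?i ?x))"
    if "f \<in> smooth_functions A" "h \<in> smooth_functions A" for f h
    by (rule frechet_derivative_at[symmetric]) (intro has_derivative_mult D that)
  show ?thesis
    unfolding tangent_space_def coord_vector_def
    by (auto simp: o_def lin mult smooth_add smooth_mult smooth_scale chart_inv[OF c p])
qed

lemma vector_fieldD:
  assumes "X \<in> vector_fields A"
  shows "p \<in> points A \<Longrightarrow> X p \<in> tangent_space A p"
    and "p \<notin> points A \<Longrightarrow> X p = (\<lambda>_. 0)"
    and "f \<in> smooth_functions A \<Longrightarrow> (\<lambda>p. X p f) \<in> smooth_functions A"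
  using assms by (auto simp: vector_fields_def deriv_along_def)

lemma vector_fieldI:
  assumes "\<And>p. p \<in> points A \<Longrightarrow> X p \<in> tangent_space A p"
    and "\<And>p. p \<notin> points A \<Longrightarrow> X p = (\<lambda>_. 0)"
    and "\<And>f. f \<in> smooth_functions A \<Longrightarrow> (\<lambda>p. X p f) \<in> smooth_functions A"
  shows "X \<in> vector_fields A"
  using assms by (auto simp: vector_fields_def deriv_along_def)

lemma vf_sum_mem:
  assumes "\<And>i. i \<in> I \<Longrightarrow> h i \<in> smooth_functions A" "\<And>i. i \<in> I \<Longrightarrow> X i \<in> vector_fields A"
  shows "(\<lambda>p f. \<Sum>i\<in>I. h i p * X i p f) \<in> vector_fields A"
proof (rule vector_fieldI)
  show "(\<lambda>f. \<Sum>i\<in>I. h i p * X i p f) \<in> tangent_space A p" if "p \<in> points A" for p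
    by (rule tangent_space_sum) (use assms(2) vector_fieldD(1) that in auto)
  show "(\<lambda>f. \<Sum>i\<in>I. h i p * X i p f) = (\<lambda>_. 0)" if "p \<notin> points A" for p
    using assms(2) vector_fieldD(2) that by (auto intro!: ext sum.neutral)
  show "(\<lambda>p. \<Sum>i\<in>I. h i p * X i p f) \<in> smooth_functions A" if "f \<in> smooth_functions A" for f
    by (intro smooth_sum smooth_mult assms(1) vector_fieldD(3)[OF assms(2)] that)
qed

lemma vf_scale_mem: "h \<in> smooth_functions A \<Longrightarrow> X \<in> vector_fields A \<Longrightarrow> vf_scale h X \<in> vector_fields A"
  using vf_sum_mem[of "{()}" "\<lambda>_. h" "\<lambda>_. X"] by (simp add: vf_scale_def)

lemma vf_add_mem: "X \<in> vector_fields A \<Longrightarrow> Y \<in> vector_fields A \<Longrightarrow> vf_add X Y \<in> vector_fields A"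
  by (rule vector_fieldI)
    (use tangent_space_combination[where a = 1 and b = 1] vector_fieldD(1)
      in \<open>auto simp: vf_add_def vector_fieldD(2) intro: smooth_add vector_fieldD(3)\<close>)

lemma vf_zero_mem: "(\<lambda>p f. 0) \<in> vector_fields A"
  using vf_sum_mem[of "{}"] by simp

lemma lie_bracket_mem:
  assumes "X \<in> vector_fields A" "Y \<in> vector_fields A"
  shows "lie_bracket X Y \<in> vector_fields A"
proof (rule vector_fieldI)
  note X = vector_fieldD[OF assms(1)] and Y = vector_fieldD[OF assms(2)]
  show "(\<lambda>p. lie_bracket X Y p f) \<in> smooth_functions A" if "f \<in> smooth_functions A" for f
    unfolding lie_bracket_def deriv_along_def by (intro smooth_diff X(3) Y(3) that)
  show "lie_bracket X Y p = (\<lambda>_. 0)" if "p \<notin> points A" for p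
    using X(2)[OF that] Y(2)[OF that] by (simp add: lie_bracket_def)
  fix p assume p: "p \<in> points A"
  note Xp = X(1)[OF p] and Yp = Y(1)[OF p]
  have "(\<lambda>q. X q f) = (\<lambda>q. 0)" "(\<lambda>q. Y q f) = (\<lambda>q. 0)" if "f \<notin> smooth_functions A" for f
    using X(1,2) Y(1,2) tangent_vanish that by (metis)+
  then have "lie_bracket X Y p f = 0" if "f \<notin> smooth_functions A" for f
    using that tangent_zero[OF Xp] tangent_zero[OF Yp] by (simp add: lie_bracket_def deriv_along_def)
  moreover have lin: "(\<lambda>q. Z q (\<lambda>x. a * f x + b * h x)) = (\<lambda>q. a * Z q f + b * Z q h)"
    if "Z \<in> vector_fields A" "f \<in> smooth_functions A" "h \<in> smooth_functions A" for Z f h a b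
  proof
    show "Z q (\<lambda>x. a * f x + b * h x) = a * Z q f + b * Z q h" for q
      using tangent_linear[OF vector_fieldD(1)[OF that(1)] that(2,3)] vector_fieldD(2)[OF that(1), of q]
      by (cases "q \<in> points A") simp_all
  qed
  moreover have mult: "(\<lambda>q. Z q (\<lambda>x. f x * h x)) = (\<lambda>q. f q * Z q h + h q * Z q f)"
    if "Z \<in> vector_fields A" "f \<in> smooth_functions A" "h \<in> smooth_functions A" for Z f h
  proof
    show "Z q (\<lambda>x. f x * h x) = f q * Z q h + h q * Z q f" for q
      using tangent_mult[OF vector_fieldD(1)[OF that(1)] that(2,3)] vector_fieldD(2)[OF that(1), of q]
      by (cases "q \<in> points A") simp_all
  qed
  ultimately show "lie_bracket X Y p \<in> tangent_space A p"
    unfolding tangent_space_def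
    by (auto simp: lie_bracket_def deriv_along_def assms X(3) Y(3) smooth_mult algebra_simps
        tangent_linear[OF Xp] tangent_linear[OF Yp] tangent_mult[OF Xp] tangent_mult[OF Yp]
        tangent_add[OF Xp] tangent_add[OF Yp])
qed

end

section \<open>Bump functions in charts and the expansion of tangent vectors\<close>

text \<open>
A pair of cut-off functions for the chart \<open>c\<close>. The function \<open>\<eta>\<close> is supported in the region given by the
convex set \<open>C\<close>, where the Hadamard lemma applies; \<open>\<theta>\<close> equals 1 on this region and is supported in the chart
domain, so that products with \<open>\<theta>\<close> extend objects from the chart to the manifold without changing them
where \<open>\<eta>\<close> is nonzero. Supports are described by open sets on which the functions vanish.
\<close>

definition chart_bump ::
    "('a, 'e::euclidean_space) atlas \<Rightarrow> 'a set \<times> ('a \<Rightarrow> 'e) \<Rightarrow> ('a \<Rightarrow> real) \<Rightarrow> ('a \<Rightarrow> real) \<Rightarrow> 'e set \<Rightarrow> bool" where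
  "chart_bump A c \<eta> \<theta> C \<longleftrightarrow> c \<in> A \<and> \<eta> \<in> smooth_functions A \<and> \<theta> \<in> smooth_functions A \<and>
     open C \<and> convex C \<and> C \<subseteq> snd c ` fst c \<and> (\<forall>q\<in>fst c. snd c q \<in> C \<longrightarrow> \<theta> q = 1) \<and>
     (\<exists>V. atlas_open A V \<and> V \<union> {q \<in> fst c. snd c q \<in> C} = points A \<and> (\<forall>q\<in>V. \<eta> q = 0)) \<and>
     (\<exists>W. atlas_open A W \<and> W \<union> fst c = points A \<and> (\<forall>q\<in>W. \<theta> q = 0))"

definition cut_coord :: "('a \<Rightarrow> real) \<Rightarrow> 'a set \<times> ('a \<Rightarrow> 'e::euclidean_space) \<Rightarrow> 'e \<Rightarrow> 'a \<Rightarrow> real" where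
  "cut_coord \<theta> c b = (\<lambda>q. if q \<in> fst c then \<theta> q * (snd c q \<bullet> b) else 0)"

definition cut_vector ::
    "('a, 'e::euclidean_space) atlas \<Rightarrow> ('a \<Rightarrow> real) \<Rightarrow> 'a set \<times> ('a \<Rightarrow> 'e) \<Rightarrow> 'e \<Rightarrow> 'a vfield" where
  "cut_vector A \<eta> c b = (\<lambda>q f. if q \<in> fst c then \<eta> q * coord_vector A c b q f else 0)"

context charted begin

text \<open>
Truncation turns a smooth function of the coordinates into a smooth function on the manifold.
\<close>

lemma cut_function_smooth:
  assumes c: "(U, \<phi>) \<in> A" and h: "smooth_on (\<phi> ` U) h" and \<theta>: "\<theta> \<in> smooth_functions A"
    and W: "atlas_open A W" "W \<union> U = points A" "\<And>q. q \<in> W \<Longrightarrow> \<theta> q = 0"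
  shows "(\<lambda>q. if q \<in> U then \<theta> q * h (\<phi> q) else 0) \<in> smooth_functions A"
proof (rule smooth_chart_extension[OF c chart_open[OF c] order_refl _ W(1)])
  let ?i = "inv_into U \<phi>"
  have "smooth_on (\<phi> ` U) (\<lambda>y. \<theta> (?i y) * h y)"
    by (intro smooth_on_mult chart_open[OF c] smoothD[OF \<theta> c] h)
  then show "smooth_on (\<phi> ` U) (\<lambda>y. if ?i y \<in> U then \<theta> (?i y) * h (\<phi> (?i y)) else 0)"
    by (rule smooth_on_cong[OF chart_open[OF c], THEN iffD1, rotated]) (auto simp: chart_inv[OF c])
  show "W \<union> {q \<in> U. \<phi> q \<in> \<phi> ` U} = points A"
    using W(2) by auto
qed (use W(3) chart_points[OF c] in auto)

lemma chart_bumpD: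
  assumes "chart_bump A (U, \<phi>) \<eta> \<theta> C"
  shows "(U, \<phi>) \<in> A" "\<eta> \<in> smooth_functions A" "\<theta> \<in> smooth_functions A" "open C" "convex C" "C \<subseteq> \<phi> ` U"
    "\<And>q. q \<in> U \<Longrightarrow> \<phi> q \<in> C \<Longrightarrow> \<theta> q = 1"
    "\<And>q. q \<in> points A \<Longrightarrow> \<not> (q \<in> U \<and> \<phi> q \<in> C) \<Longrightarrow> \<eta> q = 0"
    "\<exists>V. atlas_open A V \<and> V \<union> {q \<in> U. \<phi> q \<in> C} = points A \<and> (\<forall>q\<in>V. \<eta> q = 0)"
    "\<exists>V. atlas_open A V \<and> V \<union> U = points A \<and> (\<forall>q\<in>V. \<eta> q = 0)"
    "\<exists>V. atlas_open A V \<and> V \<union> U = points A \<and> (\<forall>q\<in>V. \<theta> q = 0)"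
proof -
  show 1: "(U, \<phi>) \<in> A" and "\<eta> \<in> smooth_functions A" "\<theta> \<in> smooth_functions A" "open C" "convex C" "C \<subseteq> \<phi> ` U"
    "\<And>q. q \<in> U \<Longrightarrow> \<phi> q \<in> C \<Longrightarrow> \<theta> q = 1"
    and 2: "\<exists>V. atlas_open A V \<and> V \<union> {q \<in> U. \<phi> q \<in> C} = points A \<and> (\<forall>q\<in>V. \<eta> q = 0)"
    and "\<exists>V. atlas_open A V \<and> V \<union> U = points A \<and> (\<forall>q\<in>V. \<theta> q = 0)"
    using assms by (auto simp: chart_bump_def)
  show "\<And>q. q \<in> points A \<Longrightarrow> \<not> (q \<in> U \<and> \<phi> q \<in> C) \<Longrightarrow> \<eta> q = 0"
    using 2 by blast
  obtain V where V: "atlas_open A V" "V \<union> {q \<in> U. \<phi> q \<in> C} = points A" "\<forall>q\<in>V. \<eta> q = 0"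
    using 2 by blast
  moreover have "V \<union> U = points A"
    using V(2) chart_points[OF 1] by blast
  ultimately show "\<exists>V. atlas_open A V \<and> V \<union> U = points A \<and> (\<forall>q\<in>V. \<eta> q = 0)"
    by blast
qed

lemma cut_coord_smooth:
  assumes "chart_bump A (U, \<phi>) \<eta> \<theta> C"
  shows "cut_coord \<theta> (U, \<phi>) b \<in> smooth_functions A"
proof -
  note B = chart_bumpD[OF assms]
  obtain W where "atlas_open A W" "W \<union> U = points A" "\<forall>q\<in>W. \<theta> q = 0"
    using B(11) by blast
  then show ?thesis
    using cut_function_smooth[OF B(1) smooth_on_linear[OF chart_open[OF B(1)] bounded_linear_inner_left] B(3), of W b]
    by (simp add: cut_coord_def cong: if_cong)
qed

lemma cut_vector_mem:
  assumes c: "(U, \<phi>) \<in> A" and \<eta>: "\<eta> \<in> smooth_functions A"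
    and "\<exists>V. atlas_open A V \<and> V \<union> U = points A \<and> (\<forall>q\<in>V. \<eta> q = 0)"
  shows "cut_vector A \<eta> (U, \<phi>) b \<in> vector_fields A"
proof -
  obtain V where V: "atlas_open A V" "V \<union> U = points A" "\<And>q. q \<in> V \<Longrightarrow> \<eta> q = 0"
    using assms(3) by blast
  show ?thesis
  proof (rule vector_fieldI)
    show "cut_vector A \<eta> (U, \<phi>) b p \<in> tangent_space A p" for p
      using tangent_space_scale[OF coord_vector_tangent[OF c, of p b]] tangent_space_zero
      by (cases "p \<in> U") (simp_all add: cut_vector_def)
    show "cut_vector A \<eta> (U, \<phi>) b p = (\<lambda>_. 0)" if "p \<notin> points A" for p
      using chart_points[OF c, of p] that by (auto simp: cut_vector_def fun_eq_iff)
    fix f assume f: "f \<in> smooth_functions A"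
    have "smooth_on (\<phi> ` U) (\<lambda>x. frechet_derivative (\<lambda>y. f (inv_into U \<phi> y)) (at x) b)"
      by (rule smooth_on_frechet[OF smoothD[OF f c]])
    from cut_function_smooth[OF c this \<eta> V]
    show "(\<lambda>p. cut_vector A \<eta> (U, \<phi>) b p f) \<in> smooth_functions A"
      using f by (simp add: cut_vector_def coord_vector_def o_def cong: if_cong)
  qed
qed

lemma cut_vector_cut_coord:
  assumes "chart_bump A (U, \<phi>) \<eta> \<theta> C" "b \<in> Basis" "b' \<in> Basis" "q \<in> points A"
  shows "cut_vector A \<eta> (U, \<phi>) b q (cut_coord \<theta> (U, \<phi>) b') = (if b = b' then \<eta> q else 0)"
proof (cases "q \<in> U \<and> \<phi> q \<in> C")
  note B = chart_bumpD[OF assms(1)]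
  case True
  have "frechet_derivative (\<lambda>y. cut_coord \<theta> (U, \<phi>) b' (inv_into U \<phi> y)) (at (\<phi> q)) =
      frechet_derivative (\<lambda>y. y \<bullet> b') (at (\<phi> q))"
    by (rule frechet_derivative_cong_open[OF B(4)])
      (use True B(6,7) chart_inv[OF B(1)] in \<open>auto simp: cut_coord_def\<close>)
  also have "\<dots> = (\<lambda>v. v \<bullet> b')"
    by (rule frechet_derivative_at[symmetric]) (auto intro: derivative_eq_intros)
  finally show ?thesis
    using True cut_coord_smooth[OF assms(1)] assms(2,3)
    by (simp add: cut_vector_def coord_vector_def o_def inner_Basis)
next
  case False
  then show ?thesis
    using chart_bumpD(8)[OF assms(1,4)] by (simp add: cut_vector_def)
qed

text \<open>
Apply the derivation \<open>v\<close> to the Hadamard expansion of \<open>f\<close> around \<open>q\<close>, multiplied by \<open>\<eta>\<close> to make it an identity of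
global functions: \<open>\<eta> (f - f(q)) = (\<Sum>b. (x\<^sub>b - x\<^sub>b(q)) H\<^sub>b)\<close>. Every summand has a factor vanishing at \<open>q\<close>, so by the
product rule only \<open>v(x\<^sub>b) H\<^sub>b(q)\<close> survives, and \<open>H\<^sub>b(q)\<close> is the partial derivative times \<open>\<eta>(q)\<close>.
\<close>

lemma frame_expansion:
  assumes bump: "chart_bump A (U, \<phi>) \<eta> \<theta> C" and q: "q \<in> points A" and v: "v \<in> tangent_space A q"
    and f: "f \<in> smooth_functions A"
  shows "\<eta> q * v f = (\<Sum>b\<in>Basis. v (cut_coord \<theta> (U, \<phi>) b) * cut_vector A \<eta> (U, \<phi>) b q f)"
proof (cases "q \<in> U \<and> \<phi> q \<in> C")
  note B = chart_bumpD[OF bump]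
  case True
  let ?i = "inv_into U \<phi>" and ?x = "cut_coord \<theta> (U, \<phi>)"
  let ?c = "\<lambda>k p. if p \<in> points A then k else (0::real)"
  have "smooth_on C (\<lambda>y. f (?i y))"
    by (rule smooth_on_subset[OF smoothD[OF f B(1)] B(6)])
  from hadamard[OF B(4,5) _ this, of "\<phi> q"] True
  obtain g where g: "\<And>b. smooth_on C (g b)" "\<And>b. g b (\<phi> q) = frechet_derivative (\<lambda>y. f (?i y)) (at (\<phi> q)) b"
    "\<And>y. y \<in> C \<Longrightarrow> f (?i y) = f (?i (\<phi> q)) + (\<Sum>b\<in>Basis. ((y - \<phi> q) \<bullet> b) * g b y)"
    by blast
  define H where "H b = (\<lambda>p. if p \<in> U \<and> \<phi> p \<in> C then \<eta> p * g b (\<phi> p) else 0)" for b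
  have H: "H b \<in> smooth_functions A" for b
  proof -
    obtain V where V: "atlas_open A V" "V \<union> {q \<in> U. \<phi> q \<in> C} = points A" "\<forall>q\<in>V. \<eta> q = 0"
      using B(9) by blast
    show ?thesis
    proof (rule smooth_chart_extension[OF B(1,4,6) _ V(1,2)])
      have "smooth_on C (\<lambda>y. \<eta> (?i y) * g b y)"
        by (intro smooth_on_mult B(4) g(1) smooth_on_subset[OF smoothD[OF B(2,1)] B(6)])
      then show "smooth_on C (\<lambda>y. H b (?i y))"
        by (rule smooth_on_cong[OF B(4), THEN iffD1, rotated])
          (use B(6) chart_inv[OF B(1)] in \<open>auto simp: H_def\<close>)
    qed (use V(3) chart_points[OF B(1)] in \<open>auto simp: H_def\<close>)
  qed
  \<comment> \<open>Constants are cut off outside the manifold, where all functions are 0.\<close>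
  have eq: "\<eta> p * f p - f q * \<eta> p = (\<Sum>b\<in>Basis. (?x b p - ?c (\<phi> q \<bullet> b) p) * H b p)" for p
  proof (cases "p \<in> U \<and> \<phi> p \<in> C")
    case True
    have "f p = f q + (\<Sum>b\<in>Basis. ((\<phi> p - \<phi> q) \<bullet> b) * g b (\<phi> p))"
      using g(3)[of "\<phi> p"] True \<open>q \<in> U \<and> \<phi> q \<in> C\<close> chart_inv[OF B(1)] by simp
    then have "\<eta> p * f p - f q * \<eta> p = (\<Sum>b\<in>Basis. ((\<phi> p - \<phi> q) \<bullet> b) * (\<eta> p * g b (\<phi> p)))"
      by (simp add: algebra_simps sum_distrib_left)
    also have "\<dots> = (\<Sum>b\<in>Basis. (?x b p - ?c (\<phi> q \<bullet> b) p) * H b p)"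
      using True B(7)[of p] chart_points[OF B(1), of p]
      by (intro sum.cong) (auto simp: cut_coord_def H_def inner_diff_left)
    finally show ?thesis .
  next
    case False
    then have "\<eta> p = 0"
      using B(8)[of p] smooth_outside[OF B(2), of p] by blast
    then show ?thesis
      using False by (auto simp: H_def intro!: sum.neutral)
  qed
  have x: "?x b \<in> smooth_functions A" for b
    by (rule cut_coord_smooth[OF bump])
  have "v (\<lambda>p. \<eta> p * f p - f q * \<eta> p) = \<eta> q * v f"
    using tangent_diff[OF v smooth_mult[OF B(2) f] smooth_scale[OF B(2)]] tangent_mult[OF v B(2) f]
      tangent_scale[OF v B(2)] by simp
  moreover have "v (\<lambda>p. \<Sum>b\<in>Basis. (?x b p - ?c (\<phi> q \<bullet> b) p) * H b p) =
      (\<Sum>b\<in>Basis. v (\<lambda>p. (?x b p - ?c (\<phi> q \<bullet> b) p) * H b p))"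
    by (intro tangent_sum[OF v] smooth_mult smooth_diff x H smooth_const)
  moreover have "v (\<lambda>p. (?x b p - ?c (\<phi> q \<bullet> b) p) * H b p) = v (?x b) * cut_vector A \<eta> (U, \<phi>) b q f" for b
  proof -
    have "v (\<lambda>p. (?x b p - ?c (\<phi> q \<bullet> b) p) * H b p) = H b q * v (\<lambda>p. ?x b p - ?c (\<phi> q \<bullet> b) p)"
      using tangent_mult[OF v smooth_diff[OF x smooth_const] H, of b "\<phi> q \<bullet> b" b] True q B(7)[of q]
      by (simp add: cut_coord_def)
    also have "v (\<lambda>p. ?x b p - ?c (\<phi> q \<bullet> b) p) = v (?x b)"
      using tangent_diff[OF v x smooth_const] tangent_const[OF v q] by simp
    finally show ?thesis
      using True f g(2) by (simp add: H_def cut_vector_def coord_vector_def o_def)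
  qed
  ultimately show ?thesis
    using eq by simp
next
  case False
  then show ?thesis
    using chart_bumpD(8)[OF bump q] by (auto simp: cut_vector_def intro!: sum.neutral)
qed

end

lemma (in charted) atlas_open_points: "atlas_open A (points A)"
  unfolding atlas_open_def
proof safe
  fix V \<psi> assume "(V, \<psi>) \<in> A"
  moreover from this have "points A \<inter> V = V" by (auto simp: points_def)
  ultimately show "open (\<psi> ` (points A \<inter> V))"
    using chart_open by simp
qed

lemma (in charted) topspace_atlas_topology: "topspace (atlas_topology A) = points A"
proof -
  have "T \<subseteq> points A" if "atlas_open A T" for T
    using that by (simp add: atlas_open_def)
  then show ?thesis
    unfolding topspace_def openin_atlas_topology[OF compatible] using atlas_open_points by blast
qed

text \<open>
The preimage of a closed ball under the chart is compact, hence closed in a Hausdorff space; its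
complement is the open set on which the bump functions vanish.
\<close>

lemma (in charted) Hausdorff_chart_bump:
  assumes haus: "Hausdorff_space (atlas_topology A)" and c: "(U, \<phi>) \<in> A" and p: "p \<in> U"
  shows "\<exists>\<eta> \<theta> C. chart_bump A (U, \<phi>) \<eta> \<theta> C \<and> \<eta> p = 1"
proof -
  let ?i = "inv_into U \<phi>"
  obtain e where e: "e > 0" "cball (\<phi> p) e \<subseteq> \<phi> ` U"
    using open_contains_cball_eq[OF chart_open[OF c]] p by blast
  define r where "r = e / 3"
  have r: "r > 0" "3 * r = e" using e by (auto simp: r_def)
  define W where "W k = points A - ?i ` cball (\<phi> p) k" for k
  have W_open: "atlas_open A (W k)" if "k \<le> e" for k
  proof -
    have sub: "cball (\<phi> p) k \<subseteq> \<phi> ` U"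
      using e(2) that by (meson cball_subset_cball_iff order_trans subset_cball)
    have "continuous_map (top_of_set (\<phi> ` U)) (atlas_topology A) ?i"
      unfolding continuous_map_def
    proof (intro conjI allI impI)
      show "?i \<in> topspace (top_of_set (\<phi> ` U)) \<rightarrow> topspace (atlas_topology A)"
      proof
        fix y assume "y \<in> topspace (top_of_set (\<phi> ` U))"
        then have "?i y \<in> points A"
          using chart_points[OF c] by (auto simp: chart_inv[OF c])
        then show "?i y \<in> topspace (atlas_topology A)"
          by (simp add: topspace_atlas_topology)
      qed
      fix T assume "openin (atlas_topology A) T"
      then have "open (\<phi> ` (T \<inter> U))"
        using c by (auto simp: openin_atlas_topology[OF compatible] atlas_open_def)
      moreover have "{y \<in> topspace (top_of_set (\<phi> ` U)). ?i y \<in> T} = \<phi> ` (T \<inter> U)"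
        by (auto simp: chart_inv[OF c])
      ultimately show "openin (top_of_set (\<phi> ` U)) {y \<in> topspace (top_of_set (\<phi> ` U)). ?i y \<in> T}"
        by (simp add: openin_open_eq[OF chart_open[OF c]] image_mono)
    qed
    moreover have "compactin (top_of_set (\<phi> ` U)) (cball (\<phi> p) k)"
      using sub by (simp add: compactin_subtopology)
    ultimately have "compactin (atlas_topology A) (?i ` cball (\<phi> p) k)"
      by (rule image_compactin[rotated])
    then have "closedin (atlas_topology A) (?i ` cball (\<phi> p) k)"
      by (rule compactin_imp_closedin[OF haus])
    then have "openin (atlas_topology A) (topspace (atlas_topology A) - ?i ` cball (\<phi> p) k)"
      by (rule openin_diff[OF openin_topspace])
    then show ?thesis
      by (simp add: openin_atlas_topology[OF compatible] topspace_atlas_topology W_def)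
  qed
  have W_cover: "W k \<union> {q \<in> U. \<phi> q \<in> ball (\<phi> p) l} = points A" if "k < l" "l \<le> e" for k l
  proof -
    have "?i y \<in> U \<and> \<phi> (?i y) \<in> ball (\<phi> p) l" if "y \<in> cball (\<phi> p) k" for y
    proof -
      have "y \<in> \<phi> ` U"
        using e(2) that \<open>k < l\<close> \<open>l \<le> e\<close> by auto
      then show ?thesis
        using that \<open>k < l\<close> by (auto simp: chart_inv[OF c])
    qed
    then have "?i ` cball (\<phi> p) k \<subseteq> {q \<in> U. \<phi> q \<in> ball (\<phi> p) l}"
      by blast
    moreover have "U \<subseteq> points A"
      using chart_points[OF c] by blast
    ultimately show ?thesis
      unfolding W_def by blast
  qed
  have bump: "\<exists>h. h \<in> smooth_functions A \<and> (\<forall>q\<in>W l. h q = 0) \<and> (\<forall>q\<in>U. dist (\<phi> p) (\<phi> q) \<le> k \<longrightarrow> h q = 1)"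
    if kl: "0 < k" "k < l" "l < e" for k l
  proof -
    obtain s :: "'e \<Rightarrow> real" where s: "smooth_on UNIV s" "\<forall>y. dist (\<phi> p) y \<le> k \<longrightarrow> s y = 1" "\<forall>y. dist (\<phi> p) y \<ge> l \<longrightarrow> s y = 0"
      using smooth_bump[OF kl(1,2)] by metis
    define h where "h q = (if q \<in> U then s (\<phi> q) else 0)" for q
    have h0: "h q = 0" if "q \<in> W l" for q
    proof (cases "q \<in> U")
      case True
      then have "\<phi> q \<notin> cball (\<phi> p) l"
        using that chart_inv[OF c True] by (force simp: W_def)
      then show ?thesis using s(3) by (simp add: h_def)
    qed (simp add: h_def)
    have "h \<in> smooth_functions A"
    proof (rule smooth_chart_extension[OF c chart_open[OF c] order_refl _ W_open])
      show "smooth_on (\<phi> ` U) (\<lambda>y. h (?i y))"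
        by (rule smooth_on_cong[OF chart_open[OF c], THEN iffD1, OF _ smooth_on_subset[OF s(1)]])
          (auto simp: h_def chart_inv[OF c])
      show "W l \<union> {q \<in> U. \<phi> q \<in> \<phi> ` U} = points A"
        using W_cover[OF kl(3) order_refl] chart_points[OF c] by blast
    qed (use kl h0 chart_points[OF c] in \<open>auto simp: h_def\<close>)
    then show ?thesis
      using h0 s(2) by (auto simp: h_def)
  qed
  \<comment> \<open>With \<open>3 * r = e\<close>: \<open>\<eta>\<close> lives inside radius \<open>r\<close>, the convex set is the ball of radius \<open>2 * r\<close>, and \<open>\<theta>\<close> drops to 0 before \<open>e\<close>.\<close>
  obtain \<eta> where \<eta>: "\<eta> \<in> smooth_functions A" "\<forall>q\<in>W r. \<eta> q = 0" "\<forall>q\<in>U. dist (\<phi> p) (\<phi> q) \<le> r / 2 \<longrightarrow> \<eta> q = 1"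
    using bump[of "r / 2" r] r by auto
  obtain \<theta> where \<theta>: "\<theta> \<in> smooth_functions A" "\<forall>q\<in>W (5 / 2 * r). \<theta> q = 0"
      "\<forall>q\<in>U. dist (\<phi> p) (\<phi> q) \<le> 2 * r \<longrightarrow> \<theta> q = 1"
    using bump[of "2 * r" "5 / 2 * r"] r by auto
  have "chart_bump A (U, \<phi>) \<eta> \<theta> (ball (\<phi> p) (2 * r))"
    unfolding chart_bump_def
  proof (intro conjI)
    show "ball (\<phi> p) (2 * r) \<subseteq> snd (U, \<phi>) ` fst (U, \<phi>)"
      using e(2) r by auto
    show "\<exists>V. atlas_open A V \<and> V \<union> {q \<in> fst (U, \<phi>). snd (U, \<phi>) q \<in> ball (\<phi> p) (2 * r)} = points A \<and> (\<forall>q\<in>V. \<eta> q = 0)"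
      using W_open[of r] W_cover[of r "2 * r"] \<eta>(2) r by (intro exI[of _ "W r"]) auto
    show "\<exists>V. atlas_open A V \<and> V \<union> fst (U, \<phi>) = points A \<and> (\<forall>q\<in>V. \<theta> q = 0)"
      using W_open[of "5 / 2 * r"] W_cover[of "5 / 2 * r" e] \<theta>(2) r chart_points[OF c]
      by (intro exI[of _ "W (5 / 2 * r)"]) auto
  qed (use c \<eta> \<theta> in auto)
  moreover have "\<eta> p = 1"
    using \<eta>(3) p r by simp
  ultimately show ?thesis by blast
qed


section \<open>Local frames and tensoriality\<close>

text \<open>
What the Hausdorff property is used for. In this form the property passes directly to the cotangent
bundle.
\<close>

locale bump_atlas = charted A for A :: "('a, 'e::euclidean_space) atlas" +
  assumes has_bump: "\<And>U \<phi> p. (U, \<phi>) \<in> A \<Longrightarrow> p \<in> U \<Longrightarrow> \<exists>\<eta> \<theta> C. chart_bump A (U, \<phi>) \<eta> \<theta> C \<and> \<eta> p = 1"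
begin

text \<open>
The expansion holds at every point and not only near \<open>p\<close>, because the frame fields carry the factor
\<open>\<eta>\<close>; the point \<open>p\<close> enters through \<open>\<eta> p = 1\<close> alone.
\<close>

definition frame_at :: "'a \<Rightarrow> ('a \<Rightarrow> real) \<Rightarrow> ('e \<Rightarrow> 'a \<Rightarrow> real) \<Rightarrow> ('e \<Rightarrow> 'a vfield) \<Rightarrow> bool" where
  "frame_at p \<eta> x E \<longleftrightarrow> \<eta> \<in> smooth_functions A \<and> \<eta> p = 1 \<and>
     (\<forall>b. x b \<in> smooth_functions A) \<and> (\<forall>b. E b \<in> vector_fields A) \<and>
     (\<forall>q\<in>points A. \<forall>v\<in>tangent_space A q. \<forall>f. \<eta> q * v f = (\<Sum>b\<in>Basis. v (x b) * E b q f)) \<and>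
     (\<forall>q\<in>points A. \<forall>b\<in>Basis. \<forall>b'\<in>Basis. E b q (x b') = (if b = b' then \<eta> q else 0))"

lemma frame_atD:
  assumes "frame_at p \<eta> x E"
  shows "\<eta> \<in> smooth_functions A" "\<eta> p = 1" "x b \<in> smooth_functions A" "E b \<in> vector_fields A"
    and "q \<in> points A \<Longrightarrow> v \<in> tangent_space A q \<Longrightarrow> \<eta> q * v f = (\<Sum>b\<in>Basis. v (x b) * E b q f)"
    and "q \<in> points A \<Longrightarrow> b \<in> Basis \<Longrightarrow> b' \<in> Basis \<Longrightarrow> E b q (x b') = (if b = b' then \<eta> q else 0)"
  using assms unfolding frame_at_def by (blast, blast, blast, blast, blast, blast)

lemma chart_bump_frame:
  assumes bump: "chart_bump A (U, \<phi>) \<eta> \<theta> C" "\<eta> p = 1"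
  shows "frame_at p \<eta> (cut_coord \<theta> (U, \<phi>)) (cut_vector A \<eta> (U, \<phi>))"
proof -
  note B = chart_bumpD[OF bump(1)]
  let ?x = "cut_coord \<theta> (U, \<phi>)" and ?E = "cut_vector A \<eta> (U, \<phi>)"
  have E: "?E b \<in> vector_fields A" for b
    by (rule cut_vector_mem[OF B(1,2,10)])
  have "\<eta> q * v f = (\<Sum>b\<in>Basis. v (?x b) * ?E b q f)"
    if q: "q \<in> points A" and v: "v \<in> tangent_space A q" for q v f
  proof (cases "f \<in> smooth_functions A")
    case True
    then show ?thesis by (rule frame_expansion[OF bump(1) q v])
  next
    case False
    then show ?thesis
      using tangent_vanish[OF v] tangent_vanish[OF vector_fieldD(1)[OF E q]] by simp
  qed
  then show ?thesis
    unfolding frame_at_def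
    using B(2) bump(2) cut_coord_smooth[OF bump(1)] E cut_vector_cut_coord[OF bump(1)] by blast
qed

lemma frame_exists:
  assumes "p \<in> points A"
  obtains \<eta> x E where "frame_at p \<eta> x E"
proof -
  obtain U \<phi> where c: "(U, \<phi>) \<in> A" "p \<in> U"
    using pointsE[OF assms] .
  obtain \<eta> \<theta> C where "chart_bump A (U, \<phi>) \<eta> \<theta> C" "\<eta> p = 1"
    using has_bump[OF c] by blast
  then have "frame_at p \<eta> (cut_coord \<theta> (U, \<phi>)) (cut_vector A \<eta> (U, \<phi>))"
    by (rule chart_bump_frame)
  then show ?thesis
    by (rule that)
qed

lemma extend_tangent:
  assumes "p \<in> points A" "v \<in> tangent_space A p"
  obtains X where "X \<in> vector_fields A" "X p = v"
proof -
  obtain \<eta> x E where "frame_at p \<eta> x E"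
    using frame_exists[OF assms(1)] .
  note F = frame_atD[OF this]
  show ?thesis
  proof
    show "(\<lambda>q f. \<Sum>b\<in>Basis. (if q \<in> points A then v (x b) else 0) * E b q f) \<in> vector_fields A"
      by (rule vf_sum_mem[OF smooth_const F(4)])
    show "(\<lambda>f. \<Sum>b\<in>Basis. (if p \<in> points A then v (x b) else 0) * E b p f) = v"
      using assms(1) by (simp add: F(5)[OF assms, symmetric] F(2))
  qed
qed

text \<open>
Linearity over the ring of smooth functions, with the value of the coefficient taken at \<open>p\<close>.
\<close>

definition linear_at :: "'a \<Rightarrow> ('a vfield \<Rightarrow> real) \<Rightarrow> bool" where
  "linear_at p F \<longleftrightarrow>
     (\<forall>X\<in>vector_fields A. \<forall>Y\<in>vector_fields A. F (vf_add X Y) = F X + F Y) \<and>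
     (\<forall>h\<in>smooth_functions A. \<forall>X\<in>vector_fields A. F (vf_scale h X) = h p * F X)"

lemma linear_atI:
  assumes "\<And>X Y. X \<in> vector_fields A \<Longrightarrow> Y \<in> vector_fields A \<Longrightarrow> F (vf_add X Y) = F X + F Y"
    and "\<And>h X. h \<in> smooth_functions A \<Longrightarrow> X \<in> vector_fields A \<Longrightarrow> F (vf_scale h X) = h p * F X"
  shows "linear_at p F"
  using assms by (simp add: linear_at_def)

lemma linear_at_add: "linear_at p F \<Longrightarrow> X \<in> vector_fields A \<Longrightarrow> Y \<in> vector_fields A \<Longrightarrow> F (vf_add X Y) = F X + F Y"
  and linear_at_scale: "linear_at p F \<Longrightarrow> h \<in> smooth_functions A \<Longrightarrow> X \<in> vector_fields A \<Longrightarrow> F (vf_scale h X) = h p * F X"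
  by (auto simp: linear_at_def)

lemma linear_at_plus: "linear_at p F \<Longrightarrow> linear_at p G \<Longrightarrow> linear_at p (\<lambda>X. F X + G X)"
  and linear_at_minus: "linear_at p F \<Longrightarrow> linear_at p G \<Longrightarrow> linear_at p (\<lambda>X. F X - G X)"
  and linear_at_zero: "linear_at p (\<lambda>X. 0)"
  by (auto simp: linear_at_def algebra_simps)

lemma linear_at_sum: "(\<And>i. i \<in> I \<Longrightarrow> linear_at p (F i)) \<Longrightarrow> linear_at p (\<lambda>X. \<Sum>i\<in>I. F i X)"
  by (induction I rule: infinite_finite_induct) (simp_all add: linear_at_plus linear_at_zero)

lemma linear_at_combination:
  assumes F: "linear_at p F"
  shows "finite I \<Longrightarrow> (\<And>i. i \<in> I \<Longrightarrow> h i \<in> smooth_functions A) \<Longrightarrow> (\<And>i. i \<in> I \<Longrightarrow> X i \<in> vector_fields A) \<Longrightarrow>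
    F (\<lambda>q f. \<Sum>i\<in>I. h i q * X i q f) = (\<Sum>i\<in>I. h i p * F (X i))"
proof (induction I rule: finite_induct)
  case empty
  have "F (vf_scale (\<lambda>q. 0) (\<lambda>q f. 0)) = 0"
    using linear_at_scale[OF F smooth_zero vf_zero_mem] by simp
  then show ?case by (simp add: vf_scale_def)
next
  case (insert i I)
  have "F (vf_add (vf_scale (h i) (X i)) (\<lambda>q f. \<Sum>i\<in>I. h i q * X i q f)) =
      h i p * F (X i) + (\<Sum>i\<in>I. h i p * F (X i))"
    using linear_at_add[OF F vf_scale_mem vf_sum_mem, of "h i" "X i" I h X] linear_at_scale[OF F] insert by simp
  then show ?case
    using insert by (simp add: vf_add_def vf_scale_def)
qed

lemma frame_vector_field:
  assumes "frame_at p \<eta> x E" "X \<in> vector_fields A"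
  shows "vf_scale \<eta> X = (\<lambda>q f. \<Sum>b\<in>Basis. X q (x b) * E b q f)"
proof (intro ext)
  note fr = frame_atD[OF assms(1)]
  fix q f
  show "vf_scale \<eta> X q f = (\<Sum>b\<in>Basis. X q (x b) * E b q f)"
    using fr(5)[OF _ vector_fieldD(1)[OF assms(2)], of q f] vector_fieldD(2)[OF assms(2), of q]
      vector_fieldD(2)[OF fr(4), of q]
    by (cases "q \<in> points A") (simp_all add: vf_scale_def)
qed

lemma linear_at_frame:
  assumes F: "linear_at q F" and X: "X \<in> vector_fields A" and fr: "frame_at p \<eta> x E"
  shows "\<eta> q * F X = (\<Sum>b\<in>Basis. X q (x b) * F (E b))"
proof -
  note D = frame_atD[OF fr]
  have "\<eta> q * F X = F (vf_scale \<eta> X)"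
    by (rule linear_at_scale[OF F D(1) X, symmetric])
  also have "\<dots> = (\<Sum>b\<in>Basis. X q (x b) * F (E b))"
    unfolding frame_vector_field[OF fr X] by (rule linear_at_combination[OF F finite_Basis]) (simp_all add: vector_fieldD(3)[OF X] D(3,4))
  finally show ?thesis .
qed

lemma linear_at_expansion:
  assumes "linear_at p F" "X \<in> vector_fields A" and fr: "frame_at p \<eta> x E"
  shows "F X = (\<Sum>b\<in>Basis. X p (x b) * F (E b))"
  using linear_at_frame[OF assms] frame_atD(2)[OF fr] by simp

text \<open>
Tensoriality: by the expansion in a frame at \<open>p\<close>, a functional that is linear over smooth functions
depends on the value of the field at \<open>p\<close> only.
\<close>

lemma linear_at_cong:
  assumes "linear_at p F" "p \<in> points A" "X \<in> vector_fields A" "Y \<in> vector_fields A" "X p = Y p"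
  shows "F X = F Y"
proof -
  obtain \<eta> x E where fr: "frame_at p \<eta> x E"
    using frame_exists[OF assms(2)] .
  then show ?thesis
    using linear_at_expansion[OF assms(1,3) fr] linear_at_expansion[OF assms(1,4) fr] assms(5) by simp
qed

lemma linear_at_vanish:
  assumes "linear_at p F" "p \<in> points A" "X \<in> vector_fields A" "X p = (\<lambda>f. 0)"
  shows "F X = 0"
  using linear_at_cong[OF assms(1-3) vf_zero_mem assms(4)]
    linear_at_scale[OF assms(1) smooth_zero vf_zero_mem] by (simp add: vf_scale_def)

section \<open>Symmetric tensors as symmetric multilinear maps of vector fields\<close>

lemma sym_tensor_outside:
    "\<phi> \<in> sym_tensors A r \<Longrightarrow> \<not> (p \<in> points A \<and> length vs = r \<and> set vs \<subseteq> tangent_space A p) \<Longrightarrow> \<phi> p vs = 0"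
  and sym_tensor_multilinear: "\<phi> \<in> sym_tensors A r \<Longrightarrow> p \<in> points A \<Longrightarrow> vs \<in> lists (tangent_space A p) \<Longrightarrow>
      i < length vs \<Longrightarrow> v \<in> tangent_space A p \<Longrightarrow> w \<in> tangent_space A p \<Longrightarrow>
      \<phi> p (vs[i := (\<lambda>f. a * v f + b * w f)]) = a * \<phi> p (vs[i := v]) + b * \<phi> p (vs[i := w])"
  and sym_tensor_symmetric: "\<phi> \<in> sym_tensors A r \<Longrightarrow> p \<in> points A \<Longrightarrow> vs \<in> lists (tangent_space A p) \<Longrightarrow>
      mset ws = mset vs \<Longrightarrow> \<phi> p ws = \<phi> p vs"
  and sym_tensor_smooth: "\<phi> \<in> sym_tensors A r \<Longrightarrow> Xs \<in> lists (vector_fields A) \<Longrightarrow>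
      apply_tensor \<phi> Xs \<in> smooth_functions A"
proof -
  assume \<phi>: "\<phi> \<in> sym_tensors A r"
  note D = \<phi>[unfolded sym_tensors_def mem_Collect_eq]
  show "\<not> (p \<in> points A \<and> length vs = r \<and> set vs \<subseteq> tangent_space A p) \<Longrightarrow> \<phi> p vs = 0"
    by (rule D[THEN conjunct1, rule_format])
  show "p \<in> points A \<Longrightarrow> vs \<in> lists (tangent_space A p) \<Longrightarrow>
      i < length vs \<Longrightarrow> v \<in> tangent_space A p \<Longrightarrow> w \<in> tangent_space A p \<Longrightarrow>
      \<phi> p (vs[i := (\<lambda>f. a * v f + b * w f)]) = a * \<phi> p (vs[i := v]) + b * \<phi> p (vs[i := w])"
    by (rule D[THEN conjunct2, THEN conjunct1, rule_format])
  show "p \<in> points A \<Longrightarrow> vs \<in> lists (tangent_space A p) \<Longrightarrow> mset ws = mset vs \<Longrightarrow> \<phi> p ws = \<phi> p vs"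
    by (rule D[THEN conjunct2, THEN conjunct2, THEN conjunct1, rule_format])
  show "Xs \<in> lists (vector_fields A) \<Longrightarrow> apply_tensor \<phi> Xs \<in> smooth_functions A"
    by (rule D[THEN conjunct2, THEN conjunct2, THEN conjunct2, rule_format])
qed

text \<open>
The summation over degrees disappears: an element of the direct sum is a family that satisfies the
conditions on a symmetric tensor in all degrees at once and vanishes in large degrees.
\<close>

lemma algebra_iff:
  "\<phi> \<in> sym_tensor_algebra A \<longleftrightarrow>
     (\<forall>p vs. \<not> (p \<in> points A \<and> set vs \<subseteq> tangent_space A p) \<longrightarrow> \<phi> p vs = 0) \<and>
     (\<exists>n. \<forall>p vs. n \<le> length vs \<longrightarrow> \<phi> p vs = 0) \<and>
     (\<forall>p\<in>points A. \<forall>vs\<in>lists (tangent_space A p). \<forall>i<length vs.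
        \<forall>v\<in>tangent_space A p. \<forall>w\<in>tangent_space A p. \<forall>a b.
          \<phi> p (vs[i := (\<lambda>f. a * v f + b * w f)]) = a * \<phi> p (vs[i := v]) + b * \<phi> p (vs[i := w])) \<and>
     (\<forall>p\<in>points A. \<forall>vs\<in>lists (tangent_space A p). \<forall>ws. mset ws = mset vs \<longrightarrow> \<phi> p ws = \<phi> p vs) \<and>
     (\<forall>Xs\<in>lists (vector_fields A). apply_tensor \<phi> Xs \<in> smooth_functions A)"
  (is "_ \<longleftrightarrow> ?R")
proof
  assume "\<phi> \<in> sym_tensor_algebra A"
  then obtain n \<psi> where \<psi>: "\<And>r. r < n \<Longrightarrow> \<psi> r \<in> sym_tensors A r" and \<phi>: "\<phi> = (\<lambda>p vs. \<Sum>r<n. \<psi> r p vs)"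
    by (auto simp: sym_tensor_algebra_def)
  have "\<phi> p vs = 0" if "\<not> (p \<in> points A \<and> set vs \<subseteq> tangent_space A p)" for p vs
    unfolding \<phi> using sym_tensor_outside[OF \<psi>] that by (intro sum.neutral) simp
  moreover have "\<exists>n. \<forall>p vs. n \<le> length vs \<longrightarrow> \<phi> p vs = 0"
    unfolding \<phi> using sym_tensor_outside[OF \<psi>] by (intro exI[of _ n] allI impI sum.neutral) simp
  moreover have "\<phi> p (vs[i := (\<lambda>f. a * v f + b * w f)]) = a * \<phi> p (vs[i := v]) + b * \<phi> p (vs[i := w])"
    if "p \<in> points A" "vs \<in> lists (tangent_space A p)" "i < length vs" "v \<in> tangent_space A p" "w \<in> tangent_space A p"
    for p vs i v w a b
    unfolding \<phi> sum_distrib_left sum.distrib[symmetric]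
    by (intro sum.cong refl sym_tensor_multilinear[OF \<psi> that]) simp
  moreover have "\<phi> p ws = \<phi> p vs" if "p \<in> points A" "vs \<in> lists (tangent_space A p)" "mset ws = mset vs" for p vs ws
    unfolding \<phi> by (intro sum.cong refl sym_tensor_symmetric[OF \<psi> that]) simp
  moreover have "apply_tensor \<phi> Xs \<in> smooth_functions A" if "Xs \<in> lists (vector_fields A)" for Xs
    using smooth_sum[of "{..<n}" "\<lambda>r. apply_tensor (\<psi> r) Xs"] sym_tensor_smooth[OF \<psi> that]
    by (simp add: \<phi> apply_tensor_def)
  ultimately show ?R by (intro conjI allI ballI impI)
next
  assume R: ?R
  have outside: "\<And>p vs. \<not> (p \<in> points A \<and> set vs \<subseteq> tangent_space A p) \<Longrightarrow> \<phi> p vs = 0"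
    and multilinear: "\<And>p vs i v w a b. p \<in> points A \<Longrightarrow> vs \<in> lists (tangent_space A p) \<Longrightarrow> i < length vs \<Longrightarrow>
      v \<in> tangent_space A p \<Longrightarrow> w \<in> tangent_space A p \<Longrightarrow>
      \<phi> p (vs[i := (\<lambda>f. a * v f + b * w f)]) = a * \<phi> p (vs[i := v]) + b * \<phi> p (vs[i := w])"
    and symmetric: "\<And>p vs ws. p \<in> points A \<Longrightarrow> vs \<in> lists (tangent_space A p) \<Longrightarrow> mset ws = mset vs \<Longrightarrow> \<phi> p ws = \<phi> p vs"
    and smooth: "\<And>Xs. Xs \<in> lists (vector_fields A) \<Longrightarrow> apply_tensor \<phi> Xs \<in> smooth_functions A"
  proof -
    show "\<And>p vs. \<not> (p \<in> points A \<and> set vs \<subseteq> tangent_space A p) \<Longrightarrow> \<phi> p vs = 0"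
      by (rule R[THEN conjunct1, rule_format])
    show "\<And>p vs i v w a b. p \<in> points A \<Longrightarrow> vs \<in> lists (tangent_space A p) \<Longrightarrow> i < length vs \<Longrightarrow>
      v \<in> tangent_space A p \<Longrightarrow> w \<in> tangent_space A p \<Longrightarrow>
      \<phi> p (vs[i := (\<lambda>f. a * v f + b * w f)]) = a * \<phi> p (vs[i := v]) + b * \<phi> p (vs[i := w])"
      by (rule R[THEN conjunct2, THEN conjunct2, THEN conjunct1, rule_format])
    show "\<And>p vs ws. p \<in> points A \<Longrightarrow> vs \<in> lists (tangent_space A p) \<Longrightarrow> mset ws = mset vs \<Longrightarrow> \<phi> p ws = \<phi> p vs"
      by (rule R[THEN conjunct2, THEN conjunct2, THEN conjunct2, THEN conjunct1, rule_format])
    show "\<And>Xs. Xs \<in> lists (vector_fields A) \<Longrightarrow> apply_tensor \<phi> Xs \<in> smooth_functions A"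
      by (rule R[THEN conjunct2, THEN conjunct2, THEN conjunct2, THEN conjunct2, rule_format])
  qed
  from R[THEN conjunct2, THEN conjunct1] obtain n where "\<forall>p vs. n \<le> length vs \<longrightarrow> \<phi> p vs = 0"
    by (elim exE)
  then have n: "\<And>p vs. n \<le> length vs \<Longrightarrow> \<phi> p vs = 0"
    by simp
  define \<psi> where "\<psi> r = (\<lambda>p vs. if length vs = r then \<phi> p vs else 0)" for r
  have "\<psi> r \<in> sym_tensors A r" for r
    unfolding sym_tensors_def mem_Collect_eq
  proof (intro conjI allI ballI impI)
    show "apply_tensor (\<psi> r) Xs \<in> smooth_functions A" if "Xs \<in> lists (vector_fields A)" for Xs
      using smooth[OF that] smooth_zero by (cases "length Xs = r") (simp_all add: \<psi>_def apply_tensor_def)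
    show "\<psi> r p ws = \<psi> r p vs" if "p \<in> points A" "vs \<in> lists (tangent_space A p)" "mset ws = mset vs" for p vs ws
      using symmetric[OF that] mset_eq_length[OF that(3)] by (simp add: \<psi>_def)
    show "\<psi> r p vs = 0" if "\<not> (p \<in> points A \<and> length vs = r \<and> set vs \<subseteq> tangent_space A p)" for p vs
      using outside[of p vs] that by (auto simp: \<psi>_def)
    show "\<psi> r p (vs[i := (\<lambda>f. a * v f + b * w f)]) = a * \<psi> r p (vs[i := v]) + b * \<psi> r p (vs[i := w])"
      if "p \<in> points A" "vs \<in> lists (tangent_space A p)" "i < length vs" "v \<in> tangent_space A p" "w \<in> tangent_space A p"
      for p vs i v w a b
      using multilinear[OF that] by (simp add: \<psi>_def)
  qed
  moreover have "\<phi> = (\<lambda>p vs. \<Sum>r<n. \<psi> r p vs)"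
  proof (intro ext)
    fix p vs
    have "(\<Sum>r<n. \<psi> r p vs) = (if length vs < n then \<phi> p vs else 0)"
      by (simp add: \<psi>_def)
    then show "\<phi> p vs = (\<Sum>r<n. \<psi> r p vs)"
      using n[of vs p] by auto
  qed
  ultimately show "\<phi> \<in> sym_tensor_algebra A"
    unfolding sym_tensor_algebra_def by blast
qed

lemma algebra_outside: "\<phi> \<in> sym_tensor_algebra A \<Longrightarrow> \<not> (p \<in> points A \<and> set vs \<subseteq> tangent_space A p) \<Longrightarrow> \<phi> p vs = 0"
  and algebra_degree: "\<phi> \<in> sym_tensor_algebra A \<Longrightarrow> \<exists>n. \<forall>p vs. n \<le> length vs \<longrightarrow> \<phi> p vs = 0"
  and algebra_multilinear: "\<phi> \<in> sym_tensor_algebra A \<Longrightarrow> p \<in> points A \<Longrightarrow> vs \<in> lists (tangent_space A p) \<Longrightarrow> i < length vs \<Longrightarrow>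
      v \<in> tangent_space A p \<Longrightarrow> w \<in> tangent_space A p \<Longrightarrow>
      \<phi> p (vs[i := (\<lambda>f. a * v f + b * w f)]) = a * \<phi> p (vs[i := v]) + b * \<phi> p (vs[i := w])"
  and algebra_symmetric: "\<phi> \<in> sym_tensor_algebra A \<Longrightarrow> p \<in> points A \<Longrightarrow> vs \<in> lists (tangent_space A p) \<Longrightarrow>
      mset ws = mset vs \<Longrightarrow> \<phi> p ws = \<phi> p vs"
  and algebra_smooth: "\<phi> \<in> sym_tensor_algebra A \<Longrightarrow> Xs \<in> lists (vector_fields A) \<Longrightarrow> apply_tensor \<phi> Xs \<in> smooth_functions A"
proof -
  assume \<phi>: "\<phi> \<in> sym_tensor_algebra A"
  note D = \<phi>[unfolded algebra_iff]
  show "\<not> (p \<in> points A \<and> set vs \<subseteq> tangent_space A p) \<Longrightarrow> \<phi> p vs = 0"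
    by (rule D[THEN conjunct1, rule_format])
  show "\<exists>n. \<forall>p vs. n \<le> length vs \<longrightarrow> \<phi> p vs = 0"
    by (rule D[THEN conjunct2, THEN conjunct1])
  show "p \<in> points A \<Longrightarrow> vs \<in> lists (tangent_space A p) \<Longrightarrow>
      i < length vs \<Longrightarrow> v \<in> tangent_space A p \<Longrightarrow> w \<in> tangent_space A p \<Longrightarrow>
      \<phi> p (vs[i := (\<lambda>f. a * v f + b * w f)]) = a * \<phi> p (vs[i := v]) + b * \<phi> p (vs[i := w])"
    by (rule D[THEN conjunct2, THEN conjunct2, THEN conjunct1, rule_format])
  show "p \<in> points A \<Longrightarrow> vs \<in> lists (tangent_space A p) \<Longrightarrow> mset ws = mset vs \<Longrightarrow> \<phi> p ws = \<phi> p vs"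
    by (rule D[THEN conjunct2, THEN conjunct2, THEN conjunct2, THEN conjunct1, rule_format])
  show "Xs \<in> lists (vector_fields A) \<Longrightarrow> apply_tensor \<phi> Xs \<in> smooth_functions A"
    by (rule D[THEN conjunct2, THEN conjunct2, THEN conjunct2, THEN conjunct2, rule_format])
qed

lemma apply_symmetric:
  assumes "\<phi> \<in> sym_tensor_algebra A" "Xs \<in> lists (vector_fields A)" "mset Ys = mset Xs"
  shows "apply_tensor \<phi> Ys = apply_tensor \<phi> Xs"
proof
  fix p
  have Ys: "Ys \<in> lists (vector_fields A)"
    using assms(2,3) mset_eq_setD by fastforce
  show "apply_tensor \<phi> Ys p = apply_tensor \<phi> Xs p"
  proof (cases "p \<in> points A")
    case True
    have "map (\<lambda>X. X p) Xs \<in> lists (tangent_space A p)"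
      using assms(2) vector_fieldD(1)[OF _ True] by auto
    then show ?thesis
      unfolding apply_tensor_def
      by (rule algebra_symmetric[OF assms(1) True]) (simp only: mset_map assms(3))
  next
    case False
    then show ?thesis
      using algebra_outside[OF assms(1)] by (simp add: apply_tensor_def)
  qed
qed

lemma apply_linear_at:
  assumes "\<phi> \<in> sym_tensor_algebra A" "Xs \<in> lists (vector_fields A)" "p \<in> points A"
  shows "linear_at p (\<lambda>X. apply_tensor \<phi> (X # Xs) p)"
proof -
  have Xs: "map (\<lambda>X. X p) Xs \<in> lists (tangent_space A p)"
    using assms(2) vector_fieldD(1)[OF _ assms(3)] by auto
  have lin: "\<phi> p ((\<lambda>f. a * v f + b * w f) # map (\<lambda>X. X p) Xs) =
      a * \<phi> p (v # map (\<lambda>X. X p) Xs) + b * \<phi> p (w # map (\<lambda>X. X p) Xs)"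
    if "v \<in> tangent_space A p" "w \<in> tangent_space A p" for a b v w
    using algebra_multilinear[OF assms(1,3) _ _ that, of "v # map (\<lambda>X. X p) Xs" 0 a b] Xs that by simp
  show ?thesis
  proof (rule linear_atI)
    fix X Y assume X: "X \<in> vector_fields A" and Y: "Y \<in> vector_fields A"
    show "apply_tensor \<phi> (vf_add X Y # Xs) p = apply_tensor \<phi> (X # Xs) p + apply_tensor \<phi> (Y # Xs) p"
      using lin[OF vector_fieldD(1)[OF X assms(3)] vector_fieldD(1)[OF Y assms(3)], of 1 1]
      by (simp add: apply_tensor_def vf_add_def)
  next
    fix h X assume "h \<in> smooth_functions A" and X: "X \<in> vector_fields A"
    show "apply_tensor \<phi> (vf_scale h X # Xs) p = h p * apply_tensor \<phi> (X # Xs) p"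
      using lin[OF vector_fieldD(1)[OF X assms(3)] vector_fieldD(1)[OF X assms(3)], of "h p" 0]
      by (simp add: apply_tensor_def vf_scale_def)
  qed
qed

text \<open>
A vector field through a given tangent vector; only its value at the point matters.
\<close>

definition extension :: "'a \<Rightarrow> 'a tangent \<Rightarrow> 'a vfield" where
  "extension p v = (SOME X. X \<in> vector_fields A \<and> X p = v)"

lemma extension:
  assumes "p \<in> points A" "v \<in> tangent_space A p"
  shows "extension p v \<in> vector_fields A" "extension p v p = v"
  using someI_ex[of "\<lambda>X. X \<in> vector_fields A \<and> X p = v"] extend_tangent[OF assms]
  unfolding extension_def by blast+

lemma algebra_eqI:
  assumes \<phi>: "\<phi> \<in> sym_tensor_algebra A" and \<psi>: "\<psi> \<in> sym_tensor_algebra A"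
    and eq: "\<And>Xs. Xs \<in> lists (vector_fields A) \<Longrightarrow> apply_tensor \<phi> Xs = apply_tensor \<psi> Xs"
  shows "\<phi> = \<psi>"
proof (intro ext)
  fix p vs
  show "\<phi> p vs = \<psi> p vs"
  proof (cases "p \<in> points A \<and> set vs \<subseteq> tangent_space A p")
    case True
    then have ext: "extension p v \<in> vector_fields A" "extension p v p = v" if "v \<in> set vs" for v
      using extension[of p v] that by auto
    then have "map ((\<lambda>X. X p) \<circ> extension p) vs = vs"
      by (intro map_idI) simp
    moreover have "apply_tensor \<phi> (map (extension p) vs) p = apply_tensor \<psi> (map (extension p) vs) p"
      by (subst eq) (use ext in auto)
    ultimately show ?thesis
      by (simp add: apply_tensor_def)
  next
    case False
    then show ?thesis
      using algebra_outside[OF \<phi>] algebra_outside[OF \<psi>] by metis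
  qed
qed

text \<open>
Existence part of the tensor characterization lemma: the tensor is evaluated on arbitrary extensions of
the tangent vectors to vector fields. Linearity is required in the first slot only, since symmetry
moves every slot there; replacing the arguments one after the other shows that the choice of the
extensions is immaterial.
\<close>

lemma tensor_from_fields:
  assumes smooth: "\<And>Xs. Xs \<in> lists (vector_fields A) \<Longrightarrow> T Xs \<in> smooth_functions A"
    and lin: "\<And>Xs p. Xs \<in> lists (vector_fields A) \<Longrightarrow> p \<in> points A \<Longrightarrow> linear_at p (\<lambda>X. T (X # Xs) p)"
    and sym: "\<And>Xs Ys. Xs \<in> lists (vector_fields A) \<Longrightarrow> mset Ys = mset Xs \<Longrightarrow> T Ys = T Xs"
    and deg: "\<And>Xs. Xs \<in> lists (vector_fields A) \<Longrightarrow> n \<le> length Xs \<Longrightarrow> T Xs = (\<lambda>p. 0)"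
  shows "\<exists>\<psi>\<in>sym_tensor_algebra A. \<forall>Xs\<in>lists (vector_fields A). apply_tensor \<psi> Xs = T Xs"
proof -
  define \<psi> where "\<psi> p vs = (if p \<in> points A \<and> set vs \<subseteq> tangent_space A p then T (map (extension p) vs) p else 0)" for p vs
  have cong: "T (Zs @ Xs) p = T (Zs @ Ys) p"
    if "list_all2 (\<lambda>X Y. X \<in> vector_fields A \<and> Y \<in> vector_fields A \<and> X p = Y p) Xs Ys"
      "Zs \<in> lists (vector_fields A)" "p \<in> points A" for Zs Xs Ys p
    using that
  proof (induction arbitrary: Zs rule: list_all2_induct)
    case (Cons X Xs Y Ys)
    have Xs: "Xs \<in> lists (vector_fields A)"
      using Cons.hyps(2) by (auto simp: list_all2_conv_all_nth in_set_conv_nth)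
    have "T (Zs @ X # Xs) p = T (X # Zs @ Xs) p"
      by (subst sym[of "X # Zs @ Xs" "Zs @ X # Xs"]) (use Cons Xs in auto)
    also have "\<dots> = T (Y # Zs @ Xs) p"
      using linear_at_cong[OF lin[of "Zs @ Xs"] \<open>p \<in> points A\<close>, of X Y] Cons Xs by auto
    also have "\<dots> = T ((Zs @ [Y]) @ Xs) p"
      by (subst sym[of "Y # Zs @ Xs" "(Zs @ [Y]) @ Xs"]) (use Cons Xs in auto)
    also have "\<dots> = T ((Zs @ [Y]) @ Ys) p"
      using Cons by (intro Cons.IH) auto
    finally show ?case by simp
  qed simp
  have app: "apply_tensor \<psi> Xs = T Xs" if Xs: "Xs \<in> lists (vector_fields A)" for Xs
  proof
    fix p
    show "apply_tensor \<psi> Xs p = T Xs p"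
    proof (cases "p \<in> points A")
      case True
      have "T ([] @ map (extension p) (map (\<lambda>X. X p) Xs)) p = T ([] @ Xs) p"
        using Xs extension[OF True vector_fieldD(1)[OF _ True]] True
        by (intro cong) (auto simp: list_all2_conv_all_nth)
      moreover have "set (map (\<lambda>X. X p) Xs) \<subseteq> tangent_space A p"
        using Xs vector_fieldD(1)[OF _ True] by auto
      ultimately show ?thesis
        using True by (simp add: apply_tensor_def \<psi>_def)
    next
      case False
      then show ?thesis
        using smooth_outside[OF smooth[OF Xs]] by (simp add: apply_tensor_def \<psi>_def)
    qed
  qed
  have "\<psi> \<in> sym_tensor_algebra A"
    unfolding algebra_iff
  proof (intro conjI allI ballI impI)
    show "\<exists>n. \<forall>p vs. n \<le> length vs \<longrightarrow> \<psi> p vs = 0"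
    proof (intro exI allI impI)
      fix p and vs :: "'a tangent list" assume "n \<le> length vs"
      moreover have "map (extension p) vs \<in> lists (vector_fields A)" if "p \<in> points A" "set vs \<subseteq> tangent_space A p"
        using extension(1)[OF that(1) subsetD[OF that(2)]] by auto
      ultimately show "\<psi> p vs = 0"
        using deg[of "map (extension p) vs"] by (simp add: \<psi>_def)
    qed
  next
    fix p vs i v w a b
    assume p: "p \<in> points A" and vs: "vs \<in> lists (tangent_space A p)" and i: "i < length vs"
      and v: "v \<in> tangent_space A p" and w: "w \<in> tangent_space A p"
    let ?u = "\<lambda>f. a * v f + b * w f" and ?e = "extension p" and ?c = "\<lambda>k q. if q \<in> points A then k else (0 :: real)"
    define Xs where "Xs = take i (map ?e vs) @ drop (Suc i) (map ?e vs)"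
    have Xs: "Xs \<in> lists (vector_fields A)"
      using vs extension[OF p] by (auto simp: Xs_def dest!: in_set_takeD in_set_dropD)
    note ev = extension[OF p v] and ew = extension[OF p w]
      and eu = extension[OF p tangent_space_combination[OF v w, of a b]]
    have upd: "\<psi> p (vs[i := u]) = T (?e u # Xs) p" if u: "u \<in> tangent_space A p" for u
    proof -
      have "mset ((map ?e vs)[i := ?e u]) = mset (?e u # Xs)"
        using i by (simp add: Xs_def upd_conv_take_nth_drop)
      moreover have "?e u # Xs \<in> lists (vector_fields A)"
        using Xs extension[OF p u] by simp
      moreover have "set (vs[i := u]) \<subseteq> tangent_space A p"
        using vs u set_update_subset_insert[of vs i u] by auto
      ultimately show ?thesis
        using sym[of "?e u # Xs" "(map ?e vs)[i := ?e u]"] p by (simp add: \<psi>_def map_update)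
    qed
    have lin': "linear_at p (\<lambda>X. T (X # Xs) p)"
      by (rule lin[OF Xs p])
    let ?W = "vf_add (vf_scale (?c a) (?e v)) (vf_scale (?c b) (?e w))"
    have "T (?e ?u # Xs) p = T (?W # Xs) p"
      using ev ew eu p
      by (intro linear_at_cong[OF lin' p] vf_add_mem vf_scale_mem smooth_const)
        (auto simp: vf_add_def vf_scale_def)
    also have "\<dots> = a * T (?e v # Xs) p + b * T (?e w # Xs) p"
      using linear_at_add[OF lin' vf_scale_mem[OF smooth_const] vf_scale_mem[OF smooth_const], of "?e v" "?e w" a b]
        linear_at_scale[OF lin' smooth_const] ev ew p by simp
    finally show "\<psi> p (vs[i := ?u]) = a * \<psi> p (vs[i := v]) + b * \<psi> p (vs[i := w])"
      by (simp add: upd v w tangent_space_combination)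
  next
    fix p vs ws
    assume p: "p \<in> points A" and vs: "vs \<in> lists (tangent_space A p)" and ws: "mset ws = mset vs"
    have "set ws = set vs"
      using ws by (rule mset_eq_setD)
    moreover have "T (map (extension p) ws) = T (map (extension p) vs)"
      using extension[OF p] vs ws by (intro sym) auto
    ultimately show "\<psi> p ws = \<psi> p vs"
      by (simp add: \<psi>_def)
  next
    show "apply_tensor \<psi> Xs \<in> smooth_functions A" if "Xs \<in> lists (vector_fields A)" for Xs
      using app smooth that by simp
  qed (auto simp: \<psi>_def)
  then show ?thesis
    using app by blast
qed

end


section \<open>Reindexing sums over the positions of a list\<close>

abbreviation del_nth :: "nat \<Rightarrow> 'b list \<Rightarrow> 'b list" where
  "del_nth j xs \<equiv> take j xs @ drop (Suc j) xs"

lemma mset_del_nth: "j < length xs \<Longrightarrow> mset (del_nth j xs) = mset xs - {#xs ! j#}"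
  by (subst (3) id_take_nth_drop[of j xs]) auto

lemma mset_update_del: "j < length xs \<Longrightarrow> mset (xs[j := x]) = mset (x # del_nth j xs)"
  by (simp add: upd_conv_take_nth_drop)

lemma set_del_nth: "set (del_nth j xs) \<subseteq> set xs"
  using set_take_subset[of j xs] set_drop_subset[of "Suc j" xs] by simp

text \<open>
Used to show that expressions summing over the positions of an argument list are symmetric in the
arguments.
\<close>

lemma sum_positions_permute:
  fixes G H :: "nat \<Rightarrow> real"
  assumes "mset ys = mset xs"
    and "\<And>i j. i < length ys \<Longrightarrow> j < length xs \<Longrightarrow> ys ! i = xs ! j \<Longrightarrow> G i = H j"
  shows "(\<Sum>i<length ys. G i) = (\<Sum>j<length xs. H j)"
proof -
  obtain f where f: "bij_betw f {..<length ys} {..<length xs}" "\<And>i. i < length ys \<Longrightarrow> ys ! i = xs ! f i"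
    using permutation_Ex_bij[OF assms(1)] by blast
  have "(\<Sum>i<length ys. G i) = (\<Sum>i<length ys. H (f i))"
    using f bij_betwE[OF f(1)] by (intro sum.cong refl assms(2)) auto
  also have "\<dots> = (\<Sum>j<length xs. H j)"
    by (rule sum.reindex_bij_betw[OF f(1)])
  finally show ?thesis .
qed

text \<open>
The position in a list of the \<open>k\<close>-th entry that remains after deletion of the entry \<open>j\<close>.
\<close>

definition skip :: "nat \<Rightarrow> nat \<Rightarrow> nat" where
  "skip j k = (if k < j then k else Suc k)"

lemma bij_betw_skip: "j < Suc n \<Longrightarrow> bij_betw (skip j) {..<n} ({..<Suc n} - {j})"
proof (rule bij_betwI[where g = "\<lambda>i. if i < j then i else i - 1"])
qed (auto simp: skip_def split: if_splits)

lemma sum_skip: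
  fixes F :: "nat \<Rightarrow> real"
  assumes "j < length xs"
  shows "(\<Sum>i<length xs. F i) = F j + (\<Sum>k<length (del_nth j xs). F (skip j k))"
proof -
  obtain n where n: "length xs = Suc n"
    using assms by (cases "length xs") auto
  have "(\<Sum>i<Suc n. F i) = F j + (\<Sum>i\<in>{..<Suc n} - {j}. F i)"
    using assms n by (intro sum.remove) auto
  also have "(\<Sum>i\<in>{..<Suc n} - {j}. F i) = (\<Sum>k<n. F (skip j k))"
    using sum.reindex_bij_betw[OF bij_betw_skip, of j n F] assms n by simp
  finally show ?thesis
    using n assms by (simp add: min_def)
qed

lemma del_nth_skip:
  assumes "j < length xs" "k < length (del_nth j xs)"
  shows "del_nth j xs ! k = xs ! skip j k"
    and "del_nth j (xs[skip j k := x]) = (del_nth j xs)[k := x]"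
    and "xs[skip j k := x] ! j = xs ! j"
  using assms by (auto simp: skip_def nth_append list_update_append drop_update_swap take_update_swap
      intro!: list_update_beyond)

section \<open>Covariant derivative and symmetric derivative\<close>

context bump_atlas begin

lemma smooth_eqI:
  assumes "f \<in> smooth_functions A" "g \<in> smooth_functions A" "\<And>p. p \<in> points A \<Longrightarrow> f p = g p"
  shows "f = g"
  using assms smooth_outside by (metis ext)

lemma vf_apply_add: "X \<in> vector_fields A \<Longrightarrow> f \<in> smooth_functions A \<Longrightarrow> g \<in> smooth_functions A \<Longrightarrow>
    X p (\<lambda>q. f q + g q) = X p f + X p g"
  and vf_apply_diff: "X \<in> vector_fields A \<Longrightarrow> f \<in> smooth_functions A \<Longrightarrow> g \<in> smooth_functions A \<Longrightarrow>
    X p (\<lambda>q. f q - g q) = X p f - X p g"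
  and vf_apply_mult: "X \<in> vector_fields A \<Longrightarrow> f \<in> smooth_functions A \<Longrightarrow> g \<in> smooth_functions A \<Longrightarrow>
    X p (\<lambda>q. f q * g q) = f p * X p g + g p * X p f"
  and vf_apply_zero: "X \<in> vector_fields A \<Longrightarrow> X p (\<lambda>q. 0) = 0"
  using vector_fieldD(1,2)[of X p] tangent_add[of "X p" p f g] tangent_diff[of "X p" p f g]
    tangent_mult[of "X p" p f g] tangent_zero[of "X p" p]
  by (cases "p \<in> points A"; simp)+

lemma vf_apply_sum: "X \<in> vector_fields A \<Longrightarrow> (\<And>i. i \<in> I \<Longrightarrow> f i \<in> smooth_functions A) \<Longrightarrow>
    X p (\<lambda>q. \<Sum>i\<in>I. f i q) = (\<Sum>i\<in>I. X p (f i))"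
  using vector_fieldD(1,2)[of X p] tangent_sum[of "X p" p I f]
  by (cases "p \<in> points A") simp_all

lemma vf_apply_nonsmooth: "X \<in> vector_fields A \<Longrightarrow> f \<notin> smooth_functions A \<Longrightarrow> X p f = 0"
  using vector_fieldD(1,2)[of X p] tangent_vanish[of "X p" p f]
  by (cases "p \<in> points A") simp_all

definition vf_diff :: "'a vfield \<Rightarrow> 'a vfield \<Rightarrow> 'a vfield" where
  "vf_diff X Y = (\<lambda>p f. X p f - Y p f)"

lemma vf_diff_conv: "vf_diff X Y = vf_add X (vf_scale (\<lambda>p. if p \<in> points A then -1 else 0) Y)"
  if "Y \<in> vector_fields A"
  using vector_fieldD(2)[OF that] by (auto simp: vf_diff_def vf_add_def vf_scale_def fun_eq_iff)

lemma vf_diff_mem: "X \<in> vector_fields A \<Longrightarrow> Y \<in> vector_fields A \<Longrightarrow> vf_diff X Y \<in> vector_fields A"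
  by (simp add: vf_diff_conv vf_add_mem vf_scale_mem smooth_const)

lemma linear_at_diff:
  "linear_at p F \<Longrightarrow> p \<in> points A \<Longrightarrow> X \<in> vector_fields A \<Longrightarrow> Y \<in> vector_fields A \<Longrightarrow> F (vf_diff X Y) = F X - F Y"
  by (simp add: vf_diff_conv linear_at_add linear_at_scale vf_scale_mem smooth_const)

text \<open>
Symmetric tensors seen as maps on lists of vector fields. Covariant derivatives can be
iterated on these maps without first turning each of them into a tensor.
\<close>

definition field_form :: "('a vfield list \<Rightarrow> 'a \<Rightarrow> real) \<Rightarrow> bool" where
  "field_form \<Phi> \<longleftrightarrow> (\<forall>Xs\<in>lists (vector_fields A). \<Phi> Xs \<in> smooth_functions A \<and>
     (\<forall>p\<in>points A. linear_at p (\<lambda>X. \<Phi> (X # Xs) p)) \<and> (\<forall>Ys. mset Ys = mset Xs \<longrightarrow> \<Phi> Ys = \<Phi> Xs))"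

lemma field_formI:
  assumes "\<And>Xs. Xs \<in> lists (vector_fields A) \<Longrightarrow> \<Phi> Xs \<in> smooth_functions A"
    and "\<And>Xs p. Xs \<in> lists (vector_fields A) \<Longrightarrow> p \<in> points A \<Longrightarrow> linear_at p (\<lambda>X. \<Phi> (X # Xs) p)"
    and "\<And>Xs Ys. Xs \<in> lists (vector_fields A) \<Longrightarrow> mset Ys = mset Xs \<Longrightarrow> \<Phi> Ys = \<Phi> Xs"
  shows "field_form \<Phi>"
  unfolding field_form_def by (intro ballI conjI allI impI) (rule assms; assumption)+

lemma field_formD:
  assumes "field_form \<Phi>" "Xs \<in> lists (vector_fields A)"
  shows "\<Phi> Xs \<in> smooth_functions A"
    and "p \<in> points A \<Longrightarrow> linear_at p (\<lambda>X. \<Phi> (X # Xs) p)"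
    and "mset Ys = mset Xs \<Longrightarrow> \<Phi> Ys = \<Phi> Xs"
  using assms(1)[unfolded field_form_def, rule_format, OF assms(2)] by blast+

lemma apply_tensor_field_form: "\<phi> \<in> sym_tensor_algebra A \<Longrightarrow> field_form (apply_tensor \<phi>)"
  by (rule field_formI) (rule algebra_smooth apply_linear_at apply_symmetric; assumption)+

lemma del_nth_fields: "Xs \<in> lists (vector_fields A) \<Longrightarrow> del_nth j Xs \<in> lists (vector_fields A)"
  using set_del_nth[of j Xs] by auto

lemma update_fields: "Xs \<in> lists (vector_fields A) \<Longrightarrow> X \<in> vector_fields A \<Longrightarrow> Xs[j := X] \<in> lists (vector_fields A)"
  using set_update_subset_insert[of Xs j X] by auto

lemma nth_fields: "Xs \<in> lists (vector_fields A) \<Longrightarrow> j < length Xs \<Longrightarrow> Xs ! j \<in> vector_fields A"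
  by (metis in_lists_conv_set nth_mem)

lemma field_form_update:
  assumes "field_form \<Phi>" "Xs \<in> lists (vector_fields A)" "j < length Xs" "X \<in> vector_fields A"
  shows "\<Phi> (Xs[j := X]) = \<Phi> (X # del_nth j Xs)"
proof (rule field_formD(3)[OF assms(1)])
  show "X # del_nth j Xs \<in> lists (vector_fields A)"
    using del_nth_fields[OF assms(2), of j] assms(4) by (rule lists.Cons[rotated])
  show "mset (Xs[j := X]) = mset (X # del_nth j Xs)"
    by (rule mset_update_del[OF assms(3)])
qed

lemma field_form_update_linear:
  assumes "field_form \<Phi>" "Xs \<in> lists (vector_fields A)" "j < length Xs" "p \<in> points A"
  shows "linear_at p (\<lambda>X. \<Phi> (Xs[j := X]) p)"
proof -
  have "linear_at p (\<lambda>X. \<Phi> (X # del_nth j Xs) p)"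
    by (rule field_formD(2)[OF assms(1) del_nth_fields[OF assms(2)] assms(4)])
  then show ?thesis
    unfolding linear_at_def
    by (simp add: field_form_update[OF assms(1-3)] vf_add_mem vf_scale_mem)
qed

lemma field_form_add:
  assumes "field_form \<Phi>" "Xs \<in> lists (vector_fields A)" "Y \<in> vector_fields A" "Z \<in> vector_fields A"
  shows "\<Phi> (vf_add Y Z # Xs) = (\<lambda>p. \<Phi> (Y # Xs) p + \<Phi> (Z # Xs) p)"
proof (rule smooth_eqI)
  show "\<Phi> (vf_add Y Z # Xs) \<in> smooth_functions A" "(\<lambda>p. \<Phi> (Y # Xs) p + \<Phi> (Z # Xs) p) \<in> smooth_functions A"
    using assms by (auto intro!: smooth_add field_formD(1)[OF assms(1)] vf_add_mem)
qed (rule linear_at_add[OF field_formD(2)[OF assms(1,2)] assms(3,4)])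

lemma field_form_scale:
  assumes "field_form \<Phi>" "Xs \<in> lists (vector_fields A)" "h \<in> smooth_functions A" "Y \<in> vector_fields A"
  shows "\<Phi> (vf_scale h Y # Xs) = (\<lambda>p. h p * \<Phi> (Y # Xs) p)"
proof (rule smooth_eqI)
  show "\<Phi> (vf_scale h Y # Xs) \<in> smooth_functions A" "(\<lambda>p. h p * \<Phi> (Y # Xs) p) \<in> smooth_functions A"
    using assms by (auto intro!: smooth_mult field_formD(1)[OF assms(1)] vf_scale_mem)
qed (rule linear_at_scale[OF field_formD(2)[OF assms(1,2)] assms(3,4)])

end

locale affine_manifold = bump_atlas A for A :: "('a, 'e::euclidean_space) atlas" +
  fixes nab :: "'a vfield \<Rightarrow> 'a vfield \<Rightarrow> 'a vfield"
  assumes connection: "affine_connection A nab"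
begin

lemma nab_mem: "X \<in> vector_fields A \<Longrightarrow> Y \<in> vector_fields A \<Longrightarrow> nab X Y \<in> vector_fields A"
  and nab_add_left: "X \<in> vector_fields A \<Longrightarrow> Y \<in> vector_fields A \<Longrightarrow> Z \<in> vector_fields A \<Longrightarrow>
    nab (vf_add X Y) Z = vf_add (nab X Z) (nab Y Z)"
  and nab_add_right: "X \<in> vector_fields A \<Longrightarrow> Y \<in> vector_fields A \<Longrightarrow> Z \<in> vector_fields A \<Longrightarrow>
    nab X (vf_add Y Z) = vf_add (nab X Y) (nab X Z)"
  and nab_scale_left: "h \<in> smooth_functions A \<Longrightarrow> X \<in> vector_fields A \<Longrightarrow> Y \<in> vector_fields A \<Longrightarrow>
    nab (vf_scale h X) Y = vf_scale h (nab X Y)"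
  and nab_scale_right: "h \<in> smooth_functions A \<Longrightarrow> X \<in> vector_fields A \<Longrightarrow> Y \<in> vector_fields A \<Longrightarrow>
    nab X (vf_scale h Y) = vf_add (vf_scale (\<lambda>p. X p h) Y) (vf_scale h (nab X Y))"
  using connection unfolding affine_connection_def deriv_along_def by blast+

text \<open>
The covariant derivative \<open>\<nabla>\<^sub>X \<Phi>\<close>, extended by the product rule to maps on lists of fields.
\<close>

definition cov :: "'a vfield \<Rightarrow> ('a vfield list \<Rightarrow> 'a \<Rightarrow> real) \<Rightarrow> 'a vfield list \<Rightarrow> 'a \<Rightarrow> real" where
  "cov X \<Phi> Xs = (\<lambda>p. X p (\<Phi> Xs) - (\<Sum>i<length Xs. \<Phi> (Xs[i := nab X (Xs ! i)]) p))"

definition symsum :: "('a vfield list \<Rightarrow> 'a \<Rightarrow> real) \<Rightarrow> 'a vfield list \<Rightarrow> 'a \<Rightarrow> real" where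
  "symsum \<Phi> Xs = (\<lambda>p. \<Sum>j<length Xs. cov (Xs ! j) \<Phi> (del_nth j Xs) p)"

lemma cov_cong:
  assumes "\<And>Xs. Xs \<in> lists (vector_fields A) \<Longrightarrow> \<Phi> Xs = \<Psi> Xs" "X \<in> vector_fields A" "Xs \<in> lists (vector_fields A)"
  shows "cov X \<Phi> Xs = cov X \<Psi> Xs"
proof -
  have "\<Phi> (Xs[i := nab X (Xs ! i)]) = \<Psi> (Xs[i := nab X (Xs ! i)])" if "i < length Xs" for i
    by (intro assms(1) update_fields nab_mem assms(2,3) nth_fields that)
  then show ?thesis
    by (simp add: cov_def assms(1)[OF assms(3)])
qed

lemma symsum_cong:
  assumes "\<And>Xs. Xs \<in> lists (vector_fields A) \<Longrightarrow> \<Phi> Xs = \<Psi> Xs" "Xs \<in> lists (vector_fields A)"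
  shows "symsum \<Phi> Xs = symsum \<Psi> Xs"
proof -
  have "cov (Xs ! j) \<Phi> (del_nth j Xs) = cov (Xs ! j) \<Psi> (del_nth j Xs)" if "j < length Xs" for j
    by (rule cov_cong[OF assms(1) nth_fields[OF assms(2) that] del_nth_fields[OF assms(2)]])
  then show ?thesis
    by (simp add: symsum_def)
qed

lemma cov_Cons:
  "cov X \<Phi> (Z # Xs) p = X p (\<Phi> (Z # Xs)) - \<Phi> (nab X Z # Xs) p -
     (\<Sum>i<length Xs. \<Phi> (Z # Xs[i := nab X (Xs ! i)]) p)"
  by (simp add: cov_def sum.lessThan_Suc_shift del: sum.lessThan_Suc)

lemma symsum_Cons:
  "symsum \<Phi> (Z # Xs) p = cov Z \<Phi> Xs p + (\<Sum>j<length Xs. cov (Xs ! j) \<Phi> (Z # del_nth j Xs) p)"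
  by (simp add: symsum_def sum.lessThan_Suc_shift del: sum.lessThan_Suc)

lemma cov_smooth:
  assumes "field_form \<Phi>" "X \<in> vector_fields A" "Xs \<in> lists (vector_fields A)"
  shows "cov X \<Phi> Xs \<in> smooth_functions A"
proof -
  have "\<Phi> (Xs[i := nab X (Xs ! i)]) \<in> smooth_functions A" if "i < length Xs" for i
    by (rule field_formD(1)[OF assms(1) update_fields[OF assms(3) nab_mem[OF assms(2) nth_fields[OF assms(3) that]]]])
  then show ?thesis
    unfolding cov_def
    by (intro smooth_diff smooth_sum vector_fieldD(3)[OF assms(2) field_formD(1)[OF assms(1,3)]]) simp
qed

lemma cov_symmetric:
  assumes "field_form \<Phi>" "X \<in> vector_fields A" "Xs \<in> lists (vector_fields A)" "mset Ys = mset Xs"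
  shows "cov X \<Phi> Ys = cov X \<Phi> Xs"
proof -
  have "(\<Sum>i<length Ys. \<Phi> (Ys[i := nab X (Ys ! i)]) p) = (\<Sum>i<length Xs. \<Phi> (Xs[i := nab X (Xs ! i)]) p)" for p
  proof (rule sum_positions_permute[OF assms(4)])
    fix i j assume ij: "i < length Ys" "j < length Xs" "Ys ! i = Xs ! j"
    have "\<Phi> (Ys[i := nab X (Ys ! i)]) = \<Phi> (Xs[j := nab X (Xs ! j)])"
      by (rule field_formD(3)[OF assms(1) update_fields[OF assms(3) nab_mem[OF assms(2) nth_fields[OF assms(3) ij(2)]]]])
        (simp add: mset_update ij assms(4))
    then show "\<Phi> (Ys[i := nab X (Ys ! i)]) p = \<Phi> (Xs[j := nab X (Xs ! j)]) p"
      by simp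
  qed
  then show ?thesis
    by (simp only: cov_def field_formD(3)[OF assms(1,3,4)])
qed

lemma cov_linear_direction:
  assumes "field_form \<Phi>" "Xs \<in> lists (vector_fields A)" "p \<in> points A"
  shows "linear_at p (\<lambda>X. cov X \<Phi> Xs p)"
  unfolding cov_def
proof (intro linear_at_minus linear_at_sum)
  show "linear_at p (\<lambda>X. X p (\<Phi> Xs))"
    by (rule linear_atI) (simp_all add: vf_add_def vf_scale_def)
  fix i assume "i \<in> {..<length Xs}"
  then have i: "i < length Xs" by simp
  have lin: "linear_at p (\<lambda>Z. \<Phi> (Xs[i := Z]) p)"
    by (rule field_form_update_linear[OF assms(1,2) i assms(3)])
  note Xi = nth_fields[OF assms(2) i]
  show "linear_at p (\<lambda>X. \<Phi> (Xs[i := nab X (Xs ! i)]) p)"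
    using linear_at_add[OF lin nab_mem[OF _ Xi] nab_mem[OF _ Xi]] linear_at_scale[OF lin _ nab_mem[OF _ Xi]]
    by (intro linear_atI) (simp_all add: nab_add_left[OF _ _ Xi] nab_scale_left[OF _ _ Xi])
qed

text \<open>
The derivative of the coefficient \<open>h\<close> appears once from \<open>X\<close> acting on \<open>\<Phi>(h Z, \<dots>)\<close> and once, with the
opposite sign, from \<open>\<nabla>\<^sub>X (h Z)\<close>.
\<close>

lemma cov_linear_argument:
  assumes \<Phi>: "field_form \<Phi>" and X: "X \<in> vector_fields A" and Xs: "Xs \<in> lists (vector_fields A)" and p: "p \<in> points A"
  shows "linear_at p (\<lambda>Z. cov X \<Phi> (Z # Xs) p)"
proof (rule linear_atI)
  have upd: "Xs[i := nab X (Xs ! i)] \<in> lists (vector_fields A)" if "i < length Xs" for i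
    by (intro update_fields Xs nab_mem X nth_fields that)
  have sm: "\<Phi> (Z # Xs) \<in> smooth_functions A" if "Z \<in> vector_fields A" for Z
    using field_formD(1)[OF \<Phi>, of "Z # Xs"] that Xs by simp
  {
    fix Y Z assume Y: "Y \<in> vector_fields A" and Z: "Z \<in> vector_fields A"
    show "cov X \<Phi> (vf_add Y Z # Xs) p = cov X \<Phi> (Y # Xs) p + cov X \<Phi> (Z # Xs) p"
      using upd
      by (simp add: cov_Cons nab_add_right X Y Z field_form_add[OF \<Phi>] Xs nab_mem vf_apply_add sm sum.distrib)
  next
    fix h Z assume h: "h \<in> smooth_functions A" and Z: "Z \<in> vector_fields A"
    note Xh = vector_fieldD(3)[OF X h]
    show "cov X \<Phi> (vf_scale h Z # Xs) p = h p * cov X \<Phi> (Z # Xs) p"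
      using upd
      by (simp add: cov_Cons nab_scale_right X Z h Xh field_form_add[OF \<Phi>] field_form_scale[OF \<Phi>] Xs nab_mem
          vf_apply_mult sm vf_scale_mem sum_distrib_left algebra_simps)
  }
qed

lemma symsum_field_form:
  assumes "field_form \<Phi>"
  shows "field_form (symsum \<Phi>)"
proof (rule field_formI)
  fix Xs assume Xs: "Xs \<in> lists (vector_fields A)"
  show "symsum \<Phi> Xs \<in> smooth_functions A"
    unfolding symsum_def
    by (intro smooth_sum cov_smooth assms nth_fields[OF Xs] del_nth_fields[OF Xs]) simp
  show "symsum \<Phi> Ys = symsum \<Phi> Xs" if perm: "mset Ys = mset Xs" for Ys
    unfolding symsum_def
  proof (rule ext, rule sum_positions_permute[OF perm])
    fix p i j assume ij: "i < length Ys" "j < length Xs" "Ys ! i = Xs ! j"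
    have "cov (Xs ! j) \<Phi> (del_nth i Ys) = cov (Xs ! j) \<Phi> (del_nth j Xs)"
      using ij perm by (intro cov_symmetric[OF assms nth_fields[OF Xs] del_nth_fields[OF Xs]])
        (simp_all only: mset_del_nth)
    then show "cov (Ys ! i) \<Phi> (del_nth i Ys) p = cov (Xs ! j) \<Phi> (del_nth j Xs) p"
      using ij by simp
  qed
  fix p assume p: "p \<in> points A"
  show "linear_at p (\<lambda>X. symsum \<Phi> (X # Xs) p)"
    unfolding symsum_Cons
    by (intro linear_at_plus linear_at_sum cov_linear_direction[OF assms Xs p]
        cov_linear_argument[OF assms nth_fields[OF Xs] del_nth_fields[OF Xs] p]) simp
qed

text \<open>
The description that defines the symmetric derivative has exactly one solution: \<open>symsum\<close> is symmetric and
linear over functions, and tensors are determined by their values on vector fields.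
\<close>

lemma sym_deriv:
  assumes \<phi>: "\<phi> \<in> sym_tensor_algebra A"
  shows "sym_deriv A nab \<phi> \<in> sym_tensor_algebra A"
    and "Xs \<in> lists (vector_fields A) \<Longrightarrow> apply_tensor (sym_deriv A nab \<phi>) Xs = symsum (apply_tensor \<phi>) Xs"
proof -
  note ff = apply_tensor_field_form[OF \<phi>]
  obtain n where "\<forall>p vs. n \<le> length vs \<longrightarrow> \<phi> p vs = 0"
    using algebra_degree[OF \<phi>] ..
  then have n: "apply_tensor \<phi> Xs = (\<lambda>p. 0)" if "n \<le> length Xs" for Xs
    using that by (simp add: apply_tensor_def)
  have "\<exists>\<psi>\<in>sym_tensor_algebra A. \<forall>Xs\<in>lists (vector_fields A). apply_tensor \<psi> Xs = symsum (apply_tensor \<phi>) Xs"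
  proof (rule tensor_from_fields[of _ "Suc n"])
    fix Xs assume Xs: "Xs \<in> lists (vector_fields A)" "Suc n \<le> length Xs"
    have "cov (Xs ! j) (apply_tensor \<phi>) (del_nth j Xs) p = 0" if "j < length Xs" for j p
      using Xs that vf_apply_zero[OF nth_fields[OF Xs(1) that]] by (simp add: cov_def n)
    then show "symsum (apply_tensor \<phi>) Xs = (\<lambda>p. 0)"
      by (simp add: symsum_def)
  qed (rule field_formD[OF symsum_field_form[OF ff]]; assumption)+
  then obtain \<psi> where \<psi>: "\<psi> \<in> sym_tensor_algebra A" "\<forall>Xs\<in>lists (vector_fields A). apply_tensor \<psi> Xs = symsum (apply_tensor \<phi>) Xs"
    by blast
  have def: "sym_deriv A nab \<phi> = (THE \<psi>. \<psi> \<in> sym_tensor_algebra A \<and>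
     (\<forall>Xs\<in>lists (vector_fields A). apply_tensor \<psi> Xs = symsum (apply_tensor \<phi>) Xs))"
    unfolding sym_deriv_def symsum_def cov_def cov_deriv_apply_def deriv_along_def ..
  have "sym_deriv A nab \<phi> = \<psi>"
    unfolding def
  proof (rule the_equality)
    fix \<psi>' assume "\<psi>' \<in> sym_tensor_algebra A \<and> (\<forall>Xs\<in>lists (vector_fields A). apply_tensor \<psi>' Xs = symsum (apply_tensor \<phi>) Xs)"
    then show "\<psi>' = \<psi>"
      using \<psi> by (intro algebra_eqI) auto
  qed (use \<psi> in blast)
  then show "sym_deriv A nab \<phi> \<in> sym_tensor_algebra A"
    and "Xs \<in> lists (vector_fields A) \<Longrightarrow> apply_tensor (sym_deriv A nab \<phi>) Xs = symsum (apply_tensor \<phi>) Xs"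
    using \<psi> by auto
qed

end


section \<open>The symmetric Lie derivative\<close>

context bump_atlas begin

lemma contraction_mem:
  assumes X: "X \<in> vector_fields A" and \<phi>: "\<phi> \<in> sym_tensor_algebra A"
  shows "contraction X \<phi> \<in> sym_tensor_algebra A"
  unfolding algebra_iff
proof (intro conjI allI ballI impI)
  obtain n where n: "\<forall>p vs. n \<le> length vs \<longrightarrow> \<phi> p vs = 0"
    using algebra_degree[OF \<phi>] ..
  show "\<exists>n. \<forall>p vs. n \<le> length vs \<longrightarrow> contraction X \<phi> p vs = 0"
    using n by (intro exI[of _ n]) (simp add: contraction_def)
  show "contraction X \<phi> p vs = 0" if "\<not> (p \<in> points A \<and> set vs \<subseteq> tangent_space A p)" for p vs
    using algebra_outside[OF \<phi>, of p "X p # vs"] that by (auto simp: contraction_def)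
  show "apply_tensor (contraction X \<phi>) Xs \<in> smooth_functions A" if "Xs \<in> lists (vector_fields A)" for Xs
    using algebra_smooth[OF \<phi>, of "X # Xs"] X that by (simp add: apply_tensor_def contraction_def)
  fix p vs assume p: "p \<in> points A" and vs: "vs \<in> lists (tangent_space A p)"
  have Xvs: "X p # vs \<in> lists (tangent_space A p)"
    using vs vector_fieldD(1)[OF X p] by simp
  show "contraction X \<phi> p ws = contraction X \<phi> p vs" if "mset ws = mset vs" for ws
    unfolding contraction_def by (rule algebra_symmetric[OF \<phi> p Xvs]) (simp add: that)
  show "contraction X \<phi> p (vs[i := (\<lambda>f. a * v f + b * w f)]) =
      a * contraction X \<phi> p (vs[i := v]) + b * contraction X \<phi> p (vs[i := w])"
    if "i < length vs" "v \<in> tangent_space A p" "w \<in> tangent_space A p" for i v w a b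
    using algebra_multilinear[OF \<phi> p Xvs, of "Suc i" v w a b] that by (simp add: contraction_def)
qed

lemma apply_contraction: "apply_tensor (contraction X \<phi>) Xs = apply_tensor \<phi> (X # Xs)"
  by (simp add: apply_tensor_def contraction_def)

lemma algebra_diff_mem:
  assumes \<phi>: "\<phi> \<in> sym_tensor_algebra A" and \<psi>: "\<psi> \<in> sym_tensor_algebra A"
  shows "(\<lambda>p vs. \<phi> p vs - \<psi> p vs) \<in> sym_tensor_algebra A"
  unfolding algebra_iff
proof (intro conjI allI ballI impI)
  obtain n m where n: "\<forall>p vs. n \<le> length vs \<longrightarrow> \<phi> p vs = 0" "\<forall>p vs. m \<le> length vs \<longrightarrow> \<psi> p vs = 0"
    using algebra_degree[OF \<phi>] algebra_degree[OF \<psi>] by metis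
  show "\<exists>n. \<forall>p vs. n \<le> length vs \<longrightarrow> \<phi> p vs - \<psi> p vs = 0"
    using n by (intro exI[of _ "max n m"]) simp
  show "\<phi> p vs - \<psi> p vs = 0" if "\<not> (p \<in> points A \<and> set vs \<subseteq> tangent_space A p)" for p vs
    using algebra_outside[OF \<phi> that] algebra_outside[OF \<psi> that] by simp
  show "apply_tensor (\<lambda>p vs. \<phi> p vs - \<psi> p vs) Xs \<in> smooth_functions A" if "Xs \<in> lists (vector_fields A)" for Xs
    using smooth_diff[OF algebra_smooth[OF \<phi> that] algebra_smooth[OF \<psi> that]] by (simp add: apply_tensor_def)
  fix p vs assume p: "p \<in> points A" and vs: "vs \<in> lists (tangent_space A p)"
  show "\<phi> p ws - \<psi> p ws = \<phi> p vs - \<psi> p vs" if "mset ws = mset vs" for ws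
    by (simp only: algebra_symmetric[OF \<phi> p vs that] algebra_symmetric[OF \<psi> p vs that])
  show "\<phi> p (vs[i := (\<lambda>f. a * v f + b * w f)]) - \<psi> p (vs[i := (\<lambda>f. a * v f + b * w f)]) =
      a * (\<phi> p (vs[i := v]) - \<psi> p (vs[i := v])) + b * (\<phi> p (vs[i := w]) - \<psi> p (vs[i := w]))"
    if "i < length vs" "v \<in> tangent_space A p" "w \<in> tangent_space A p" for i v w a b
    by (simp add: algebra_multilinear[OF \<phi> p vs that] algebra_multilinear[OF \<psi> p vs that] algebra_simps)
qed

lemma apply_diff: "apply_tensor (\<lambda>p vs. \<phi> p vs - \<psi> p vs) Xs = (\<lambda>p. apply_tensor \<phi> Xs p - apply_tensor \<psi> Xs p)"
  by (simp add: apply_tensor_def)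

lemma contraction_diff: "contraction X (\<lambda>p vs. \<phi> p vs - \<psi> p vs) = (\<lambda>p vs. contraction X \<phi> p vs - contraction X \<psi> p vs)"
  by (simp add: contraction_def)

lemma function_mem:
  assumes f: "f \<in> smooth_functions A"
  shows "(\<lambda>p vs. if vs = [] then f p else 0) \<in> sym_tensor_algebra A"
  unfolding algebra_iff
proof (intro conjI allI ballI impI)
  show "\<exists>n. \<forall>p vs. n \<le> length vs \<longrightarrow> (if vs = [] then f p else 0) = 0"
    by (intro exI[of _ 1]) auto
  show "(if vs = [] then f p else 0) = 0" if "\<not> (p \<in> points A \<and> set vs \<subseteq> tangent_space A p)" for p and vs :: "'a tangent list"
    using that smooth_outside[OF f, of p] by auto
  show "apply_tensor (\<lambda>p vs. if vs = [] then f p else 0) Xs \<in> smooth_functions A" for Xs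
    using f smooth_zero by (cases Xs) (simp_all add: apply_tensor_def)
qed auto

lemma differential_apply: "p \<in> points A \<Longrightarrow> Y \<in> vector_fields A \<Longrightarrow> apply_tensor (differential A f) [Y] p = Y p f"
  using vector_fieldD(1)[of Y p] by (simp add: apply_tensor_def differential_def)

lemma differential_mem:
  assumes f: "f \<in> smooth_functions A"
  shows "differential A f \<in> sym_tensors A 1"
  unfolding sym_tensors_def mem_Collect_eq
proof (intro conjI allI ballI impI)
  show "differential A f p vs = 0" if "\<not> (p \<in> points A \<and> length vs = 1 \<and> set vs \<subseteq> tangent_space A p)" for p vs
    using that by (auto simp: differential_def)
  show "apply_tensor (differential A f) Xs \<in> smooth_functions A" if Xs: "Xs \<in> lists (vector_fields A)" for Xs
  proof (cases "length Xs = 1")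
    case True
    then obtain Y where Y: "Xs = [Y]" by (cases Xs) auto
    have "apply_tensor (differential A f) Xs = (\<lambda>p. Y p f)"
    proof
      show "apply_tensor (differential A f) Xs p = Y p f" for p
        using Xs Y differential_apply[of p Y f] vector_fieldD(2)[of Y p]
        by (cases "p \<in> points A") (simp_all add: apply_tensor_def differential_def)
    qed
    then show ?thesis
      using vector_fieldD(3)[OF _ f, of Y] Xs Y by simp
  next
    case False
    then have "apply_tensor (differential A f) Xs = (\<lambda>p. 0)"
      by (auto simp: apply_tensor_def differential_def)
    then show ?thesis
      using smooth_zero by simp
  qed
  fix p vs assume p: "p \<in> points A" and vs: "vs \<in> lists (tangent_space A p)"
  show "differential A f p ws = differential A f p vs" if "mset ws = mset vs" for ws
  proof (cases "length vs = 1")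
    case True
    then show ?thesis
      using that by (cases vs) auto
  next
    case False
    then show ?thesis
      using mset_eq_length[OF that] by (simp add: differential_def)
  qed
  show "differential A f p (vs[i := (\<lambda>f. a * v f + b * w f)]) =
      a * differential A f p (vs[i := v]) + b * differential A f p (vs[i := w])"
    if "i < length vs" "v \<in> tangent_space A p" "w \<in> tangent_space A p" for i v w a b
  proof (cases "length vs = 1")
    case True
    then have "i = 0" "\<exists>u. vs = [u]"
      using that(1) by (auto simp: length_Suc_conv)
    then show ?thesis
      using p that(2,3) tangent_space_combination[OF that(2,3)] by (auto simp: differential_def)
  next
    case False
    then show ?thesis by (simp add: differential_def)
  qed
qed

lemma sym_tensors_algebra:
  assumes "\<phi> \<in> sym_tensors A r"
  shows "\<phi> \<in> sym_tensor_algebra A"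
proof -
  have "(\<lambda>p vs. 0) \<in> sym_tensors A k" for k
    unfolding sym_tensors_def using smooth_zero by (simp add: apply_tensor_def)
  then have "\<forall>k<Suc r. (if k = r then \<phi> else (\<lambda>p vs. 0)) \<in> sym_tensors A k"
    using assms by simp
  moreover have "\<phi> = (\<lambda>p vs. \<Sum>k<Suc r. (if k = r then \<phi> else (\<lambda>p vs. 0)) p vs)"
  proof (intro ext)
    fix p vs
    have "(\<Sum>k<r. (if k = r then \<phi> else (\<lambda>p vs. 0)) p vs) = 0"
      by (intro sum.neutral) auto
    then show "\<phi> p vs = (\<Sum>k<Suc r. (if k = r then \<phi> else (\<lambda>p vs. 0)) p vs)"
      by simp
  qed
  ultimately show ?thesis
    unfolding sym_tensor_algebra_def mem_Collect_eq
    by (intro exI[of _ "Suc r"] exI[of _ "\<lambda>k. if k = r then \<phi> else (\<lambda>p vs. 0)"] conjI)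
qed

end

context affine_manifold begin

lemma sym_lie_deriv_mem:
  "X \<in> vector_fields A \<Longrightarrow> \<phi> \<in> sym_tensor_algebra A \<Longrightarrow> sym_lie_deriv A nab X \<phi> \<in> sym_tensor_algebra A"
  unfolding sym_lie_deriv_def by (intro algebra_diff_mem contraction_mem sym_deriv(1))

text \<open>
In \<open>\<nabla>\<^sup>s\<phi>(X, X\<^sub>1, \<dots>)\<close> the term differentiating along \<open>X\<close> stays. The others are compared with \<open>\<nabla>\<^sup>s(\<iota>\<^sub>X \<phi>)\<close>,
which differs from them by the terms where the derivative falls on \<open>X\<close>.
\<close>

lemma apply_sym_lie_deriv:
  assumes X: "X \<in> vector_fields A" and \<phi>: "\<phi> \<in> sym_tensor_algebra A" and Xs: "Xs \<in> lists (vector_fields A)"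
  shows "apply_tensor (sym_lie_deriv A nab X \<phi>) Xs p =
    cov X (apply_tensor \<phi>) Xs p - (\<Sum>j<length Xs. apply_tensor \<phi> (nab (Xs ! j) X # del_nth j Xs) p)"
proof -
  let ?\<Phi> = "apply_tensor \<phi>"
  have "apply_tensor (sym_lie_deriv A nab X \<phi>) Xs p =
      symsum ?\<Phi> (X # Xs) p - symsum (\<lambda>Ys. ?\<Phi> (X # Ys)) Xs p"
    using X Xs by (simp add: sym_lie_deriv_def apply_diff apply_contraction sym_deriv(2) \<phi> contraction_mem
        apply_contraction[abs_def])
  also have "\<dots> = cov X ?\<Phi> Xs p +
      (\<Sum>j<length Xs. cov (Xs ! j) ?\<Phi> (X # del_nth j Xs) p - cov (Xs ! j) (\<lambda>Ys. ?\<Phi> (X # Ys)) (del_nth j Xs) p)"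
    unfolding symsum_Cons by (simp add: symsum_def sum_subtractf)
  also have "(\<Sum>j<length Xs. cov (Xs ! j) ?\<Phi> (X # del_nth j Xs) p - cov (Xs ! j) (\<lambda>Ys. ?\<Phi> (X # Ys)) (del_nth j Xs) p) =
      (\<Sum>j<length Xs. - ?\<Phi> (nab (Xs ! j) X # del_nth j Xs) p)"
    by (simp only: cov_Cons) (simp add: cov_def)
  finally show ?thesis
    by (simp add: sum_negf)
qed

lemma cov_diff:
  assumes "field_form \<Phi>" "field_form \<Psi>" "X \<in> vector_fields A" "Xs \<in> lists (vector_fields A)"
  shows "cov X (\<lambda>Xs q. \<Phi> Xs q - \<Psi> Xs q) Xs p = cov X \<Phi> Xs p - cov X \<Psi> Xs p"
  using field_formD(1)[OF assms(1,4)] field_formD(1)[OF assms(2,4)]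
  by (simp add: cov_def vf_apply_diff[OF assms(3)] sum_subtractf)

lemma sym_deriv_diff:
  assumes \<phi>: "\<phi> \<in> sym_tensor_algebra A" and \<psi>: "\<psi> \<in> sym_tensor_algebra A"
  shows "sym_deriv A nab (\<lambda>p vs. \<phi> p vs - \<psi> p vs) = (\<lambda>p vs. sym_deriv A nab \<phi> p vs - sym_deriv A nab \<psi> p vs)"
proof (rule algebra_eqI)
  fix Xs assume Xs: "Xs \<in> lists (vector_fields A)"
  have "apply_tensor (sym_deriv A nab (\<lambda>p vs. \<phi> p vs - \<psi> p vs)) Xs =
      symsum (\<lambda>Xs q. apply_tensor \<phi> Xs q - apply_tensor \<psi> Xs q) Xs"
    using sym_deriv(2)[OF algebra_diff_mem[OF \<phi> \<psi>] Xs] by (simp add: apply_diff[abs_def])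
  also have "\<dots> = (\<lambda>p. symsum (apply_tensor \<phi>) Xs p - symsum (apply_tensor \<psi>) Xs p)"
    unfolding symsum_def
    by (simp add: cov_diff[OF apply_tensor_field_form[OF \<phi>] apply_tensor_field_form[OF \<psi>] nth_fields[OF Xs]
          del_nth_fields[OF Xs]] sum_subtractf)
  finally show "apply_tensor (sym_deriv A nab (\<lambda>p vs. \<phi> p vs - \<psi> p vs)) Xs =
      apply_tensor (\<lambda>p vs. sym_deriv A nab \<phi> p vs - sym_deriv A nab \<psi> p vs) Xs"
    by (simp add: apply_diff sym_deriv(2) \<phi> \<psi> Xs)
qed (intro sym_deriv(1) algebra_diff_mem \<phi> \<psi>)+

lemma sym_lie_deriv_diff:
  assumes X: "X \<in> vector_fields A" and \<phi>: "\<phi> \<in> sym_tensor_algebra A" and \<psi>: "\<psi> \<in> sym_tensor_algebra A"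
  shows "sym_lie_deriv A nab X (\<lambda>p vs. \<phi> p vs - \<psi> p vs) =
    (\<lambda>p vs. sym_lie_deriv A nab X \<phi> p vs - sym_lie_deriv A nab X \<psi> p vs)"
  by (simp add: sym_lie_deriv_def sym_deriv_diff \<phi> \<psi> contraction_diff contraction_mem X algebra_simps)

lemma sym_bracket_mem: "X \<in> vector_fields A \<Longrightarrow> Y \<in> vector_fields A \<Longrightarrow> sym_bracket nab X Y \<in> vector_fields A"
  unfolding sym_bracket_def by (intro vf_add_mem nab_mem)

text \<open>
By \<open>apply_sym_lie_deriv\<close>, \<open>L\<^sup>s\<^sub>X \<iota>\<^sub>Y \<phi>\<close> lacks the term of \<open>\<iota>\<^sub>Y L\<^sup>s\<^sub>X \<phi>\<close> in which \<open>\<nabla>\<^sub>X\<close> falls on the argument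
\<open>Y\<close>, as well as the term with \<open>\<nabla>\<^sub>Y X\<close>; the remaining terms agree by symmetry of \<open>\<phi>\<close>.
\<close>

lemma commutator_lie_contraction:
  assumes X: "X \<in> vector_fields A" and Y: "Y \<in> vector_fields A"
  shows "operators_eq A (commutator (sym_lie_deriv A nab X) (contraction Y)) (contraction (sym_bracket nab X Y))"
  unfolding operators_eq_def
proof (rule ballI, rule algebra_eqI)
  fix \<phi> assume \<phi>: "\<phi> \<in> sym_tensor_algebra A"
  let ?\<Phi> = "apply_tensor \<phi>"
  note ff = apply_tensor_field_form[OF \<phi>]
  show "commutator (sym_lie_deriv A nab X) (contraction Y) \<phi> \<in> sym_tensor_algebra A"
    unfolding commutator_def by (intro algebra_diff_mem contraction_mem sym_lie_deriv_mem X Y \<phi>)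
  show "contraction (sym_bracket nab X Y) \<phi> \<in> sym_tensor_algebra A"
    by (intro contraction_mem sym_bracket_mem X Y \<phi>)
  fix Xs assume Xs: "Xs \<in> lists (vector_fields A)"
  then have YXs: "Y # Xs \<in> lists (vector_fields A)"
    using Y by simp
  show "apply_tensor (commutator (sym_lie_deriv A nab X) (contraction Y) \<phi>) Xs =
      apply_tensor (contraction (sym_bracket nab X Y) \<phi>) Xs"
  proof
    fix p
    have swap: "?\<Phi> (nab (Xs ! j) X # Y # del_nth j Xs) = ?\<Phi> (Y # nab (Xs ! j) X # del_nth j Xs)" if "j < length Xs" for j
      using Y nab_mem[OF nth_fields[OF Xs that] X] del_nth_fields[OF Xs]
      by (intro field_formD(3)[OF ff]) auto
    have "apply_tensor (commutator (sym_lie_deriv A nab X) (contraction Y) \<phi>) Xs p =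
        cov X (\<lambda>Ys. ?\<Phi> (Y # Ys)) Xs p - (\<Sum>j<length Xs. ?\<Phi> (Y # nab (Xs ! j) X # del_nth j Xs) p) -
        (cov X ?\<Phi> (Y # Xs) p - (\<Sum>j<length (Y # Xs). ?\<Phi> (nab ((Y # Xs) ! j) X # del_nth j (Y # Xs)) p))"
      by (simp only: commutator_def apply_diff apply_contraction apply_contraction[abs_def]
          apply_sym_lie_deriv[OF X \<phi> YXs] apply_sym_lie_deriv[OF X contraction_mem[OF Y \<phi>] Xs])
    also have "(\<Sum>j<length (Y # Xs). ?\<Phi> (nab ((Y # Xs) ! j) X # del_nth j (Y # Xs)) p) =
        ?\<Phi> (nab Y X # Xs) p + (\<Sum>j<length Xs. ?\<Phi> (nab (Xs ! j) X # Y # del_nth j Xs) p)"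
      by (simp add: sum.lessThan_Suc_shift del: sum.lessThan_Suc)
    also have "(\<Sum>j<length Xs. ?\<Phi> (nab (Xs ! j) X # Y # del_nth j Xs) p) =
        (\<Sum>j<length Xs. ?\<Phi> (Y # nab (Xs ! j) X # del_nth j Xs) p)"
      by (simp add: swap)
    finally have "apply_tensor (commutator (sym_lie_deriv A nab X) (contraction Y) \<phi>) Xs p =
        ?\<Phi> (nab X Y # Xs) p + ?\<Phi> (nab Y X # Xs) p"
      unfolding cov_Cons by (simp add: cov_def)
    then show "apply_tensor (commutator (sym_lie_deriv A nab X) (contraction Y) \<phi>) Xs p =
        apply_tensor (contraction (sym_bracket nab X Y) \<phi>) Xs p"
      by (simp add: apply_contraction sym_bracket_def field_form_add[OF ff Xs] nab_mem X Y)
  qed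
qed

text \<open>
The Jacobi identity for \<open>L\<^sup>s\<^sub>X\<close>, \<open>\<iota>\<^sub>Y\<close> and \<open>\<nabla>\<^sup>s\<close>: since \<open>L\<^sup>s\<^sub>X\<close> commutes with \<open>\<nabla>\<^sup>s\<close>, it acts on
\<open>L\<^sup>s\<^sub>Y = [\<iota>\<^sub>Y, \<nabla>\<^sup>s]\<close> through the factor \<open>\<iota>\<^sub>Y\<close> alone.
\<close>

lemma commutator_lie_lie:
  assumes X: "X \<in> vector_fields A" and Y: "Y \<in> vector_fields A"
    and 6: "operators_eq A (commutator (sym_deriv A nab) (sym_lie_deriv A nab X)) zero_operator"
  shows "operators_eq A (commutator (sym_lie_deriv A nab X) (sym_lie_deriv A nab Y)) (sym_lie_deriv A nab (sym_bracket nab X Y))"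
  unfolding operators_eq_def
proof
  fix \<phi> assume \<phi>: "\<phi> \<in> sym_tensor_algebra A"
  let ?L = "sym_lie_deriv A nab X" and ?i = "contraction Y" and ?d = "sym_deriv A nab" and ?j = "contraction (sym_bracket nab X Y)"
  note mem = contraction_mem[OF Y] sym_deriv(1) sym_lie_deriv_mem[OF X]
  have comm: "?d (?L \<psi>) = ?L (?d \<psi>)" if "\<psi> \<in> sym_tensor_algebra A" for \<psi>
  proof (intro ext)
    show "?d (?L \<psi>) p vs = ?L (?d \<psi>) p vs" for p vs
      using 6 that by (auto simp: operators_eq_def commutator_def zero_operator_def fun_eq_iff)
  qed
  have con: "?j \<psi> = (\<lambda>p vs. ?L (?i \<psi>) p vs - ?i (?L \<psi>) p vs)" if "\<psi> \<in> sym_tensor_algebra A" for \<psi>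
    using commutator_lie_contraction[OF X Y] that by (simp add: operators_eq_def commutator_def)
  have "?L (sym_lie_deriv A nab Y \<phi>) = (\<lambda>p vs. ?L (?i (?d \<phi>)) p vs - ?L (?d (?i \<phi>)) p vs)"
    unfolding sym_lie_deriv_def[of A nab Y] by (intro sym_lie_deriv_diff X mem \<phi>)
  moreover have "sym_lie_deriv A nab Y (?L \<phi>) = (\<lambda>p vs. ?i (?L (?d \<phi>)) p vs - ?d (?i (?L \<phi>)) p vs)"
    unfolding sym_lie_deriv_def[of A nab Y] by (simp add: comm \<phi>)
  moreover have "?d (?j \<phi>) = (\<lambda>p vs. ?L (?d (?i \<phi>)) p vs - ?d (?i (?L \<phi>)) p vs)"
    unfolding con[OF \<phi>] by (simp add: sym_deriv_diff mem \<phi> comm)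
  moreover have "?j (?d \<phi>) = (\<lambda>p vs. ?L (?i (?d \<phi>)) p vs - ?i (?L (?d \<phi>)) p vs)"
    by (rule con[OF mem(2)[OF \<phi>]])
  ultimately show "commutator ?L (sym_lie_deriv A nab Y) \<phi> = sym_lie_deriv A nab (sym_bracket nab X Y) \<phi>"
    by (simp add: commutator_def sym_lie_deriv_def[of A nab "sym_bracket nab X Y"] algebra_simps)
qed

end


section \<open>Parallel fields, curvature and the Ricci identity\<close>

context affine_manifold begin

definition curvature :: "'a vfield \<Rightarrow> 'a vfield \<Rightarrow> 'a vfield \<Rightarrow> 'a vfield" where
  "curvature X Y Z = vf_diff (vf_diff (nab X (nab Y Z)) (nab Y (nab X Z))) (nab (lie_bracket X Y) Z)"

definition parallel :: "'a vfield \<Rightarrow> bool" where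
  "parallel X \<longleftrightarrow> (\<forall>Y\<in>vector_fields A. nab Y X = (\<lambda>p f. 0))"

definition annihilates_curvature :: "'a vfield \<Rightarrow> bool" where
  "annihilates_curvature X \<longleftrightarrow> (\<forall>Y\<in>vector_fields A. \<forall>Z\<in>vector_fields A. curvature X Y Z = (\<lambda>p f. 0))"

lemma curvature_mem:
  "X \<in> vector_fields A \<Longrightarrow> Y \<in> vector_fields A \<Longrightarrow> Z \<in> vector_fields A \<Longrightarrow> curvature X Y Z \<in> vector_fields A"
  unfolding curvature_def by (intro vf_diff_mem nab_mem lie_bracket_mem)

lemma linear_at_curvature:
  assumes "linear_at p F" "p \<in> points A" "X \<in> vector_fields A" "Y \<in> vector_fields A" "Z \<in> vector_fields A"
  shows "F (curvature X Y Z) = F (nab X (nab Y Z)) - F (nab Y (nab X Z)) - F (nab (lie_bracket X Y) Z)"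
  unfolding curvature_def
  by (simp add: linear_at_diff[OF assms(1,2)] vf_diff_mem nab_mem lie_bracket_mem assms)

lemma sum_offdiagonal_swap:
  fixes f g :: "nat \<Rightarrow> nat \<Rightarrow> real"
  assumes "\<And>i k. i < n \<Longrightarrow> k < n \<Longrightarrow> i \<noteq> k \<Longrightarrow> f k i = g i k"
  shows "(\<Sum>k<n. \<Sum>i<n. f k i) - (\<Sum>k<n. \<Sum>i<n. g k i) = (\<Sum>k<n. f k k - g k k)"
proof -
  have "(\<Sum>k<n. \<Sum>i<n. g k i) = (\<Sum>k<n. \<Sum>i<n. g i k)"
    by (rule sum.swap)
  then have "(\<Sum>k<n. \<Sum>i<n. f k i) - (\<Sum>k<n. \<Sum>i<n. g k i) = (\<Sum>k<n. \<Sum>i<n. f k i - g i k)"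
    by (simp add: sum_subtractf)
  also have "\<dots> = (\<Sum>k<n. f k k - g k k)"
  proof (intro sum.cong refl)
    fix k assume k: "k \<in> {..<n}"
    have "(\<Sum>i<n. f k i - g i k) = (\<Sum>i<n. if i = k then f k k - g k k else 0)"
      using k assms by (intro sum.cong) auto
    then show "(\<Sum>i<n. f k i - g i k) = f k k - g k k"
      using k by simp
  qed
  finally show ?thesis .
qed

text \<open>
In the antisymmetrized second derivative all terms cancel in which the two derivatives fall on
different places. What is left is \<open>[V, W]\<close> acting on the function and, in each argument, the
commutator of \<open>\<nabla>\<^sub>V\<close> and \<open>\<nabla>\<^sub>W\<close>.
\<close>

lemma ricci_identity:
  assumes ff: "field_form \<Phi>" and V: "V \<in> vector_fields A" and W: "W \<in> vector_fields A"
    and Ys: "Ys \<in> lists (vector_fields A)" and p: "p \<in> points A"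
  shows "cov V (cov W \<Phi>) Ys p - cov W (cov V \<Phi>) Ys p - cov (lie_bracket V W) \<Phi> Ys p =
    - (\<Sum>k<length Ys. \<Phi> (Ys[k := curvature V W (Ys ! k)]) p)"
proof -
  let ?n = "length Ys"
  define u where "u V W k i = \<Phi> (Ys[k := nab V (Ys ! k), i := nab W (Ys[k := nab V (Ys ! k)] ! i)]) p" for V W k i
  note Y = nth_fields[OF Ys]
  have expand: "cov V (cov W \<Phi>) Ys p = V p (\<lambda>q. W q (\<Phi> Ys)) - (\<Sum>i<?n. V p (\<Phi> (Ys[i := nab W (Ys ! i)])))
      - (\<Sum>k<?n. W p (\<Phi> (Ys[k := nab V (Ys ! k)]))) + (\<Sum>k<?n. \<Sum>i<?n. u V W k i)"
    if V: "V \<in> vector_fields A" and W: "W \<in> vector_fields A" for V W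
  proof -
    have sm: "\<Phi> (Ys[i := nab W (Ys ! i)]) \<in> smooth_functions A" if "i < ?n" for i
      by (rule field_formD(1)[OF ff update_fields[OF Ys nab_mem[OF W Y[OF that]]]])
    have "V p (cov W \<Phi> Ys) = V p (\<lambda>q. W q (\<Phi> Ys)) - (\<Sum>i<?n. V p (\<Phi> (Ys[i := nab W (Ys ! i)])))"
    proof -
      have "V p (\<lambda>q. W q (\<Phi> Ys) - (\<Sum>i<?n. \<Phi> (Ys[i := nab W (Ys ! i)]) q)) =
          V p (\<lambda>q. W q (\<Phi> Ys)) - V p (\<lambda>q. \<Sum>i<?n. \<Phi> (Ys[i := nab W (Ys ! i)]) q)"
        by (rule vf_apply_diff[OF V vector_fieldD(3)[OF W field_formD(1)[OF ff Ys]] smooth_sum]) (simp add: sm)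
      also have "V p (\<lambda>q. \<Sum>i<?n. \<Phi> (Ys[i := nab W (Ys ! i)]) q) = (\<Sum>i<?n. V p (\<Phi> (Ys[i := nab W (Ys ! i)])))"
        by (rule vf_apply_sum[OF V]) (simp add: sm)
      finally show ?thesis by (simp only: cov_def)
    qed
    then show ?thesis
      by (simp add: cov_def[of V "cov W \<Phi>"] cov_def[of W \<Phi> "_[_ := _]"] sum_subtractf u_def)
  qed
  have "(\<Sum>k<?n. \<Sum>i<?n. u V W k i) - (\<Sum>k<?n. \<Sum>i<?n. u W V k i) = (\<Sum>k<?n. u V W k k - u W V k k)"
    by (rule sum_offdiagonal_swap) (simp add: u_def list_update_swap)
  moreover have "u V W k k = \<Phi> (Ys[k := nab W (nab V (Ys ! k))]) p" if "k < ?n" for V W k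
    using that by (simp add: u_def)
  ultimately have "cov V (cov W \<Phi>) Ys p - cov W (cov V \<Phi>) Ys p - cov (lie_bracket V W) \<Phi> Ys p =
      (\<Sum>k<?n. \<Phi> (Ys[k := nab W (nab V (Ys ! k))]) p - \<Phi> (Ys[k := nab V (nab W (Ys ! k))]) p
        + \<Phi> (Ys[k := nab (lie_bracket V W) (Ys ! k)]) p)"
    unfolding expand[OF V W] expand[OF W V]
    by (simp add: cov_def lie_bracket_def deriv_along_def sum.distrib sum_subtractf)
  also have "\<dots> = (\<Sum>k<?n. - \<Phi> (Ys[k := curvature V W (Ys ! k)]) p)"
  proof (intro sum.cong refl)
    fix k assume "k \<in> {..<?n}"
    then have k: "k < ?n" by simp
    show "\<Phi> (Ys[k := nab W (nab V (Ys ! k))]) p - \<Phi> (Ys[k := nab V (nab W (Ys ! k))]) p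
        + \<Phi> (Ys[k := nab (lie_bracket V W) (Ys ! k)]) p = - \<Phi> (Ys[k := curvature V W (Ys ! k)]) p"
      using linear_at_curvature[OF field_form_update_linear[OF ff Ys k p] p V W Y[OF k]] by simp
  qed
  finally show ?thesis
    by (simp add: sum_negf)
qed

text \<open>
Position \<open>i\<close> of the argument list, at which \<open>\<nabla>\<^sub>X\<close> acts, is compared with position \<open>j\<close>, the direction of
differentiation: \<open>i = j\<close> produces the derivative along \<open>\<nabla>\<^sub>X X\<^sub>j\<close>, and \<open>i \<noteq> j\<close> the remaining terms of the
second covariant derivative.
\<close>

lemma cov_symsum:
  assumes ff: "field_form \<Phi>" and X: "X \<in> vector_fields A" and Xs: "Xs \<in> lists (vector_fields A)"
  shows "cov X (symsum \<Phi>) Xs p =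
    (\<Sum>j<length Xs. cov X (cov (Xs ! j) \<Phi>) (del_nth j Xs) p - cov (nab X (Xs ! j)) \<Phi> (del_nth j Xs) p)"
proof -
  let ?n = "length Xs" and ?X' = "\<lambda>i. Xs[i := nab X (Xs ! i)]"
  have sm: "cov (Xs ! j) \<Phi> (del_nth j Xs) \<in> smooth_functions A" if "j < ?n" for j
    by (rule cov_smooth[OF ff nth_fields[OF Xs that] del_nth_fields[OF Xs]])
  have "cov X (symsum \<Phi>) Xs p = (\<Sum>j<?n. X p (cov (Xs ! j) \<Phi> (del_nth j Xs))) -
      (\<Sum>i<?n. \<Sum>j<?n. cov (?X' i ! j) \<Phi> (del_nth j (?X' i)) p)"
  proof -
    have "X p (symsum \<Phi> Xs) = (\<Sum>j<?n. X p (cov (Xs ! j) \<Phi> (del_nth j Xs)))"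
      unfolding symsum_def by (rule vf_apply_sum[OF X]) (simp add: sm)
    then show ?thesis
      unfolding cov_def[of X "symsum \<Phi>"] by (simp only: symsum_def[of _ "_[_ := _]"] length_list_update)
  qed
  also have "(\<Sum>i<?n. \<Sum>j<?n. cov (?X' i ! j) \<Phi> (del_nth j (?X' i)) p) =
      (\<Sum>j<?n. \<Sum>i<?n. cov (?X' i ! j) \<Phi> (del_nth j (?X' i)) p)"
    by (rule sum.swap)
  also have "\<dots> = (\<Sum>j<?n. cov (nab X (Xs ! j)) \<Phi> (del_nth j Xs) p +
      (\<Sum>k<length (del_nth j Xs). cov (Xs ! j) \<Phi> ((del_nth j Xs)[k := nab X (del_nth j Xs ! k)]) p))"
  proof (rule sum.cong[OF refl])
    fix j assume "j \<in> {..<?n}"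
    then have j: "j < ?n" by simp
    have "(\<Sum>i<?n. cov (?X' i ! j) \<Phi> (del_nth j (?X' i)) p) = cov (?X' j ! j) \<Phi> (del_nth j (?X' j)) p +
        (\<Sum>k<length (del_nth j Xs). cov (?X' (skip j k) ! j) \<Phi> (del_nth j (?X' (skip j k))) p)"
      by (rule sum_skip[OF j])
    moreover have "?X' j ! j = nab X (Xs ! j)" "del_nth j (?X' j) = del_nth j Xs"
      using j by simp_all
    moreover have "?X' (skip j k) ! j = Xs ! j"
      "del_nth j (?X' (skip j k)) = (del_nth j Xs)[k := nab X (del_nth j Xs ! k)]" if "k < length (del_nth j Xs)" for k
      using del_nth_skip[OF j that] by simp_all
    ultimately show "(\<Sum>i<?n. cov (?X' i ! j) \<Phi> (del_nth j (?X' i)) p) = cov (nab X (Xs ! j)) \<Phi> (del_nth j Xs) p +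
        (\<Sum>k<length (del_nth j Xs). cov (Xs ! j) \<Phi> ((del_nth j Xs)[k := nab X (del_nth j Xs ! k)]) p)"
      by (simp only:) (simp del: length_append length_take length_drop)
  qed
  finally show ?thesis
    by (simp add: cov_def[of X "cov _ _"] sum.distrib sum_subtractf del: length_append length_take length_drop)
qed

end

locale torsion_free_manifold = affine_manifold A nab
  for A :: "('a, 'e::euclidean_space) atlas" and nab +
  assumes torsion_free: "torsion_free A nab"
begin

lemma torsion_free_apply:
  "X \<in> vector_fields A \<Longrightarrow> Y \<in> vector_fields A \<Longrightarrow> nab X Y p f - nab Y X p f = lie_bracket X Y p f"
proof -
  assume "X \<in> vector_fields A" "Y \<in> vector_fields A"
  then have "(\<lambda>p f. nab X Y p f - nab Y X p f) = lie_bracket X Y"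
    using torsion_free unfolding torsion_free_def by blast
  from fun_cong[OF fun_cong[OF this, of p], of f] show ?thesis .
qed

lemma parallel_nab:
  assumes "parallel X" "X \<in> vector_fields A" "Y \<in> vector_fields A"
  shows "nab X Y = lie_bracket X Y"
  using torsion_free_apply[OF assms(2,3)] assms(1,3) by (auto simp: parallel_def fun_eq_iff)

text \<open>
For parallel \<open>X\<close> the first Bianchi identity reduces to this symmetry because \<open>R(Y, Z)X = 0\<close>. Since
\<open>\<nabla>\<^sub>X = [X, -]\<close> on vector fields, it is the Jacobi identity.
\<close>

lemma parallel_curvature_symmetric:
  assumes X: "X \<in> vector_fields A" and par: "parallel X" and Y: "Y \<in> vector_fields A" and Z: "Z \<in> vector_fields A"
  shows "curvature X Y Z = curvature X Z Y"
proof (intro ext)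
  fix p f
  note V = X Y Z lie_bracket_mem[OF X Y] lie_bracket_mem[OF X Z] lie_bracket_mem[OF Y Z]
  show "curvature X Y Z p f = curvature X Z Y p f"
  proof (cases "f \<in> smooth_functions A")
    case True
    have "(\<lambda>q. nab Y Z q f) = (\<lambda>q. nab Z Y q f + lie_bracket Y Z q f)"
      using torsion_free_apply[OF Y Z, of _ f] by (auto simp: fun_eq_iff algebra_simps)
    then have "X p (\<lambda>q. nab Y Z q f) = X p (\<lambda>q. nab Z Y q f) + X p (\<lambda>q. lie_bracket Y Z q f)"
      by (simp add: vf_apply_add[OF X] vector_fieldD(3)[OF nab_mem[OF Z Y] True] vector_fieldD(3)[OF V(6) True])
    then have 1: "lie_bracket X (nab Y Z) p f = lie_bracket X (nab Z Y) p f + lie_bracket X (lie_bracket Y Z) p f"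
      using torsion_free_apply[OF Y Z, of p "\<lambda>q. X q f"]
      unfolding lie_bracket_def[of X] deriv_along_def by linarith
    have 2: "nab Y (lie_bracket X Z) p f - nab (lie_bracket X Z) Y p f = lie_bracket Y (lie_bracket X Z) p f"
      "nab Z (lie_bracket X Y) p f - nab (lie_bracket X Y) Z p f = lie_bracket Z (lie_bracket X Y) p f"
      by (rule torsion_free_apply[OF V(2,5)], rule torsion_free_apply[OF V(3,4)])
    have sm: "(\<lambda>q. V q (\<lambda>q. W q f)) \<in> smooth_functions A" if "V \<in> vector_fields A" "W \<in> vector_fields A" for V W
      by (rule vector_fieldD(3)[OF that(1) vector_fieldD(3)[OF that(2) True]])
    have "lie_bracket X (lie_bracket Y Z) p f - lie_bracket Y (lie_bracket X Z) p f + lie_bracket Z (lie_bracket X Y) p f = 0"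
      by (simp add: lie_bracket_def deriv_along_def 
          vf_apply_diff[OF X sm[OF Y Z] sm[OF Z Y]] vf_apply_diff[OF Y sm[OF X Z] sm[OF Z X]]
          vf_apply_diff[OF Z sm[OF X Y] sm[OF Y X]])
    then show ?thesis
      using 1 2 by (simp add: curvature_def vf_diff_def parallel_nab[OF par X] nab_mem X Y Z)
  next
    case False
    then show ?thesis
      by (simp add: vf_apply_nonsmooth curvature_mem X Y Z)
  qed
qed

lemma apply_sym_lie_deriv_parallel:
  assumes X: "X \<in> vector_fields A" and par: "parallel X" and \<phi>: "\<phi> \<in> sym_tensor_algebra A" and Xs: "Xs \<in> lists (vector_fields A)"
  shows "apply_tensor (sym_lie_deriv A nab X \<phi>) Xs = cov X (apply_tensor \<phi>) Xs"
proof
  fix p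
  have "apply_tensor \<phi> (nab (Xs ! j) X # del_nth j Xs) = (\<lambda>p. 0)" if "j < length Xs" for j
    using par nth_fields[OF Xs that] field_form_scale[OF apply_tensor_field_form[OF \<phi>] del_nth_fields[OF Xs] smooth_zero vf_zero_mem]
    by (simp add: parallel_def vf_scale_def)
  then show "apply_tensor (sym_lie_deriv A nab X \<phi>) Xs p = cov X (apply_tensor \<phi>) Xs p"
    by (simp add: apply_sym_lie_deriv[OF X \<phi> Xs])
qed

lemma commutator_deriv_lie_mem:
  assumes X: "X \<in> vector_fields A" and \<phi>: "\<phi> \<in> sym_tensor_algebra A"
  shows "commutator (sym_deriv A nab) (sym_lie_deriv A nab X) \<phi> \<in> sym_tensor_algebra A"
  unfolding commutator_def by (intro algebra_diff_mem sym_deriv(1) sym_lie_deriv_mem X \<phi>)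

text \<open>
As \<open>L\<^sup>s\<^sub>X = \<nabla>\<^sub>X\<close> and \<open>\<nabla>\<^sub>X X\<^sub>j = [X, X\<^sub>j]\<close>, the commutator is the sum over \<open>j\<close> of the expressions in the Ricci
identity.
\<close>

lemma commutator_deriv_lie_parallel:
  assumes X: "X \<in> vector_fields A" and par: "parallel X" and \<phi>: "\<phi> \<in> sym_tensor_algebra A"
    and Xs: "Xs \<in> lists (vector_fields A)" and p: "p \<in> points A"
  shows "apply_tensor (commutator (sym_deriv A nab) (sym_lie_deriv A nab X) \<phi>) Xs p =
    (\<Sum>j<length Xs. \<Sum>k<length (del_nth j Xs).
       apply_tensor \<phi> ((del_nth j Xs)[k := curvature X (Xs ! j) (del_nth j Xs ! k)]) p)"
proof -
  let ?\<Phi> = "apply_tensor \<phi>"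
  note ff = apply_tensor_field_form[OF \<phi>]
  have "apply_tensor (commutator (sym_deriv A nab) (sym_lie_deriv A nab X) \<phi>) Xs p =
      symsum (apply_tensor (sym_lie_deriv A nab X \<phi>)) Xs p - cov X (apply_tensor (sym_deriv A nab \<phi>)) Xs p"
    by (simp add: commutator_def apply_diff sym_deriv(2)[OF sym_lie_deriv_mem[OF X \<phi>] Xs]
        apply_sym_lie_deriv_parallel[OF X par sym_deriv(1)[OF \<phi>] Xs])
  also have "symsum (apply_tensor (sym_lie_deriv A nab X \<phi>)) Xs = symsum (cov X ?\<Phi>) Xs"
    by (rule symsum_cong[OF apply_sym_lie_deriv_parallel[OF X par \<phi>] Xs])
  also have "cov X (apply_tensor (sym_deriv A nab \<phi>)) Xs = cov X (symsum ?\<Phi>) Xs"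
    by (rule cov_cong[OF sym_deriv(2)[OF \<phi>] X Xs])
  finally have "apply_tensor (commutator (sym_deriv A nab) (sym_lie_deriv A nab X) \<phi>) Xs p =
      (\<Sum>j<length Xs. cov (Xs ! j) (cov X ?\<Phi>) (del_nth j Xs) p -
        (cov X (cov (Xs ! j) ?\<Phi>) (del_nth j Xs) p - cov (nab X (Xs ! j)) ?\<Phi> (del_nth j Xs) p))"
    by (simp only: cov_symsum[OF ff X Xs] symsum_def sum_subtractf)
  also have "\<dots> = (\<Sum>j<length Xs. \<Sum>k<length (del_nth j Xs).
       ?\<Phi> ((del_nth j Xs)[k := curvature X (Xs ! j) (del_nth j Xs ! k)]) p)"
  proof (rule sum.cong[OF refl])
    fix j assume "j \<in> {..<length Xs}"
    then have Z: "Xs ! j \<in> vector_fields A"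
      by (intro nth_fields[OF Xs]) simp
    show "cov (Xs ! j) (cov X ?\<Phi>) (del_nth j Xs) p -
        (cov X (cov (Xs ! j) ?\<Phi>) (del_nth j Xs) p - cov (nab X (Xs ! j)) ?\<Phi> (del_nth j Xs) p) =
      (\<Sum>k<length (del_nth j Xs). ?\<Phi> ((del_nth j Xs)[k := curvature X (Xs ! j) (del_nth j Xs ! k)]) p)"
      unfolding parallel_nab[OF par X Z]
      using ricci_identity[OF ff X Z del_nth_fields[OF Xs] p, of j] by linarith
  qed
  finally show ?thesis .
qed

text \<open>
The difference \<open>Y(X f) - X(Y f) + (\<nabla>\<^sub>X Y) f + (\<nabla>\<^sub>Y X) f\<close>, in which torsion-freeness replaces the Lie
bracket by covariant derivatives.
\<close>

lemma commutator_deriv_lie_function: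
  assumes X: "X \<in> vector_fields A" and Y: "Y \<in> vector_fields A" and f: "f \<in> smooth_functions A"
  shows "apply_tensor (commutator (sym_deriv A nab) (sym_lie_deriv A nab X) (\<lambda>p vs. if vs = [] then f p else 0)) [Y] p =
    2 * nab Y X p f"
proof -
  let ?\<phi> = "\<lambda>p vs. if vs = [] then f p else (0 :: real)"
  note \<phi> = function_mem[OF f]
  have Ys: "[Y] \<in> lists (vector_fields A)" using Y by simp
  have ap: "apply_tensor ?\<phi> [] = f"
    by (simp add: apply_tensor_def)
  have d: "apply_tensor (sym_deriv A nab ?\<phi>) [Z] q = Z q f" if "Z \<in> vector_fields A" for Z q
    using sym_deriv(2)[OF \<phi>, of "[Z]"] that by (simp add: symsum_def cov_def ap)
  have L: "apply_tensor (sym_lie_deriv A nab X ?\<phi>) [] = (\<lambda>q. X q f)"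
    using apply_sym_lie_deriv[OF X \<phi>, of "[]"] by (auto simp: cov_def ap fun_eq_iff)
  have "apply_tensor (sym_deriv A nab (sym_lie_deriv A nab X ?\<phi>)) [Y] p = Y p (\<lambda>q. X q f)"
    using sym_deriv(2)[OF sym_lie_deriv_mem[OF X \<phi>] Ys] by (simp add: symsum_def cov_def L)
  moreover have "apply_tensor (sym_lie_deriv A nab X (sym_deriv A nab ?\<phi>)) [Y] p =
      X p (\<lambda>q. Y q f) - nab X Y p f - nab Y X p f"
  proof -
    have "apply_tensor (sym_deriv A nab ?\<phi>) [Y] = (\<lambda>q. Y q f)"
      using d[OF Y] by (rule ext)
    then show ?thesis
      using apply_sym_lie_deriv[OF X sym_deriv(1)[OF \<phi>] Ys, of p] by (simp add: cov_def d nab_mem X Y)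
  qed
  ultimately show ?thesis
    using torsion_free_apply[OF X Y, of p f]
    by (simp add: commutator_def apply_diff lie_bracket_def deriv_along_def)
qed

lemma commutator_deriv_lie_iff:
  assumes X: "X \<in> vector_fields A"
  shows "operators_eq A (commutator (sym_deriv A nab) (sym_lie_deriv A nab X)) zero_operator \<longleftrightarrow>
    parallel X \<and> annihilates_curvature X"
proof
  assume 6: "operators_eq A (commutator (sym_deriv A nab) (sym_lie_deriv A nab X)) zero_operator"
  then have zero: "apply_tensor (commutator (sym_deriv A nab) (sym_lie_deriv A nab X) \<phi>) Xs p = 0"
    if "\<phi> \<in> sym_tensor_algebra A" for \<phi> Xs p
    using that by (simp add: operators_eq_def zero_operator_def apply_tensor_def)
  have "nab Y X p f = 0" if Y: "Y \<in> vector_fields A" for Y p f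
  proof (cases "f \<in> smooth_functions A")
    case True
    then show ?thesis
      using commutator_deriv_lie_function[OF X Y True, of p] zero[OF function_mem[OF True]] by simp
  next
    case False
    then show ?thesis
      by (rule vf_apply_nonsmooth[OF nab_mem[OF Y X]])
  qed
  then have par: "parallel X"
    by (simp add: parallel_def fun_eq_iff)
  have "curvature X Y Z p f = 0" if Y: "Y \<in> vector_fields A" and Z: "Z \<in> vector_fields A" for Y Z p f
  proof (cases "p \<in> points A \<and> f \<in> smooth_functions A")
    case True
    \<comment> \<open>Exact one-forms separate tangent vectors, as these are derivations.\<close>
    let ?\<alpha> = "differential A f"
    have \<alpha>: "?\<alpha> \<in> sym_tensor_algebra A"
      using True by (intro sym_tensors_algebra[OF differential_mem]) simp
    have "0 = apply_tensor (commutator (sym_deriv A nab) (sym_lie_deriv A nab X) ?\<alpha>) [Y, Z] p"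
      by (rule zero[OF \<alpha>, symmetric])
    also have "\<dots> = (\<Sum>j<length [Y, Z]. \<Sum>k<length (del_nth j [Y, Z]).
       apply_tensor ?\<alpha> ((del_nth j [Y, Z])[k := curvature X ([Y, Z] ! j) (del_nth j [Y, Z] ! k)]) p)"
      using True Y Z by (intro commutator_deriv_lie_parallel[OF X par \<alpha>]) auto
    also have "\<dots> = apply_tensor ?\<alpha> [curvature X Y Z] p + apply_tensor ?\<alpha> [curvature X Z Y] p"
      by (simp add: numeral_2_eq_2)
    also have "\<dots> = 2 * curvature X Y Z p f"
      using True by (simp add: differential_apply curvature_mem X Y Z parallel_curvature_symmetric[OF X par Z Y])
    finally show ?thesis by simp
  next
    case False
    then show ?thesis
      using vector_fieldD(2)[OF curvature_mem[OF X Y Z], of p] vf_apply_nonsmooth[OF curvature_mem[OF X Y Z]] by auto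
  qed
  with par show "parallel X \<and> annihilates_curvature X"
    by (simp add: annihilates_curvature_def fun_eq_iff)
next
  assume "parallel X \<and> annihilates_curvature X"
  then have par: "parallel X" and cur: "annihilates_curvature X" by auto
  show "operators_eq A (commutator (sym_deriv A nab) (sym_lie_deriv A nab X)) zero_operator"
    unfolding operators_eq_def
  proof (rule ballI, rule algebra_eqI)
    fix \<phi> assume \<phi>: "\<phi> \<in> sym_tensor_algebra A"
    show mem: "commutator (sym_deriv A nab) (sym_lie_deriv A nab X) \<phi> \<in> sym_tensor_algebra A"
      by (rule commutator_deriv_lie_mem[OF X \<phi>])
    show "zero_operator \<phi> \<in> sym_tensor_algebra A"
      using algebra_diff_mem[OF \<phi> \<phi>] by (simp add: zero_operator_def)
    fix Xs assume Xs: "Xs \<in> lists (vector_fields A)"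
    show "apply_tensor (commutator (sym_deriv A nab) (sym_lie_deriv A nab X) \<phi>) Xs = apply_tensor (zero_operator \<phi>) Xs"
    proof (rule smooth_eqI)
      show "apply_tensor (commutator (sym_deriv A nab) (sym_lie_deriv A nab X) \<phi>) Xs \<in> smooth_functions A"
        by (rule algebra_smooth[OF mem Xs])
      show "apply_tensor (zero_operator \<phi>) Xs \<in> smooth_functions A"
        using smooth_zero by (simp add: zero_operator_def apply_tensor_def)
      fix p assume p: "p \<in> points A"
      have "apply_tensor \<phi> ((del_nth j Xs)[k := curvature X (Xs ! j) (del_nth j Xs ! k)]) p = 0"
        if j: "j < length Xs" and k: "k < length (del_nth j Xs)" for j k
      proof -
        note Ys = del_nth_fields[OF Xs, of j]
        have "curvature X (Xs ! j) (del_nth j Xs ! k) = (\<lambda>p f. 0)"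
          using cur nth_fields[OF Xs j] nth_fields[OF Ys k] by (simp add: annihilates_curvature_def)
        then show ?thesis
          using linear_at_vanish[OF field_form_update_linear[OF apply_tensor_field_form[OF \<phi>] Ys k p] p vf_zero_mem]
          by simp
      qed
      then show "apply_tensor (commutator (sym_deriv A nab) (sym_lie_deriv A nab X) \<phi>) Xs p = apply_tensor (zero_operator \<phi>) Xs p"
        unfolding commutator_deriv_lie_parallel[OF X par \<phi> Xs p]
        by (simp add: zero_operator_def apply_tensor_def del: length_append length_take length_drop)
    qed
  qed
qed

lemma relations_iff:
  assumes X: "X \<in> vector_fields A" and Y: "Y \<in> vector_fields A"
  shows "(operators_eq A (commutator (contraction X) (contraction Y)) zero_operator \<and>
          operators_eq A (commutator (sym_deriv A nab) (sym_deriv A nab)) zero_operator \<and>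
          operators_eq A (commutator (contraction X) (sym_deriv A nab)) (sym_lie_deriv A nab X) \<and>
          operators_eq A (commutator (sym_lie_deriv A nab X) (contraction Y))
            (contraction (sym_bracket nab X Y)) \<and>
          operators_eq A (commutator (sym_lie_deriv A nab X) (sym_lie_deriv A nab Y))
            (sym_lie_deriv A nab (sym_bracket nab X Y)) \<and>
          operators_eq A (commutator (sym_deriv A nab) (sym_lie_deriv A nab X)) zero_operator)
     \<longleftrightarrow> parallel X \<and> annihilates_curvature X"
proof -
  have "operators_eq A (commutator (contraction X) (contraction Y)) zero_operator"
    unfolding operators_eq_def
  proof (intro ballI ext)
    fix \<phi> p vs assume \<phi>: "\<phi> \<in> sym_tensor_algebra A"
    have "\<phi> p (Y p # X p # vs) = \<phi> p (X p # Y p # vs)"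
    proof (cases "p \<in> points A \<and> set vs \<subseteq> tangent_space A p")
      case True
      then show ?thesis
        using vector_fieldD(1)[OF X, of p] vector_fieldD(1)[OF Y, of p]
        by (intro algebra_symmetric[OF \<phi>]) auto
    next
      case False
      then have "\<not> (p \<in> points A \<and> set (Y p # X p # vs) \<subseteq> tangent_space A p)"
        "\<not> (p \<in> points A \<and> set (X p # Y p # vs) \<subseteq> tangent_space A p)"
        by auto
      then show ?thesis
        using algebra_outside[OF \<phi>] by simp
    qed
    then show "commutator (contraction X) (contraction Y) \<phi> p vs = zero_operator \<phi> p vs"
      by (simp add: commutator_def contraction_def zero_operator_def)
  qed
  moreover have "operators_eq A (commutator (sym_deriv A nab) (sym_deriv A nab)) zero_operator"
    by (simp add: operators_eq_def commutator_def zero_operator_def)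
  moreover have "operators_eq A (commutator (contraction X) (sym_deriv A nab)) (sym_lie_deriv A nab X)"
    by (simp add: operators_eq_def commutator_def sym_lie_deriv_def)
  ultimately show ?thesis
    using commutator_lie_contraction[OF X Y] commutator_lie_lie[OF X Y] commutator_deriv_lie_iff[OF X] by blast
qed

end


section \<open>The atlas of the cotangent bundle\<close>

text \<open>
Splits sums over the coordinates of the cotangent bundle into base and fibre coordinates.
\<close>

lemma sum_Basis_prod:
  fixes F :: "'e::euclidean_space \<times> 'f::euclidean_space \<Rightarrow> real"
  shows "(\<Sum>B\<in>Basis. F B) = (\<Sum>b\<in>Basis. F (b, 0)) + (\<Sum>b\<in>Basis. F (0, b))"
  unfolding Basis_prod_def
  by (subst sum.union_disjoint) (auto simp: sum.reindex inj_on_def)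

context charted begin

lemma covectorD:
  assumes "\<zeta> \<in> cotangent_space A p"
  shows "v \<notin> tangent_space A p \<Longrightarrow> \<zeta> v = 0"
    and "v \<in> tangent_space A p \<Longrightarrow> w \<in> tangent_space A p \<Longrightarrow> \<zeta> (\<lambda>f. a * v f + b * w f) = a * \<zeta> v + b * \<zeta> w"
  using assms unfolding cotangent_space_def by blast+

lemma covector_zero: "\<zeta> \<in> cotangent_space A p \<Longrightarrow> \<zeta> (\<lambda>f. 0) = 0"
  using covectorD(2)[of \<zeta> p "\<lambda>f. 0" "\<lambda>f. 0" 0 0] tangent_space_zero by simp

lemma covector_sum:
  assumes "\<zeta> \<in> cotangent_space A p" "\<And>i. i \<in> I \<Longrightarrow> v i \<in> tangent_space A p"
  shows "\<zeta> (\<lambda>f. \<Sum>i\<in>I. k i * v i f) = (\<Sum>i\<in>I. k i * \<zeta> (v i))"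
  using assms(2)
proof (induction I rule: infinite_finite_induct)
  case (insert i I)
  then show ?case
    using covectorD(2)[OF assms(1), of "v i" "\<lambda>f. \<Sum>i\<in>I. k i * v i f" "k i" 1] tangent_space_sum[of I v p k]
    by simp
qed (simp_all add: covector_zero[OF assms(1)])

lemma coord_vector_change:
  assumes c: "(U, \<phi>) \<in> A" and c': "(V, \<psi>) \<in> A" and p: "p \<in> U" "p \<in> V"
  shows "coord_vector A (V, \<psi>) b p = (\<lambda>f. \<Sum>a\<in>Basis.
    (frechet_derivative (\<phi> \<circ> inv_into V \<psi>) (at (\<psi> p)) b \<bullet> a) * coord_vector A (U, \<phi>) a p f)"
proof
  fix f
  show "coord_vector A (V, \<psi>) b p f = (\<Sum>a\<in>Basis.
    (frechet_derivative (\<phi> \<circ> inv_into V \<psi>) (at (\<psi> p)) b \<bullet> a) * coord_vector A (U, \<phi>) a p f)"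
  proof (cases "f \<in> smooth_functions A")
    case True
    let ?S = "\<psi> ` (V \<inter> U)" and ?\<tau> = "\<phi> \<circ> inv_into V \<psi>"
    let ?g = "\<lambda>y. f (inv_into U \<phi> y)" and ?D\<tau> = "frechet_derivative (\<phi> \<circ> inv_into V \<psi>) (at (\<psi> p))"
    let ?Dg = "frechet_derivative (\<lambda>y. f (inv_into U \<phi> y)) (at (\<phi> p))"
    have x: "\<psi> p \<in> ?S" using p by simp
    have \<tau>p: "?\<tau> (\<psi> p) = \<phi> p"
      by (simp add: chart_inv[OF c' p(2)])
    have \<tau>: "(?\<tau> has_derivative ?D\<tau>) (at (\<psi> p))"
      by (rule smooth_on_has_derivative[OF transition_smooth[OF c' c] x])
    have g: "(?g has_derivative ?Dg) (at (\<phi> p))"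
      by (rule smooth_on_has_derivative[OF smoothD[OF True c]]) (simp add: p)
    have "((\<lambda>y. ?g (?\<tau> y)) has_derivative (\<lambda>v. ?Dg (?D\<tau> v))) (at (\<psi> p))"
      by (rule has_derivative_compose[OF \<tau>]) (simp only: \<tau>p g)
    then have "((\<lambda>y. f (inv_into V \<psi> y)) has_derivative (\<lambda>v. ?Dg (?D\<tau> v))) (at (\<psi> p))"
      by (rule has_derivative_cong_open[OF transition_open[OF c' c] x, THEN iffD1, rotated])
        (auto simp: chart_inv[OF c'] chart_inv[OF c])
    then have "frechet_derivative (\<lambda>y. f (inv_into V \<psi> y)) (at (\<psi> p)) = (\<lambda>v. ?Dg (?D\<tau> v))"
      by (rule frechet_derivative_at[symmetric])
    then have "coord_vector A (V, \<psi>) b p f = ?Dg (?D\<tau> b)"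
      using True by (simp add: coord_vector_def o_def)
    also have "\<dots> = (\<Sum>a\<in>Basis. (?D\<tau> b \<bullet> a) * ?Dg a)"
    proof -
      interpret bounded_linear ?Dg
        using g by (rule has_derivative_bounded_linear)
      show ?thesis
        by (subst (1) euclidean_representation[of "?D\<tau> b", symmetric]) (simp add: sum scaleR)
    qed
    finally show ?thesis
      using True by (simp add: coord_vector_def o_def)
  next
    case False
    then show ?thesis by (simp add: coord_vector_def)
  qed
qed

lemma covector_coord_change:
  assumes c: "(U, \<phi>) \<in> A" and c': "(V, \<psi>) \<in> A" and p: "p \<in> U" "p \<in> V" and \<zeta>: "\<zeta> \<in> cotangent_space A p"
  shows "\<zeta> (coord_vector A (V, \<psi>) b p) = (\<Sum>a\<in>Basis.
    (frechet_derivative (\<phi> \<circ> inv_into V \<psi>) (at (\<psi> p)) b \<bullet> a) * \<zeta> (coord_vector A (U, \<phi>) a p))"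
  unfolding coord_vector_change[OF c c' p]
  by (rule covector_sum[OF \<zeta>]) (rule coord_vector_tangent[OF c p(1)])

end

context bump_atlas begin

text \<open>
At points of the chart where a bump function equals 1, the frame expansion says that the coordinate
vectors are a basis of the tangent space, with the truncated coordinates as dual functions.
\<close>

lemma tangent_coordinates:
  assumes c: "(U, \<phi>) \<in> A" and p: "p \<in> U"
  shows "\<exists>x. (\<forall>v\<in>tangent_space A p. v = (\<lambda>f. \<Sum>b\<in>Basis. v (x b) * coord_vector A (U, \<phi>) b p f)) \<and>
    (\<forall>b\<in>Basis. \<forall>b'\<in>Basis. coord_vector A (U, \<phi>) b p (x b') = (if b = b' then 1 else 0))"
proof -
  obtain \<eta> \<theta> C where bump: "chart_bump A (U, \<phi>) \<eta> \<theta> C" "\<eta> p = 1"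
    using has_bump[OF c p] by blast
  note fr = frame_atD[OF chart_bump_frame[OF bump]]
  have cv: "cut_vector A \<eta> (U, \<phi>) b p = coord_vector A (U, \<phi>) b p" for b
    using bump(2) p by (simp add: cut_vector_def)
  note pp = chart_points[OF c p]
  show ?thesis
  proof (intro exI[of _ "cut_coord \<theta> (U, \<phi>)"] conjI ballI)
    show "v = (\<lambda>f. \<Sum>b\<in>Basis. v (cut_coord \<theta> (U, \<phi>) b) * coord_vector A (U, \<phi>) b p f)"
      if v: "v \<in> tangent_space A p" for v
    proof
      show "v f = (\<Sum>b\<in>Basis. v (cut_coord \<theta> (U, \<phi>) b) * coord_vector A (U, \<phi>) b p f)" for f
        using fr(5)[OF pp v, of f] unfolding cv bump(2) mult_1 .
    qed
    show "coord_vector A (U, \<phi>) b p (cut_coord \<theta> (U, \<phi>) b') = (if b = b' then 1 else 0)"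
      if "b \<in> Basis" "b' \<in> Basis" for b b'
      using fr(6)[OF pp that] unfolding cv bump(2) .
  qed
qed

lemma covector_coord_exists:
  fixes k :: "'e \<Rightarrow> real"
  assumes c: "(U, \<phi>) \<in> A" and p: "p \<in> U"
  shows "\<exists>\<zeta>\<in>cotangent_space A p. \<forall>b\<in>Basis. \<zeta> (coord_vector A (U, \<phi>) b p) = k b"
proof -
  obtain x where x: "\<forall>b\<in>Basis. \<forall>b'\<in>Basis. coord_vector A (U, \<phi>) b p (x b') = (if b = b' then 1 else 0)"
    using tangent_coordinates[OF c p] by blast
  let ?\<zeta> = "\<lambda>v. if v \<in> tangent_space A p then \<Sum>b\<in>Basis. k b * v (x b) else 0"
  have "?\<zeta> \<in> cotangent_space A p"
    unfolding cotangent_space_def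
    by (simp add: tangent_space_combination sum_distrib_left sum.distrib algebra_simps)
  moreover have "?\<zeta> (coord_vector A (U, \<phi>) b p) = k b" if "b \<in> Basis" for b
  proof -
    have "(\<Sum>b'\<in>Basis. k b' * coord_vector A (U, \<phi>) b p (x b')) = (\<Sum>b'\<in>Basis. if b = b' then k b' else 0)"
      by (intro sum.cong refl) (simp add: x[rule_format, OF that])
    then show ?thesis
      using that by (simp add: coord_vector_tangent[OF c p])
  qed
  ultimately show ?thesis
    by (intro bexI[of _ ?\<zeta>] ballI)
qed

lemma covector_eqI:
  assumes c: "(U, \<phi>) \<in> A" and p: "p \<in> U" and \<zeta>: "\<zeta> \<in> cotangent_space A p" and \<xi>: "\<xi> \<in> cotangent_space A p"
    and eq: "\<And>b. b \<in> Basis \<Longrightarrow> \<zeta> (coord_vector A (U, \<phi>) b p) = \<xi> (coord_vector A (U, \<phi>) b p)"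
  shows "\<zeta> = \<xi>"
proof
  fix v
  show "\<zeta> v = \<xi> v"
  proof (cases "v \<in> tangent_space A p")
    case True
    obtain x where "v = (\<lambda>f. \<Sum>b\<in>Basis. v (x b) * coord_vector A (U, \<phi>) b p f)"
      using tangent_coordinates[OF c p] True by auto
    then obtain k where "v = (\<lambda>f. \<Sum>b\<in>Basis. k b * coord_vector A (U, \<phi>) b p f)"
      by (rule that[of "\<lambda>b. v (x b)"])
    moreover have *: "\<omega> (\<lambda>f. \<Sum>b\<in>Basis. k b * coord_vector A (U, \<phi>) b p f) =
        (\<Sum>b\<in>Basis. k b * \<omega> (coord_vector A (U, \<phi>) b p))" if "\<omega> \<in> cotangent_space A p" for \<omega>
      by (rule covector_sum[OF that]) (rule coord_vector_tangent[OF c p])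
    ultimately show ?thesis
      by (simp add: *[OF \<zeta>] *[OF \<xi>] eq)
  next
    case False
    then show ?thesis
      using covectorD(1)[OF \<zeta>] covectorD(1)[OF \<xi>] by simp
  qed
qed

lemma cotangent_overI: "p \<in> U \<Longrightarrow> \<zeta> \<in> cotangent_space A p \<Longrightarrow> (p, \<zeta>) \<in> cotangent_over A U"
  by (simp add: cotangent_over_def)

lemma cotangent_atlasE:
  assumes "(W, \<kappa>) \<in> cotangent_atlas A"
  obtains U \<phi> where "(U, \<phi>) \<in> A" "W = cotangent_over A U" "\<kappa> = cotangent_chart A (U, \<phi>)"
  using assms by (auto simp: cotangent_atlas_def)

lemma cotangent_atlasI: "(U, \<phi>) \<in> A \<Longrightarrow> (cotangent_over A U, cotangent_chart A (U, \<phi>)) \<in> cotangent_atlas A"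
  by (force simp: cotangent_atlas_def)

lemma points_cotangent_atlas: "points (cotangent_atlas A) = cotangent_over A (points A)"
  by (auto simp: points_def cotangent_atlas_def cotangent_over_def)

lemma cotangent_chart_apply:
  "cotangent_chart A (U, \<phi>) (p, \<zeta>) = (\<phi> p, \<Sum>b\<in>Basis. \<zeta> (coord_vector A (U, \<phi>) b p) *\<^sub>R b)"
  by (simp add: cotangent_chart_def)

lemma cotangent_chart_inj:
  assumes c: "(U, \<phi>) \<in> A"
  shows "inj_on (cotangent_chart A (U, \<phi>)) (cotangent_over A U)"
proof (rule inj_onI)
  fix z w assume z: "z \<in> cotangent_over A U" and w: "w \<in> cotangent_over A U"
    and eq: "cotangent_chart A (U, \<phi>) z = cotangent_chart A (U, \<phi>) w"
  obtain p \<zeta> q \<xi> where zw: "z = (p, \<zeta>)" "w = (q, \<xi>)"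
    by (cases z, cases w)
  have p: "p \<in> U" "\<zeta> \<in> cotangent_space A p" "q \<in> U" "\<xi> \<in> cotangent_space A q"
    using z w zw by (auto simp: cotangent_over_def)
  have pq: "p = q"
    using eq p chart_inj[OF c] by (simp add: zw cotangent_chart_apply inj_on_eq_iff)
  have "\<zeta> = \<xi>"
  proof (rule covector_eqI[OF c p(1,2)])
    fix b :: 'e assume b: "b \<in> Basis"
    have "(\<Sum>b\<in>Basis. \<zeta> (coord_vector A (U, \<phi>) b p) *\<^sub>R b) \<bullet> b = (\<Sum>b\<in>Basis. \<xi> (coord_vector A (U, \<phi>) b p) *\<^sub>R b) \<bullet> b"
      using eq pq by (simp add: zw cotangent_chart_apply)
    then show "\<zeta> (coord_vector A (U, \<phi>) b p) = \<xi> (coord_vector A (U, \<phi>) b p)"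
      using b by simp
  qed (use p pq in simp)
  then show "z = w"
    using zw pq by simp
qed

lemma cotangent_chart_image:
  assumes c: "(U, \<phi>) \<in> A" and W: "W \<subseteq> U"
  shows "cotangent_chart A (U, \<phi>) ` cotangent_over A W = \<phi> ` W \<times> UNIV"
proof
  show "cotangent_chart A (U, \<phi>) ` cotangent_over A W \<subseteq> \<phi> ` W \<times> UNIV"
    by (auto simp: cotangent_over_def cotangent_chart_apply)
  show "\<phi> ` W \<times> UNIV \<subseteq> cotangent_chart A (U, \<phi>) ` cotangent_over A W"
  proof
    fix z assume "z \<in> \<phi> ` W \<times> (UNIV :: 'e set)"
    then obtain p \<xi> where z: "z = (\<phi> p, \<xi>)" "p \<in> W" by auto
    then have p: "p \<in> U" using W by auto
    obtain \<zeta> where \<zeta>: "\<zeta> \<in> cotangent_space A p" "\<And>b. b \<in> Basis \<Longrightarrow> \<zeta> (coord_vector A (U, \<phi>) b p) = \<xi> \<bullet> b"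
      using covector_coord_exists[OF c p, of "\<lambda>b. \<xi> \<bullet> b"] by blast
    have "(\<Sum>b\<in>Basis. \<zeta> (coord_vector A (U, \<phi>) b p) *\<^sub>R b) = \<xi>"
      using \<zeta>(2) euclidean_representation[of \<xi>] by simp
    then show "z \<in> cotangent_chart A (U, \<phi>) ` cotangent_over A W"
      using z \<zeta>(1) by (intro image_eqI[of _ _ "(p, \<zeta>)"]) (simp_all add: cotangent_chart_apply cotangent_over_def)
  qed
qed

lemma cotangent_over_Int: "cotangent_over A U \<inter> cotangent_over A V = cotangent_over A (U \<inter> V)"
  by (auto simp: cotangent_over_def)

lemma cotangent_chart_inv:
  assumes c: "(U, \<phi>) \<in> A" and z: "z \<in> cotangent_over A U"
  shows "inv_into (cotangent_over A U) (cotangent_chart A (U, \<phi>)) (cotangent_chart A (U, \<phi>) z) = z"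
  by (rule inv_into_f_f[OF cotangent_chart_inj[OF c] z])

text \<open>
In the fibre the coordinate change is multiplication by the transposed Jacobian matrix of the inverse
coordinate change on the base, taken at the new base coordinates.
\<close>

lemma cotangent_compatible: "compatible_atlas (cotangent_atlas A)"
proof -
  have inj: "inj_on \<kappa> W \<and> open (\<kappa> ` W)" if "(W, \<kappa>) \<in> cotangent_atlas A" for W \<kappa>
    using that
  proof (rule cotangent_atlasE)
    fix U \<phi> assume c: "(U, \<phi>) \<in> A" and eq: "W = cotangent_over A U" "\<kappa> = cotangent_chart A (U, \<phi>)"
    show ?thesis
      unfolding eq cotangent_chart_image[OF c order_refl]
      using cotangent_chart_inj[OF c] chart_open[OF c] by (simp add: open_Times)
  qed
  have trans: "open (\<kappa> ` (W \<inter> W')) \<and> smooth_on (\<kappa> ` (W \<inter> W')) (\<kappa>' \<circ> inv_into W \<kappa>)"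
    if k: "(W, \<kappa>) \<in> cotangent_atlas A" and k': "(W', \<kappa>') \<in> cotangent_atlas A" for W \<kappa> W' \<kappa>'
  proof -
    obtain U \<phi> where c: "(U, \<phi>) \<in> A" and W: "W = cotangent_over A U" "\<kappa> = cotangent_chart A (U, \<phi>)"
      using k by (rule cotangent_atlasE)
    obtain V \<psi> where c': "(V, \<psi>) \<in> A" and W': "W' = cotangent_over A V" "\<kappa>' = cotangent_chart A (V, \<psi>)"
      using k' by (rule cotangent_atlasE)
    let ?O = "\<phi> ` (U \<inter> V)" and ?\<tau> = "\<psi> \<circ> inv_into U \<phi>" and ?\<sigma> = "\<phi> \<circ> inv_into V \<psi>"
    have im: "\<kappa> ` (W \<inter> W') = ?O \<times> UNIV"
      unfolding W W' cotangent_over_Int by (rule cotangent_chart_image[OF c]) simp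
    have op: "open (?O \<times> (UNIV :: 'e set))"
      using transition_open[OF c c'] by (simp add: open_Times)
    define G where "G z = (?\<tau> (fst z), \<Sum>b\<in>Basis. (\<Sum>a\<in>Basis.
        (frechet_derivative ?\<sigma> (at (?\<tau> (fst z))) b \<bullet> a) * (snd z \<bullet> a)) *\<^sub>R b)" for z :: "'e \<times> 'e"
    have fst: "smooth_on (?O \<times> UNIV) (fst :: 'e \<times> 'e \<Rightarrow> 'e)"
      by (rule smooth_on_linear[OF op bounded_linear_fst])
    have \<tau>: "smooth_on (?O \<times> (UNIV :: 'e set)) (\<lambda>z. ?\<tau> (fst z))"
      by (rule smooth_on_compose[OF op transition_open[OF c c'] _ fst transition_smooth[OF c c']]) auto
    have der: "smooth_on (?O \<times> (UNIV :: 'e set)) (\<lambda>z. frechet_derivative ?\<sigma> (at (?\<tau> (fst z))) b)" for b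
    proof (rule smooth_on_compose[OF op transition_open[OF c' c] _ \<tau> smooth_on_frechet[OF transition_smooth[OF c' c]]])
      show "(\<lambda>z. ?\<tau> (fst z)) ` (?O \<times> UNIV) \<subseteq> \<psi> ` (V \<inter> U)"
        by (auto simp: chart_inv[OF c])
    qed
    have sm: "smooth_on (?O \<times> UNIV) G"
      unfolding G_def
      by (intro smooth_on_Pair[OF op \<tau>] smooth_on_sum[OF op]
          smooth_on_bounded_linear[OF op bounded_linear_scaleR_left] smooth_on_mult[OF op]
          smooth_on_bounded_linear[OF op bounded_linear_inner_left der]
          smooth_on_bounded_linear[OF op bounded_linear_inner_left smooth_on_linear[OF op bounded_linear_snd]])
    have eq: "G y = (\<kappa>' \<circ> inv_into W \<kappa>) y" if "y \<in> ?O \<times> UNIV" for y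
    proof -
      have "y \<in> \<kappa> ` (W \<inter> W')" using that im by simp
      then obtain p \<zeta> where y: "y = \<kappa> (p, \<zeta>)" and p: "p \<in> U" "p \<in> V" and \<zeta>: "\<zeta> \<in> cotangent_space A p"
        by (auto simp: W W' cotangent_over_def)
      have "inv_into W \<kappa> y = (p, \<zeta>)"
        unfolding y W by (rule cotangent_chart_inv[OF c cotangent_overI[OF p(1) \<zeta>]])
      moreover have "G y = \<kappa>' (p, \<zeta>)"
        by (simp add: G_def y W W' cotangent_chart_apply chart_inv[OF c p(1)] covector_coord_change[OF c c' p \<zeta>])
      ultimately show ?thesis by simp
    qed
    have "smooth_on (?O \<times> UNIV) (\<kappa>' \<circ> inv_into W \<kappa>)"
      by (rule iffD1[OF smooth_on_cong[OF op eq] sm])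
    then show ?thesis
      using im op by simp
  qed
  show ?thesis
    unfolding compatible_atlas_def using inj trans by blast
qed

end

locale cotangent_charted = bump_atlas A + cot: charted "cotangent_atlas A" for A :: "('a, 'e::euclidean_space) atlas"
begin

lemma pullback_apply: "(p, \<zeta>) \<in> points (cotangent_atlas A) \<Longrightarrow> pullback_function A f (p, \<zeta>) = f p"
  by (simp add: pullback_function_def points_cotangent_atlas)

lemma vertical_apply: "(p, \<zeta>) \<in> points (cotangent_atlas A) \<Longrightarrow> vertical_function A Y (p, \<zeta>) = \<zeta> (Y p)"
  by (simp add: vertical_function_def points_cotangent_atlas)

lemma cotangent_pointsD:
  "(p, \<zeta>) \<in> points (cotangent_atlas A) \<Longrightarrow> p \<in> points A" "(p, \<zeta>) \<in> points (cotangent_atlas A) \<Longrightarrow> \<zeta> \<in> cotangent_space A p"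
  by (simp_all add: points_cotangent_atlas cotangent_over_def)

lemma pullback_outside: "z \<notin> points (cotangent_atlas A) \<Longrightarrow> pullback_function A f z = 0"
  by (cases z) (simp add: pullback_function_def points_cotangent_atlas)

lemma vertical_outside: "z \<notin> points (cotangent_atlas A) \<Longrightarrow> vertical_function A Y z = 0"
  by (cases z) (simp add: vertical_function_def points_cotangent_atlas)

text \<open>
In the induced charts the pullback is the given function of the base coordinates.
\<close>

lemma pullback_smooth:
  assumes f: "f \<in> smooth_functions A"
  shows "pullback_function A f \<in> smooth_functions (cotangent_atlas A)"
proof (rule cot.smoothI[OF pullback_outside])
  fix W \<kappa> assume k: "(W, \<kappa>) \<in> cotangent_atlas A"
  then obtain U \<phi> where c: "(U, \<phi>) \<in> A" and W: "W = cotangent_over A U" "\<kappa> = cotangent_chart A (U, \<phi>)"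
    by (rule cotangent_atlasE)
  have im: "\<kappa> ` W = \<phi> ` U \<times> UNIV"
    unfolding W by (rule cotangent_chart_image[OF c order_refl])
  have op: "open (\<phi> ` U \<times> (UNIV :: 'e set))"
    using chart_open[OF c] by (simp add: open_Times)
  have sm: "smooth_on (\<phi> ` U \<times> (UNIV :: 'e set)) (\<lambda>z. f (inv_into U \<phi> (fst z)))"
    by (rule smooth_on_compose[OF op chart_open[OF c] _ smooth_on_linear[OF op bounded_linear_fst] smoothD[OF f c]]) auto
  have eq: "f (inv_into U \<phi> (fst y)) = pullback_function A f (inv_into W \<kappa> y)" if "y \<in> \<phi> ` U \<times> UNIV" for y
  proof -
    have "y \<in> \<kappa> ` W" using that im by simp
    then obtain p \<zeta> where y: "y = \<kappa> (p, \<zeta>)" and p: "p \<in> U" and \<zeta>: "\<zeta> \<in> cotangent_space A p"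
      by (auto simp: W cotangent_over_def)
    have "inv_into W \<kappa> y = (p, \<zeta>)"
      unfolding y W by (rule cotangent_chart_inv[OF c cotangent_overI[OF p \<zeta>]])
    moreover have "fst y = \<phi> p"
      by (simp add: y W cotangent_chart_apply)
    ultimately show ?thesis
      using p \<zeta> chart_points[OF c p] by (simp add: pullback_function_def cotangent_over_def chart_inv[OF c p])
  qed
  show "smooth_on (\<kappa> ` W) (\<lambda>y. pullback_function A f (inv_into W \<kappa> y))"
    unfolding im by (rule iffD1[OF smooth_on_cong[OF op eq] sm])
qed

lemma cotangent_over_open:
  assumes "atlas_open A V"
  shows "atlas_open (cotangent_atlas A) (cotangent_over A V)"
  unfolding atlas_open_def
proof (intro conjI ballI)
  have V: "V \<subseteq> points A" "\<And>U \<phi>. (U, \<phi>) \<in> A \<Longrightarrow> open (\<phi> ` (V \<inter> U))"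
    using assms by (auto simp: atlas_open_def)
  show "cotangent_over A V \<subseteq> points (cotangent_atlas A)"
    using V(1) by (auto simp: points_cotangent_atlas cotangent_over_def)
  fix k assume "k \<in> cotangent_atlas A"
  moreover obtain W \<kappa> where k: "k = (W, \<kappa>)" by (cases k)
  ultimately obtain U \<phi> where c: "(U, \<phi>) \<in> A" and W: "W = cotangent_over A U" "\<kappa> = cotangent_chart A (U, \<phi>)"
    by (auto elim: cotangent_atlasE)
  have "\<kappa> ` (cotangent_over A V \<inter> W) = \<phi> ` (V \<inter> U) \<times> UNIV"
    unfolding W cotangent_over_Int by (rule cotangent_chart_image[OF c]) simp
  then show "case k of (U, \<phi>) \<Rightarrow> open (\<phi> ` (cotangent_over A V \<inter> U))"
    using V(2)[OF c] by (simp add: k open_Times)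
qed

text \<open>
The support condition in the fibre directions is void because the induced charts contain whole
fibres, and the product of a convex set with the fibre is convex.
\<close>

lemma cotangent_chart_bump:
  assumes bump: "chart_bump A (U, \<phi>) \<eta> \<theta> C"
  shows "chart_bump (cotangent_atlas A) (cotangent_over A U, cotangent_chart A (U, \<phi>))
    (pullback_function A \<eta>) (pullback_function A \<theta>) (C \<times> UNIV)"
  unfolding chart_bump_def fst_conv snd_conv
proof (intro conjI)
  note B = chart_bumpD[OF bump]
  note c = B(1)
  show "(cotangent_over A U, cotangent_chart A (U, \<phi>)) \<in> cotangent_atlas A"
    by (rule cotangent_atlasI[OF c])
  show "pullback_function A \<eta> \<in> smooth_functions (cotangent_atlas A)" "pullback_function A \<theta> \<in> smooth_functions (cotangent_atlas A)"
    by (intro pullback_smooth B(2,3))+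
  show "open (C \<times> (UNIV :: 'e set))" "convex (C \<times> (UNIV :: 'e set))"
    using B(4,5) by (simp_all add: open_Times convex_Times)
  show "C \<times> UNIV \<subseteq> cotangent_chart A (U, \<phi>) ` cotangent_over A U"
    unfolding cotangent_chart_image[OF c order_refl] using B(6) by blast
  show "\<forall>q\<in>cotangent_over A U. cotangent_chart A (U, \<phi>) q \<in> C \<times> UNIV \<longrightarrow> pullback_function A \<theta> q = 1"
    using B(7) chart_points[OF c] by (auto simp: cotangent_over_def cotangent_chart_apply pullback_function_def)
  obtain V where V: "atlas_open A V" "V \<union> {q \<in> U. \<phi> q \<in> C} = points A" "\<forall>q\<in>V. \<eta> q = 0"
    using B(9) by blast
  show "\<exists>V. atlas_open (cotangent_atlas A) V \<and>
      V \<union> {q \<in> cotangent_over A U. cotangent_chart A (U, \<phi>) q \<in> C \<times> UNIV} = points (cotangent_atlas A) \<and>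
      (\<forall>q\<in>V. pullback_function A \<eta> q = 0)"
  proof (intro exI conjI ballI)
    show "atlas_open (cotangent_atlas A) (cotangent_over A V)"
      by (rule cotangent_over_open[OF V(1)])
    show "cotangent_over A V \<union> {q \<in> cotangent_over A U. cotangent_chart A (U, \<phi>) q \<in> C \<times> UNIV} = points (cotangent_atlas A)"
      unfolding points_cotangent_atlas V(2)[symmetric] by (auto simp: cotangent_over_def cotangent_chart_apply)
    show "pullback_function A \<eta> q = 0" if "q \<in> cotangent_over A V" for q
      using that V(3) by (auto simp: cotangent_over_def pullback_function_def)
  qed
  obtain W where W: "atlas_open A W" "W \<union> U = points A" "\<forall>q\<in>W. \<theta> q = 0"
    using B(11) by blast
  show "\<exists>W. atlas_open (cotangent_atlas A) W \<and> W \<union> cotangent_over A U = points (cotangent_atlas A) \<and>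
      (\<forall>q\<in>W. pullback_function A \<theta> q = 0)"
  proof (intro exI conjI ballI)
    show "atlas_open (cotangent_atlas A) (cotangent_over A W)"
      by (rule cotangent_over_open[OF W(1)])
    show "cotangent_over A W \<union> cotangent_over A U = points (cotangent_atlas A)"
      unfolding points_cotangent_atlas W(2)[symmetric] by (auto simp: cotangent_over_def)
    show "pullback_function A \<theta> q = 0" if "q \<in> cotangent_over A W" for q
      using that W(3) by (auto simp: cotangent_over_def pullback_function_def)
  qed
qed

lemma cotangent_bump_atlas: "bump_atlas (cotangent_atlas A)"
proof
  fix W \<kappa> z assume k: "(W, \<kappa>) \<in> cotangent_atlas A" and z: "z \<in> W"
  obtain U \<phi> where c: "(U, \<phi>) \<in> A" and W: "W = cotangent_over A U" "\<kappa> = cotangent_chart A (U, \<phi>)"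
    using k by (rule cotangent_atlasE)
  obtain p \<zeta> where zp: "z = (p, \<zeta>)" "p \<in> U" "\<zeta> \<in> cotangent_space A p"
    using z by (auto simp: W cotangent_over_def)
  obtain \<eta> \<theta> C where bump: "chart_bump A (U, \<phi>) \<eta> \<theta> C" "\<eta> p = 1"
    using has_bump[OF c zp(2)] by blast
  have "pullback_function A \<eta> z = 1"
    using bump(2) zp chart_points[OF c zp(2)] by (simp add: pullback_function_def cotangent_over_def)
  with cotangent_chart_bump[OF bump(1)]
  show "\<exists>\<eta> \<theta> C. chart_bump (cotangent_atlas A) (W, \<kappa>) \<eta> \<theta> C \<and> \<eta> z = 1"
    unfolding W by blast
qed

end


section \<open>Lifting vector fields to the cotangent bundle\<close>

locale cotangent_bundle = cotangent_charted A + cot: bump_atlas "cotangent_atlas A"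
  for A :: "('a, 'e::euclidean_space) atlas"
begin

abbreviation "pb \<equiv> pullback_function A"
abbreviation "vert \<equiv> vertical_function A"
abbreviation "TM \<equiv> cotangent_atlas A"

lemma pullback_mult: "pb (\<lambda>p. f p * h p) = (\<lambda>z. pb f z * pb h z)"
  and pullback_combination: "pb (\<lambda>p. a * f p + b * h p) = (\<lambda>z. a * pb f z + b * pb h z)"
  by (auto simp: pullback_function_def fun_eq_iff)

lemma covector_vf_add:
  assumes "(p, \<zeta>) \<in> points TM" "Y \<in> vector_fields A" "Z \<in> vector_fields A"
  shows "\<zeta> (vf_add Y Z p) = \<zeta> (Y p) + \<zeta> (Z p)"
  using covectorD(2)[OF cotangent_pointsD(2)[OF assms(1)] vector_fieldD(1)[OF assms(2)] vector_fieldD(1)[OF assms(3)], of 1 1]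
    cotangent_pointsD(1)[OF assms(1)] by (simp add: vf_add_def)

lemma covector_vf_scale:
  assumes "(p, \<zeta>) \<in> points TM" "Y \<in> vector_fields A"
  shows "\<zeta> (vf_scale h Y p) = h p * \<zeta> (Y p)"
  using covectorD(2)[OF cotangent_pointsD(2)[OF assms(1)] vector_fieldD(1)[OF assms(2)] vector_fieldD(1)[OF assms(2)], of "h p" 0]
    cotangent_pointsD(1)[OF assms(1)] by (simp add: vf_scale_def)

lemma covector_linear_at: "(p, \<zeta>) \<in> points TM \<Longrightarrow> linear_at p (\<lambda>Y. \<zeta> (Y p))"
  by (rule linear_atI) (simp_all add: covector_vf_add covector_vf_scale)

lemma vertical_add: "Y \<in> vector_fields A \<Longrightarrow> Z \<in> vector_fields A \<Longrightarrow> vert (vf_add Y Z) = (\<lambda>z. vert Y z + vert Z z)"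
proof
  fix z assume Y: "Y \<in> vector_fields A" and Z: "Z \<in> vector_fields A"
  show "vert (vf_add Y Z) z = vert Y z + vert Z z"
    using covector_vf_add[OF _ Y Z] vertical_outside by (cases z; cases "z \<in> points TM") (simp_all add: vertical_apply)
qed

lemma vertical_scale: "Y \<in> vector_fields A \<Longrightarrow> vert (vf_scale h Y) = (\<lambda>z. pb h z * vert Y z)"
proof
  fix z assume Y: "Y \<in> vector_fields A"
  show "vert (vf_scale h Y) z = pb h z * vert Y z"
    using covector_vf_scale[OF _ Y] vertical_outside
    by (cases z; cases "z \<in> points TM") (simp_all add: vertical_apply pullback_apply)
qed

lemma vertical_sum:
  assumes "\<And>i. i \<in> I \<Longrightarrow> h i \<in> smooth_functions A" "\<And>i. i \<in> I \<Longrightarrow> Y i \<in> vector_fields A" "finite I"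
  shows "vert (\<lambda>p f. \<Sum>i\<in>I. h i p * Y i p f) = (\<lambda>z. \<Sum>i\<in>I. pb (h i) z * vert (Y i) z)"
proof
  fix z :: "'a \<times> 'a covector"
  obtain p \<zeta> where z: "z = (p, \<zeta>)" by (cases z)
  show "vert (\<lambda>p f. \<Sum>i\<in>I. h i p * Y i p f) z = (\<Sum>i\<in>I. pb (h i) z * vert (Y i) z)"
  proof (cases "z \<in> points TM")
    case True
    then show ?thesis
      using linear_at_combination[OF covector_linear_at, of p \<zeta> I h Y] assms
      by (simp add: z vertical_apply pullback_apply)
  next
    case False
    then show ?thesis by (simp add: vertical_outside)
  qed
qed

text \<open>
A frame \<open>E\<close> on the base together with a frame of the cotangent bundle, consisting of
the fields \<open>H\<close> along the base coordinates and \<open>V\<close> along the fibre coordinates. The coordinate functions of the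
latter are pullbacks and functions \<open>Y\<^sup>v\<close>, namely those of the fields \<open>Z b\<close>, which are the coordinate
vectors cut off by the wider of the two bump functions.
\<close>

definition lifted_frame ::
    "'a \<Rightarrow> ('a \<Rightarrow> real) \<Rightarrow> ('e \<Rightarrow> 'a \<Rightarrow> real) \<Rightarrow> ('e \<Rightarrow> 'a vfield) \<Rightarrow> ('e \<Rightarrow> 'a vfield) \<Rightarrow>
     ('e \<Rightarrow> ('a \<times> 'a covector) vfield) \<Rightarrow> ('e \<Rightarrow> ('a \<times> 'a covector) vfield) \<Rightarrow> bool" where
  "lifted_frame p \<eta> x E Z H V \<longleftrightarrow> frame_at p \<eta> x E \<and>
     (\<forall>b. Z b \<in> vector_fields A \<and> E b = vf_scale \<eta> (Z b) \<and> H b \<in> vector_fields TM \<and> V b \<in> vector_fields TM) \<and>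
     (\<forall>b\<in>Basis. vert (Z b) \<in> smooth_functions TM) \<and>
     (\<forall>z\<in>points TM. \<forall>Q\<in>tangent_space TM z. \<forall>F.
        pb \<eta> z * Q F = (\<Sum>b\<in>Basis. Q (pb (x b)) * H b z F) + (\<Sum>b\<in>Basis. Q (vert (Z b)) * V b z F)) \<and>
     (\<forall>z\<in>points TM. \<forall>b\<in>Basis. \<forall>b'\<in>Basis.
        H b z (pb (x b')) = (if b = b' then pb \<eta> z else 0) \<and> H b z (vert (Z b')) = 0 \<and>
        V b z (pb (x b')) = 0 \<and> V b z (vert (Z b')) = (if b = b' then pb \<eta> z else 0))"

lemma lifted_frameD:
  assumes "lifted_frame p \<eta> x E Z H V"
  shows "frame_at p \<eta> x E" "Z b \<in> vector_fields A" "E b = vf_scale \<eta> (Z b)" "H b \<in> vector_fields TM" "V b \<in> vector_fields TM"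
    "b \<in> Basis \<Longrightarrow> vert (Z b) \<in> smooth_functions TM"
    "z \<in> points TM \<Longrightarrow> Q \<in> tangent_space TM z \<Longrightarrow>
      pb \<eta> z * Q F = (\<Sum>b\<in>Basis. Q (pb (x b)) * H b z F) + (\<Sum>b\<in>Basis. Q (vert (Z b)) * V b z F)"
    "z \<in> points TM \<Longrightarrow> b \<in> Basis \<Longrightarrow> b' \<in> Basis \<Longrightarrow> H b z (pb (x b')) = (if b = b' then pb \<eta> z else 0)"
    "z \<in> points TM \<Longrightarrow> b \<in> Basis \<Longrightarrow> b' \<in> Basis \<Longrightarrow> H b z (vert (Z b')) = 0"
    "z \<in> points TM \<Longrightarrow> b \<in> Basis \<Longrightarrow> b' \<in> Basis \<Longrightarrow> V b z (pb (x b')) = 0"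
    "z \<in> points TM \<Longrightarrow> b \<in> Basis \<Longrightarrow> b' \<in> Basis \<Longrightarrow> V b z (vert (Z b')) = (if b = b' then pb \<eta> z else 0)"
  using assms unfolding lifted_frame_def by (blast, blast, blast, blast, blast, blast, blast, blast, blast, blast, blast)

lemma chart_bump_lifted_frame:
  assumes bump: "chart_bump A (U, \<phi>) \<eta> \<theta> C" "\<eta> p = 1"
  shows "\<exists>x E Z H V. lifted_frame p \<eta> x E Z H V"
proof -
  note B = chart_bumpD[OF bump(1)]
  let ?c = "(cotangent_over A U, cotangent_chart A (U, \<phi>))"
  let ?x = "cut_coord \<theta> (U, \<phi>)" and ?E = "cut_vector A \<eta> (U, \<phi>)" and ?Z = "cut_vector A \<theta> (U, \<phi>)"
  let ?y = "cut_coord (pb \<theta>) ?c" and ?F = "cut_vector TM (pb \<eta>) ?c"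
  note cb = cotangent_chart_bump[OF bump(1)]
  have Z: "?Z b \<in> vector_fields A" for b
    by (rule cut_vector_mem[OF B(1,3,11)])
  have E: "?E b = vf_scale \<eta> (?Z b)" for b
  proof (intro ext)
    fix q f
    show "?E b q f = vf_scale \<eta> (?Z b) q f"
      using B(7)[of q] B(8)[of q] chart_points[OF B(1), of q]
      by (cases "q \<in> U"; cases "\<phi> q \<in> C") (simp_all add: cut_vector_def vf_scale_def)
  qed
  have y1: "?y (b, 0) = pb (?x b)" for b
    by (auto simp: fun_eq_iff cut_coord_def pullback_function_def cotangent_over_def cotangent_chart_apply
        dest: chart_points[OF B(1)])
  have y2: "?y (0, b) = vert (?Z b)" if b: "b \<in> Basis" for b
  proof
    fix z :: "'a \<times> 'a covector"
    obtain q \<zeta> where z: "z = (q, \<zeta>)" by (cases z)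
    show "?y (0, b) z = vert (?Z b) z"
    proof (cases "z \<in> points TM")
      case True
      note cv = covectorD(2)[OF cotangent_pointsD(2)[OF True[unfolded z]]]
      have over: "z \<in> cotangent_over A U \<longleftrightarrow> q \<in> U"
        using cotangent_pointsD(2)[OF True[unfolded z]] by (simp add: z cotangent_over_def)
      show ?thesis
      proof (cases "q \<in> U")
        case qU: True
        have "\<zeta> (\<lambda>f. \<theta> q * coord_vector A (U, \<phi>) b q f) = \<theta> q * \<zeta> (coord_vector A (U, \<phi>) b q)"
          using cv[OF coord_vector_tangent[OF B(1) qU] coord_vector_tangent[OF B(1) qU], of "\<theta> q" b 0 b] by simp
        moreover have "?Z b q = (\<lambda>f. \<theta> q * coord_vector A (U, \<phi>) b q f)"
          using qU by (simp add: cut_vector_def)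
        ultimately show ?thesis
          using qU True over b
          by (simp add: z cut_coord_def vertical_apply pullback_apply cotangent_chart_apply)
      next
        case False
        then have "?Z b q = (\<lambda>f. 0)"
          by (simp add: cut_vector_def)
        then show ?thesis
          using False over True covector_zero[OF cotangent_pointsD(2)[OF True[unfolded z]]]
          by (simp add: z cut_coord_def vertical_apply)
      qed
    next
      case False
      then have "z \<notin> cotangent_over A U"
        using chart_points[OF B(1)] by (auto simp: points_cotangent_atlas cotangent_over_def)
      then show ?thesis
        by (simp add: cut_coord_def vertical_outside[OF False])
    qed
  qed
  have F: "?F B \<in> vector_fields TM" for B
    by (rule cot.cut_vector_mem[OF cot.chart_bumpD(1,2,10)[OF cb]])
  have vsm: "vert (?Z b) \<in> smooth_functions TM" if "b \<in> Basis" for b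
    using cot.cut_coord_smooth[OF cb, of "(0, b)"] y2[OF that] by simp
  have expand: "pb \<eta> z * Q f = (\<Sum>b\<in>Basis. Q (pb (?x b)) * ?F (b, 0) z f) + (\<Sum>b\<in>Basis. Q (vert (?Z b)) * ?F (0, b) z f)"
    if z: "z \<in> points TM" and Q: "Q \<in> tangent_space TM z" for z Q f
  proof (cases "f \<in> smooth_functions TM")
    case True
    have "(\<Sum>b\<in>Basis. Q (?y (0, b)) * ?F (0, b) z f) = (\<Sum>b\<in>Basis. Q (vert (?Z b)) * ?F (0, b) z f)"
      by (intro sum.cong refl) (simp add: y2)
    then show ?thesis
      unfolding cot.frame_expansion[OF cb z Q True] sum_Basis_prod by (simp only: y1)
  next
    case False
    then show ?thesis
      using cot.tangent_vanish[OF Q] cot.tangent_vanish[OF cot.vector_fieldD(1)[OF F z]] by simp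
  qed
  have dual: "?F (b, 0) z (pb (?x b')) = (if b = b' then pb \<eta> z else 0) \<and> ?F (b, 0) z (vert (?Z b')) = 0 \<and>
        ?F (0, b) z (pb (?x b')) = 0 \<and> ?F (0, b) z (vert (?Z b')) = (if b = b' then pb \<eta> z else 0)"
    if z: "z \<in> points TM" and b: "b \<in> Basis" "b' \<in> Basis" for z b b'
  proof -
    have bb: "(b, 0) \<in> Basis" "(0, b) \<in> Basis" "(b', 0) \<in> Basis" "(0, b') \<in> Basis"
      using b by (auto simp: Basis_prod_def)
    have "b \<noteq> 0" "b' \<noteq> 0" using b nonzero_Basis by blast+
    then show ?thesis
      using cot.cut_vector_cut_coord[OF cb bb(1,3) z] cot.cut_vector_cut_coord[OF cb bb(1,4) z]
        cot.cut_vector_cut_coord[OF cb bb(2,3) z] cot.cut_vector_cut_coord[OF cb bb(2,4) z]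
      by (simp add: y1 y2[OF b(2)])
  qed
  have "lifted_frame p \<eta> ?x ?E ?Z (\<lambda>b. ?F (b, 0)) (\<lambda>b. ?F (0, b))"
    unfolding lifted_frame_def
  proof (intro conjI allI ballI)
    show "frame_at p \<eta> ?x ?E"
      by (rule chart_bump_frame[OF bump])
  qed (rule Z E F vsm expand | (use dual in simp))+
  then show ?thesis by (intro exI)
qed

lemma lifted_frame_exists:
  assumes "p \<in> points A"
  shows "\<exists>\<eta> x E Z H V. lifted_frame p \<eta> x E Z H V"
proof -
  obtain U \<phi> where c: "(U, \<phi>) \<in> A" "p \<in> U"
    using pointsE[OF assms] .
  obtain \<eta> \<theta> C where "chart_bump A (U, \<phi>) \<eta> \<theta> C" "\<eta> p = 1"
    using has_bump[OF c] by blast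
  from chart_bump_lifted_frame[OF this] show ?thesis
    by (rule exI[of _ \<eta>])
qed

text \<open>
After multiplication by \<open>\<eta>\<close> the field is a combination of the \<open>E\<^sub>b = \<eta> Z\<^sub>b\<close>, and the functions of the \<open>Z\<^sub>b\<close>
are truncated fibre coordinates.
\<close>

lemma vertical_smooth:
  assumes Y: "Y \<in> vector_fields A"
  shows "vert Y \<in> smooth_functions TM"
proof (rule cot.smooth_local)
  show "vert Y z = 0" if "z \<notin> points TM" for z
    by (rule vertical_outside[OF that])
  fix z assume "z \<in> points TM"
  moreover obtain p \<zeta> where z: "z = (p, \<zeta>)" by (cases z)
  ultimately have zp: "(p, \<zeta>) \<in> points TM" by simp
  obtain \<eta> x E Z H V where lf: "lifted_frame p \<eta> x E Z H V"
    using lifted_frame_exists[OF cotangent_pointsD(1)[OF zp]] by (elim exE)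
  note D = lifted_frameD[OF lf]
  note fr = frame_atD[OF D(1)]
  have "(\<lambda>z. pb \<eta> z * vert Y z) = vert (vf_scale \<eta> Y)"
    by (rule vertical_scale[OF Y, symmetric])
  also have "\<dots> = (\<lambda>z. \<Sum>b\<in>Basis. pb (\<lambda>q. Y q (x b)) z * vert (E b) z)"
    unfolding frame_vector_field[OF D(1) Y]
    by (rule vertical_sum) (simp_all add: vector_fieldD(3)[OF Y] fr(3,4))
  also have "\<dots> = (\<lambda>z. \<Sum>b\<in>Basis. pb (\<lambda>q. Y q (x b)) z * (pb \<eta> z * vert (Z b) z))"
    unfolding D(3) vertical_scale[OF D(2)] ..
  also have "\<dots> \<in> smooth_functions TM"
    by (intro cot.smooth_sum cot.smooth_mult pullback_smooth vector_fieldD(3)[OF Y] fr(1,3) D(6))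
  finally show "\<exists>\<eta>\<in>smooth_functions TM. \<eta> z \<noteq> 0 \<and> (\<lambda>q. \<eta> q * vert Y q) \<in> smooth_functions TM"
    using pullback_smooth[OF fr(1)] fr(2) zp by (intro bexI[of _ "pb \<eta>"]) (simp_all add: z pullback_apply)
qed

text \<open>
The differential of the projection to the base.
\<close>

definition base_vector :: "('a \<times> 'a covector) tangent \<Rightarrow> 'a tangent" where
  "base_vector Q = (\<lambda>f. if f \<in> smooth_functions A then Q (pb f) else 0)"

lemma base_vector_tangent:
  assumes z: "(p, \<zeta>) \<in> points TM" and Q: "Q \<in> tangent_space TM (p, \<zeta>)"
  shows "base_vector Q \<in> tangent_space A p"
  unfolding tangent_space_def mem_Collect_eq
proof (intro conjI allI ballI impI)
  show "base_vector Q f = 0" if "f \<notin> smooth_functions A" for f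
    using that by (simp add: base_vector_def)
  fix f h assume f: "f \<in> smooth_functions A" and h: "h \<in> smooth_functions A"
  show "base_vector Q (\<lambda>x. a * f x + b * h x) = a * base_vector Q f + b * base_vector Q h" for a b
    using cot.tangent_linear[OF Q pullback_smooth[OF f] pullback_smooth[OF h]] f h
    by (simp add: base_vector_def smooth_add smooth_scale pullback_combination)
  show "base_vector Q (\<lambda>x. f x * h x) = f p * base_vector Q h + h p * base_vector Q f"
    using cot.tangent_mult[OF Q pullback_smooth[OF f] pullback_smooth[OF h]] f h z
    by (simp add: base_vector_def smooth_mult pullback_mult pullback_apply)
qed

lemma tangent_vertical_add:
  assumes "Q \<in> tangent_space TM z" "Y \<in> vector_fields A" "Z \<in> vector_fields A"
  shows "Q (vert (vf_add Y Z)) = Q (vert Y) + Q (vert Z)"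
  unfolding vertical_add[OF assms(2,3)] by (intro cot.tangent_add[OF assms(1)] vertical_smooth assms(2,3))

lemma tangent_vertical_scale:
  assumes "(p, \<zeta>) \<in> points TM" "Q \<in> tangent_space TM (p, \<zeta>)" "h \<in> smooth_functions A" "Y \<in> vector_fields A"
  shows "Q (vert (vf_scale h Y)) = base_vector Q h * \<zeta> (Y p) + h p * Q (vert Y)"
  unfolding vertical_scale[OF assms(4)]
  using cot.tangent_mult[OF assms(2) pullback_smooth[OF assms(3)] vertical_smooth[OF assms(4)]] assms(1,3)
  by (simp add: pullback_apply vertical_apply base_vector_def)

lemma cotangent_tangent_eqI:
  assumes z: "(p, \<zeta>) \<in> points TM" and Q: "Q \<in> tangent_space TM (p, \<zeta>)" and R: "R \<in> tangent_space TM (p, \<zeta>)"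
    and base: "base_vector Q = base_vector R" and vert: "\<And>Y. Y \<in> vector_fields A \<Longrightarrow> Q (vert Y) = R (vert Y)"
  shows "Q = R"
proof
  fix F
  obtain \<eta> x E Z H V where lf: "lifted_frame p \<eta> x E Z H V"
    using lifted_frame_exists[OF cotangent_pointsD(1)[OF z]] by (elim exE)
  note D = lifted_frameD[OF lf]
  note fr = frame_atD[OF D(1)]
  have 1: "pb \<eta> (p, \<zeta>) = 1"
    using z fr(2) by (simp add: pullback_apply)
  have "Q (pb (x b)) = R (pb (x b))" for b
    using fun_cong[OF base, of "x b"] fr(3)[of b] by (simp add: base_vector_def)
  moreover have "Q (vert (Z b)) = R (vert (Z b))" for b
    by (rule vert[OF D(2)])
  ultimately show "Q F = R F"
    using D(7)[OF z Q, of F] D(7)[OF z R, of F] by (simp add: 1)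
qed

text \<open>
The values on the coordinate functions prescribe the vector. That it takes the prescribed value on all
other functions \<open>Y\<^sup>v\<close> holds because the difference of the two values is linear over smooth functions in \<open>Y\<close> and
vanishes on a frame.
\<close>

lemma cotangent_tangent_exists:
  assumes z: "(p, \<zeta>) \<in> points TM" and u: "u \<in> tangent_space A p"
    and add: "\<And>Y Z. Y \<in> vector_fields A \<Longrightarrow> Z \<in> vector_fields A \<Longrightarrow> t (vf_add Y Z) = t Y + t Z"
    and scale: "\<And>h Y. h \<in> smooth_functions A \<Longrightarrow> Y \<in> vector_fields A \<Longrightarrow> t (vf_scale h Y) = u h * \<zeta> (Y p) + h p * t Y"
  shows "\<exists>Q\<in>tangent_space TM (p, \<zeta>). base_vector Q = u \<and> (\<forall>Y\<in>vector_fields A. Q (vert Y) = t Y)"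
proof -
  note p = cotangent_pointsD(1)[OF z]
  obtain \<eta> x E Z H V where lf: "lifted_frame p \<eta> x E Z H V"
    using lifted_frame_exists[OF p] by (elim exE)
  note D = lifted_frameD[OF lf]
  note fr = frame_atD[OF D(1)]
  have 1: "pb \<eta> (p, \<zeta>) = 1"
    using z fr(2) by (simp add: pullback_apply)
  define Q where "Q = (\<lambda>F. 1 * (\<Sum>b\<in>Basis. u (x b) * H b (p, \<zeta>) F) + 1 * (\<Sum>b\<in>Basis. t (Z b) * V b (p, \<zeta>) F))"
  have Q: "Q \<in> tangent_space TM (p, \<zeta>)"
    unfolding Q_def
    by (intro cot.tangent_space_combination cot.tangent_space_sum cot.vector_fieldD(1)[OF D(4) z] cot.vector_fieldD(1)[OF D(5) z])
  have Qx: "base_vector Q (x b) = u (x b)" if b: "b \<in> Basis" for b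
  proof -
    have "(\<Sum>b'\<in>Basis. u (x b') * H b' (p, \<zeta>) (pb (x b))) = (\<Sum>b'\<in>Basis. if b' = b then u (x b') else 0)"
      by (intro sum.cong refl) (simp add: D(8)[OF z _ b] 1)
    then show ?thesis
      using b fr(3) by (simp add: base_vector_def Q_def D(10)[OF z _ b])
  qed
  have QZ: "Q (vert (Z b)) = t (Z b)" if b: "b \<in> Basis" for b
  proof -
    have "(\<Sum>b'\<in>Basis. t (Z b') * V b' (p, \<zeta>) (vert (Z b))) = (\<Sum>b'\<in>Basis. if b' = b then t (Z b') else 0)"
      by (intro sum.cong refl) (simp add: D(11)[OF z _ b] 1)
    then show ?thesis
      using b by (simp add: Q_def D(9)[OF z _ b])
  qed
  have base: "base_vector Q = u"
  proof
    fix f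
    have "(\<Sum>b\<in>Basis. base_vector Q (x b) * E b p f) = (\<Sum>b\<in>Basis. u (x b) * E b p f)"
      by (intro sum.cong refl) (simp add: Qx)
    then show "base_vector Q f = u f"
      using fr(5)[OF p base_vector_tangent[OF z Q], of f] fr(5)[OF p u, of f] fr(2) by simp
  qed
  have lin: "linear_at p (\<lambda>Y. Q (vert Y) - t Y)"
    by (rule linear_atI)
      (simp_all add: tangent_vertical_add[OF Q] add tangent_vertical_scale[OF z Q] scale base algebra_simps)
  have "Q (vert Y) - t Y = 0" if Y: "Y \<in> vector_fields A" for Y
  proof -
    have "Q (vert (E b)) - t (E b) = 0" if "b \<in> Basis" for b
      using linear_at_scale[OF lin fr(1) D(2), of b] QZ[OF that] by (simp add: D(3))
    then show ?thesis
      using linear_at_expansion[OF lin Y D(1)] by simp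
  qed
  then show ?thesis
    using Q base by (intro bexI[of _ Q]) simp_all
qed

text \<open>
A vector field on the cotangent bundle over \<open>X\<close> may be prescribed on the functions \<open>Y\<^sup>v\<close>, subject to
additivity in \<open>Y\<close> and to the product rule for \<open>(h Y)\<^sup>v = pr\<^sup>*h Y\<^sup>v\<close>. Horizontal, vertical and complete lifts
are instances.
\<close>

lemma lift_exists:
  assumes X: "X \<in> vector_fields A" and smooth: "\<And>Y. Y \<in> vector_fields A \<Longrightarrow> T Y \<in> smooth_functions TM"
    and add: "\<And>z Y Z. z \<in> points TM \<Longrightarrow> Y \<in> vector_fields A \<Longrightarrow> Z \<in> vector_fields A \<Longrightarrow> T (vf_add Y Z) z = T Y z + T Z z"
    and scale: "\<And>p \<zeta> h Y. (p, \<zeta>) \<in> points TM \<Longrightarrow> h \<in> smooth_functions A \<Longrightarrow> Y \<in> vector_fields A \<Longrightarrow>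
      T (vf_scale h Y) (p, \<zeta>) = X p h * \<zeta> (Y p) + h p * T Y (p, \<zeta>)"
  shows "\<exists>Q\<in>vector_fields TM. (\<forall>Y\<in>vector_fields A. deriv_along Q (vert Y) = T Y) \<and>
    (\<forall>p \<zeta>. (p, \<zeta>) \<in> points TM \<longrightarrow> base_vector (Q (p, \<zeta>)) = X p)"
proof -
  define P where "P z Q \<longleftrightarrow> Q \<in> tangent_space TM z \<and> base_vector Q = X (fst z) \<and> (\<forall>Y\<in>vector_fields A. Q (vert Y) = T Y z)" for z Q
  define L where "L z = (if z \<in> points TM then SOME Q. P z Q else (\<lambda>_. 0))" for z
  have PL: "P (p, \<zeta>) (L (p, \<zeta>))" if z: "(p, \<zeta>) \<in> points TM" for p \<zeta>
  proof -
    have "\<exists>Q\<in>tangent_space TM (p, \<zeta>). base_vector Q = X p \<and> (\<forall>Y\<in>vector_fields A. Q (vert Y) = T Y (p, \<zeta>))"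
      by (rule cotangent_tangent_exists[OF z vector_fieldD(1)[OF X cotangent_pointsD(1)[OF z]] add[OF z] scale[OF z]])
    then have "\<exists>Q. P (p, \<zeta>) Q"
      unfolding P_def by auto
    then show ?thesis
      using z by (simp add: L_def someI_ex)
  qed
  have tan: "L z \<in> tangent_space TM z" if "z \<in> points TM" for z
    using PL[of "fst z" "snd z"] that by (simp add: P_def)
  have base: "base_vector (L (p, \<zeta>)) = X p" if "(p, \<zeta>) \<in> points TM" for p \<zeta>
    using PL[OF that] by (simp add: P_def)
  have LT: "L z (vert Y) = T Y z" if Y: "Y \<in> vector_fields A" for Y z
  proof (cases "z \<in> points TM")
    case True
    then show ?thesis
      using PL[of "fst z" "snd z"] Y by (simp add: P_def)
  next
    case False
    then show ?thesis
      using cot.smooth_outside[OF smooth[OF Y]] by (simp add: L_def)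
  qed
  have "L \<in> vector_fields TM"
  proof (rule cot.vector_fieldI[OF tan])
    show "L z = (\<lambda>_. 0)" if "z \<notin> points TM" for z
      using that by (simp add: L_def)
    fix F assume F: "F \<in> smooth_functions TM"
    show "(\<lambda>z. L z F) \<in> smooth_functions TM"
    proof (rule cot.smooth_local)
      show "L z F = 0" if "z \<notin> points TM" for z
        using that by (simp add: L_def)
      fix z assume "z \<in> points TM"
      moreover obtain p \<zeta> where z: "z = (p, \<zeta>)" by (cases z)
      ultimately have zp: "(p, \<zeta>) \<in> points TM" by simp
      obtain \<eta> x E Z H V where lf: "lifted_frame p \<eta> x E Z H V"
        using lifted_frame_exists[OF cotangent_pointsD(1)[OF zp]] by (elim exE)
      note D = lifted_frameD[OF lf]
      note fr = frame_atD[OF D(1)]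
      have "(\<lambda>w. pb \<eta> w * L w F) = (\<lambda>w. (\<Sum>b\<in>Basis. pb (\<lambda>q. X q (x b)) w * H b w F) + (\<Sum>b\<in>Basis. T (Z b) w * V b w F))"
      proof
        fix w :: "'a \<times> 'a covector"
        obtain q \<xi> where w: "w = (q, \<xi>)" by (cases w)
        show "pb \<eta> w * L w F = (\<Sum>b\<in>Basis. pb (\<lambda>q. X q (x b)) w * H b w F) + (\<Sum>b\<in>Basis. T (Z b) w * V b w F)"
        proof (cases "w \<in> points TM")
          case True
          have "L w (pb (x b)) = pb (\<lambda>q. X q (x b)) w" for b
            using fun_cong[OF base, of q \<xi> "x b"] True fr(3)[of b] by (simp add: w base_vector_def pullback_apply)
          then show ?thesis
            using D(7)[OF True tan[OF True], of F] by (simp add: LT[OF D(2)])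
        next
          case False
          then show ?thesis
            using cot.vector_fieldD(2)[OF D(4) False] cot.vector_fieldD(2)[OF D(5) False] by (simp add: pullback_outside)
        qed
      qed
      also have "\<dots> \<in> smooth_functions TM"
        by (intro cot.smooth_add cot.smooth_sum cot.smooth_mult pullback_smooth vector_fieldD(3)[OF X] fr(3)
            smooth D(2) cot.vector_fieldD(3)[OF D(4) F] cot.vector_fieldD(3)[OF D(5) F])
      finally show "\<exists>\<eta>\<in>smooth_functions TM. \<eta> z \<noteq> 0 \<and> (\<lambda>q. \<eta> q * L q F) \<in> smooth_functions TM"
        using pullback_smooth[OF fr(1)] fr(2) zp by (intro bexI[of _ "pb \<eta>"]) (simp_all add: z pullback_apply)
    qed
  qed
  then show ?thesis
    using LT base by (intro bexI[of _ L]) (simp_all add: deriv_along_def)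
qed

text \<open>
Values on the functions \<open>Y\<^sup>v\<close> determine those on pullbacks: applied to \<open>(f Y)\<^sup>v = pr\<^sup>*f Y\<^sup>v\<close>, the fields show
that the difference \<open>d\<close> of their values on \<open>pr\<^sup>*f\<close> satisfies \<open>d Y\<^sup>v = 0\<close> for all \<open>Y\<close>. So \<open>d\<close> vanishes where some \<open>Y\<^sup>v\<close>
is nonzero. On the zero section, differentiating \<open>d Y\<^sup>v = 0\<close> in a fibre direction gives \<open>d = 0\<close>.
\<close>

lemma lift_unique:
  assumes Q: "Q \<in> vector_fields TM" and R: "R \<in> vector_fields TM"
    and eq: "\<And>Y. Y \<in> vector_fields A \<Longrightarrow> deriv_along Q (vert Y) = deriv_along R (vert Y)"
  shows "Q = R"
proof
  fix z :: "'a \<times> 'a covector"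
  obtain p \<zeta> where z: "z = (p, \<zeta>)" by (cases z)
  show "Q z = R z"
  proof (cases "z \<in> points TM")
    case True
    note zp = True[unfolded z] and tan = cot.vector_fieldD(1)[OF Q] cot.vector_fieldD(1)[OF R]
    have eqv: "Q w (vert Y) = R w (vert Y)" if "Y \<in> vector_fields A" for Y w
      using fun_cong[OF eq[OF that], of w] by (simp add: deriv_along_def)
    obtain \<eta> x E Z H V where lf: "lifted_frame p \<eta> x E Z H V"
      using lifted_frame_exists[OF cotangent_pointsD(1)[OF zp]] by (elim exE)
    note D = lifted_frameD[OF lf]
    note fr = frame_atD[OF D(1)]
    have "Q z (pb f) = R z (pb f)" if f: "f \<in> smooth_functions A" for f
    proof -
      define d where "d w = Q w (pb f) - R w (pb f)" for w
      have d: "d \<in> smooth_functions TM"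
        unfolding d_def by (intro cot.smooth_diff cot.vector_fieldD(3)[OF Q] cot.vector_fieldD(3)[OF R] pullback_smooth f)
      have dv: "d w * vert Y w = 0" if Y: "Y \<in> vector_fields A" for Y w
      proof (cases "w \<in> points TM")
        case True
        show ?thesis
          using eqv[OF vf_scale_mem[OF f Y], of w] eqv[OF Y, of w]
            cot.tangent_mult[OF tan(1)[OF True] pullback_smooth[OF f] vertical_smooth[OF Y]]
            cot.tangent_mult[OF tan(2)[OF True] pullback_smooth[OF f] vertical_smooth[OF Y]]
          by (simp add: vertical_scale[OF Y] d_def algebra_simps)
      next
        case False
        then show ?thesis by (simp add: vertical_outside)
      qed
      obtain b :: 'e where b: "b \<in> Basis"
        using nonempty_Basis by blast
      have "V b z (\<lambda>w. d w * vert (Z b) w) = 0"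
        using cot.tangent_zero[OF cot.vector_fieldD(1)[OF D(5) True]] by (simp add: dv[OF D(2)])
      moreover have "V b z (\<lambda>w. d w * vert (Z b) w) = d z * V b z (vert (Z b)) + vert (Z b) z * V b z d"
        by (rule cot.tangent_mult[OF cot.vector_fieldD(1)[OF D(5) True] d D(6)[OF b]])
      moreover have "V b z (vert (Z b)) = 1"
        using D(11)[OF True b b] fr(2) zp by (simp add: z pullback_apply)
      ultimately have "d z = 0"
        using dv[OF D(2), of z b] by (cases "vert (Z b) z = 0") simp_all
      then show ?thesis by (simp add: d_def)
    qed
    then have "base_vector (Q z) = base_vector (R z)"
      by (simp add: base_vector_def fun_eq_iff)
    then show ?thesis
      using cotangent_tangent_eqI[OF zp] tan[OF True] eqv by (simp add: z)
  next
    case False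
    then show ?thesis
      using cot.vector_fieldD(2)[OF Q] cot.vector_fieldD(2)[OF R] by simp
  qed
qed

lemma lift:
  assumes X: "X \<in> vector_fields A" and smooth: "\<And>Y. Y \<in> vector_fields A \<Longrightarrow> T Y \<in> smooth_functions TM"
    and add: "\<And>z Y Z. z \<in> points TM \<Longrightarrow> Y \<in> vector_fields A \<Longrightarrow> Z \<in> vector_fields A \<Longrightarrow> T (vf_add Y Z) z = T Y z + T Z z"
    and scale: "\<And>p \<zeta> h Y. (p, \<zeta>) \<in> points TM \<Longrightarrow> h \<in> smooth_functions A \<Longrightarrow> Y \<in> vector_fields A \<Longrightarrow>
      T (vf_scale h Y) (p, \<zeta>) = X p h * \<zeta> (Y p) + h p * T Y (p, \<zeta>)"
    and L: "L = (THE Q. Q \<in> vector_fields TM \<and> (\<forall>Y\<in>vector_fields A. deriv_along Q (vert Y) = T Y))"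
  shows "L \<in> vector_fields TM" "Y \<in> vector_fields A \<Longrightarrow> L z (vert Y) = T Y z"
    "(p, \<zeta>) \<in> points TM \<Longrightarrow> base_vector (L (p, \<zeta>)) = X p"
proof -
  obtain Q where Q: "Q \<in> vector_fields TM" "\<forall>Y\<in>vector_fields A. deriv_along Q (vert Y) = T Y"
      "\<forall>p \<zeta>. (p, \<zeta>) \<in> points TM \<longrightarrow> base_vector (Q (p, \<zeta>)) = X p"
    using lift_exists[OF X smooth add scale] by blast
  have "L = Q"
    unfolding L
  proof (rule the_equality)
    fix R assume R: "R \<in> vector_fields TM \<and> (\<forall>Y\<in>vector_fields A. deriv_along R (vert Y) = T Y)"
    show "R = Q"
      by (rule lift_unique) (use Q R in simp_all)
  qed (use Q in blast)
  then show "L \<in> vector_fields TM" "Y \<in> vector_fields A \<Longrightarrow> L z (vert Y) = T Y z"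
    "(p, \<zeta>) \<in> points TM \<Longrightarrow> base_vector (L (p, \<zeta>)) = X p"
    using Q(1) fun_cong[OF bspec[OF Q(2)], of Y z] Q(3) by (simp_all add: deriv_along_def)
qed

end


section \<open>The Patterson-Walker metric\<close>

context bump_atlas begin

lemma lie_bracket_add_right:
  assumes X: "X \<in> vector_fields A" and Y: "Y \<in> vector_fields A" and Z: "Z \<in> vector_fields A"
  shows "lie_bracket X (vf_add Y Z) = vf_add (lie_bracket X Y) (lie_bracket X Z)"
proof (intro ext)
  fix p f
  show "lie_bracket X (vf_add Y Z) p f = vf_add (lie_bracket X Y) (lie_bracket X Z) p f"
  proof (cases "f \<in> smooth_functions A")
    case True
    show ?thesis
      using vf_apply_add[OF X vector_fieldD(3)[OF Y True] vector_fieldD(3)[OF Z True], of p]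
      by (simp add: lie_bracket_def deriv_along_def vf_add_def)
  next
    case False
    then show ?thesis
      by (simp add: vf_apply_nonsmooth vf_add_mem lie_bracket_mem X Y Z)
  qed
qed

text \<open>
Serves both the complete lift and the tensoriality of the Lie derivative of the metric.
\<close>

lemma lie_bracket_scale_right:
  assumes X: "X \<in> vector_fields A" and Y: "Y \<in> vector_fields A" and h: "h \<in> smooth_functions A"
  shows "lie_bracket X (vf_scale h Y) = vf_add (vf_scale (\<lambda>p. X p h) Y) (vf_scale h (lie_bracket X Y))"
proof (intro ext)
  fix p f
  show "lie_bracket X (vf_scale h Y) p f = vf_add (vf_scale (\<lambda>p. X p h) Y) (vf_scale h (lie_bracket X Y)) p f"
  proof (cases "f \<in> smooth_functions A")
    case True
    show ?thesis
      using vf_apply_mult[OF X h vector_fieldD(3)[OF Y True], of p]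
      by (simp add: lie_bracket_def deriv_along_def vf_add_def vf_scale_def algebra_simps)
  next
    case False
    then show ?thesis
      by (simp add: vf_apply_nonsmooth vf_add_mem vf_scale_mem lie_bracket_mem vector_fieldD(3)[OF X h] X Y h)
  qed
qed

lemma one_form_smooth: "\<alpha> \<in> sym_tensors A 1 \<Longrightarrow> Y \<in> vector_fields A \<Longrightarrow> apply_tensor \<alpha> [Y] \<in> smooth_functions A"
  by (rule sym_tensor_smooth) simp_all

lemma one_form_linear_at: "\<alpha> \<in> sym_tensors A 1 \<Longrightarrow> p \<in> points A \<Longrightarrow> linear_at p (\<lambda>Y. apply_tensor \<alpha> [Y] p)"
  using apply_linear_at[OF sym_tensors_algebra, of \<alpha> 1 "[]" p] by simp

end

locale patterson_walker = cotangent_bundle A + torsion_free_manifold A nab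
  for A :: "('a, 'e::euclidean_space) atlas" and nab
begin

abbreviation "hl \<equiv> horizontal_lift A nab"
abbreviation "vl \<equiv> vertical_lift A"
abbreviation "cl \<equiv> complete_lift A"

lemma covector_nab_right:
  assumes z: "(p, \<zeta>) \<in> points TM" and X: "X \<in> vector_fields A" and h: "h \<in> smooth_functions A" and Y: "Y \<in> vector_fields A"
  shows "\<zeta> (nab X (vf_scale h Y) p) = X p h * \<zeta> (Y p) + h p * \<zeta> (nab X Y p)"
  using covector_vf_add[OF z vf_scale_mem[OF vector_fieldD(3)[OF X h] Y] vf_scale_mem[OF h nab_mem[OF X Y]]]
  by (simp add: nab_scale_right X h Y covector_vf_scale[OF z] nab_mem)

lemma horizontal_lift:
  assumes X: "X \<in> vector_fields A"
  shows "hl X \<in> vector_fields TM" "Y \<in> vector_fields A \<Longrightarrow> hl X z (vert Y) = vert (nab X Y) z"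
    "(p, \<zeta>) \<in> points TM \<Longrightarrow> base_vector (hl X (p, \<zeta>)) = X p"
proof -
  let ?T = "\<lambda>Y. vert (nab X Y)"
  have 1: "?T Y \<in> smooth_functions TM" if "Y \<in> vector_fields A" for Y
    by (rule vertical_smooth[OF nab_mem[OF X that]])
  have 2: "?T (vf_add Y Z) z = ?T Y z + ?T Z z" if "z \<in> points TM" "Y \<in> vector_fields A" "Z \<in> vector_fields A" for z Y Z
    by (simp add: nab_add_right X that vertical_add nab_mem)
  have 3: "?T (vf_scale h Y) (p, \<zeta>) = X p h * \<zeta> (Y p) + h p * ?T Y (p, \<zeta>)"
    if "(p, \<zeta>) \<in> points TM" "h \<in> smooth_functions A" "Y \<in> vector_fields A" for p \<zeta> h Y
    unfolding vertical_apply[OF that(1)] by (rule covector_nab_right[OF that(1) X that(2,3)])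
  note L = lift[of X ?T, OF X 1 2 3 horizontal_lift_def[of A nab X]]
  show "hl X \<in> vector_fields TM"
    by (rule L(1))
  show "Y \<in> vector_fields A \<Longrightarrow> hl X z (vert Y) = vert (nab X Y) z"
    by (rule L(2))
  show "(p, \<zeta>) \<in> points TM \<Longrightarrow> base_vector (hl X (p, \<zeta>)) = X p"
    by (rule L(3))
qed

lemma vertical_lift:
  assumes \<alpha>: "\<alpha> \<in> sym_tensors A 1"
  shows "vl \<alpha> \<in> vector_fields TM" "Y \<in> vector_fields A \<Longrightarrow> vl \<alpha> z (vert Y) = pb (apply_tensor \<alpha> [Y]) z"
    "(p, \<zeta>) \<in> points TM \<Longrightarrow> base_vector (vl \<alpha> (p, \<zeta>)) = (\<lambda>f. 0)"
proof -
  let ?T = "\<lambda>Y. pb (apply_tensor \<alpha> [Y])"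
  have 1: "?T Y \<in> smooth_functions TM" if "Y \<in> vector_fields A" for Y
    by (rule pullback_smooth[OF one_form_smooth[OF \<alpha> that]])
  have 2: "?T (vf_add Y Z) z = ?T Y z + ?T Z z" if "z \<in> points TM" "Y \<in> vector_fields A" "Z \<in> vector_fields A" for z Y Z
    using that linear_at_add[OF one_form_linear_at[OF \<alpha>, of "fst z"] that(2,3)] cotangent_pointsD(1)[of "fst z" "snd z"]
    by (cases z) (simp add: pullback_apply)
  have 3: "?T (vf_scale h Y) (p, \<zeta>) = (\<lambda>p f. 0) p h * \<zeta> (Y p) + h p * ?T Y (p, \<zeta>)"
    if "(p, \<zeta>) \<in> points TM" "h \<in> smooth_functions A" "Y \<in> vector_fields A" for p \<zeta> h Y
    using linear_at_scale[OF one_form_linear_at[OF \<alpha> cotangent_pointsD(1)[OF that(1)]] that(2,3)]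
    by (simp add: pullback_apply that)
  note L = lift[of "\<lambda>p f. 0" ?T, OF vf_zero_mem 1 2 3 vertical_lift_def[of A \<alpha>]]
  show "vl \<alpha> \<in> vector_fields TM"
    by (rule L(1))
  show "Y \<in> vector_fields A \<Longrightarrow> vl \<alpha> z (vert Y) = pb (apply_tensor \<alpha> [Y]) z"
    by (rule L(2))
  show "(p, \<zeta>) \<in> points TM \<Longrightarrow> base_vector (vl \<alpha> (p, \<zeta>)) = (\<lambda>f. 0)"
    by (rule L(3))
qed

lemma complete_lift:
  assumes X: "X \<in> vector_fields A"
  shows "cl X \<in> vector_fields TM" "Y \<in> vector_fields A \<Longrightarrow> cl X z (vert Y) = vert (lie_bracket X Y) z"
    "(p, \<zeta>) \<in> points TM \<Longrightarrow> base_vector (cl X (p, \<zeta>)) = X p"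
proof -
  let ?T = "\<lambda>Y. vert (lie_bracket X Y)"
  have 1: "?T Y \<in> smooth_functions TM" if "Y \<in> vector_fields A" for Y
    by (rule vertical_smooth[OF lie_bracket_mem[OF X that]])
  have 2: "?T (vf_add Y Z) z = ?T Y z + ?T Z z" if "z \<in> points TM" "Y \<in> vector_fields A" "Z \<in> vector_fields A" for z Y Z
    by (simp add: lie_bracket_add_right X that vertical_add lie_bracket_mem)
  have 3: "?T (vf_scale h Y) (p, \<zeta>) = X p h * \<zeta> (Y p) + h p * ?T Y (p, \<zeta>)"
    if "(p, \<zeta>) \<in> points TM" "h \<in> smooth_functions A" "Y \<in> vector_fields A" for p \<zeta> h Y
    using that by (simp add: lie_bracket_scale_right X vertical_add vertical_scale vf_scale_mem vector_fieldD(3)[OF X]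
        lie_bracket_mem vertical_apply pullback_apply)
  note L = lift[of X ?T, OF X 1 2 3 complete_lift_def[of A X]]
  show "cl X \<in> vector_fields TM"
    by (rule L(1))
  show "Y \<in> vector_fields A \<Longrightarrow> cl X z (vert Y) = vert (lie_bracket X Y) z"
    by (rule L(2))
  show "(p, \<zeta>) \<in> points TM \<Longrightarrow> base_vector (cl X (p, \<zeta>)) = X p"
    by (rule L(3))
qed

text \<open>
The vertical part of \<open>v\<close> is the covector that measures how far \<open>v\<close> is from being
horizontal; \<open>kappa z v w\<close> is its value on the projection of \<open>w\<close>. The Patterson-Walker metric is the
symmetrization of this pairing.
\<close>

definition kappa :: "'a \<times> 'a covector \<Rightarrow> ('a \<times> 'a covector) tangent \<Rightarrow> ('a \<times> 'a covector) tangent \<Rightarrow> real" where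
  "kappa z v w = v (vert (extension (fst z) (base_vector w))) -
     snd z (nab (extension (fst z) (base_vector v)) (extension (fst z) (base_vector w)) (fst z))"

lemma connector_linear_at:
  assumes z: "(p, \<zeta>) \<in> points TM" and v: "v \<in> tangent_space TM (p, \<zeta>)" and U: "U \<in> vector_fields A" "U p = base_vector v"
  shows "linear_at p (\<lambda>Y. v (vert Y) - \<zeta> (nab U Y p))"
proof (rule linear_atI)
  show "v (vert (vf_add Y Z)) - \<zeta> (nab U (vf_add Y Z) p) = v (vert Y) - \<zeta> (nab U Y p) + (v (vert Z) - \<zeta> (nab U Z p))"
    if "Y \<in> vector_fields A" "Z \<in> vector_fields A" for Y Z
    by (simp add: tangent_vertical_add[OF v that] nab_add_right U that covector_vf_add[OF z] nab_mem)
  show "v (vert (vf_scale h Y)) - \<zeta> (nab U (vf_scale h Y) p) = h p * (v (vert Y) - \<zeta> (nab U Y p))"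
    if "h \<in> smooth_functions A" "Y \<in> vector_fields A" for h Y
    by (simp add: tangent_vertical_scale[OF z v that] covector_nab_right[OF z U(1) that] U(2) algebra_simps)
qed

lemma covector_nab_linear_at:
  assumes z: "(p, \<zeta>) \<in> points TM" and Y: "Y \<in> vector_fields A"
  shows "linear_at p (\<lambda>U. \<zeta> (nab U Y p))"
  by (rule linear_atI)
    (simp_all add: nab_add_left nab_scale_left Y covector_vf_add[OF z] covector_vf_scale[OF z] nab_mem)

text \<open>
The extensions in the definition may be replaced by any other ones: the expression is linear over
functions in \<open>Y\<close>, where the two product rule terms cancel, and in \<open>U\<close>.
\<close>

lemma kappa_eq:
  assumes z: "(p, \<zeta>) \<in> points TM" and v: "v \<in> tangent_space TM (p, \<zeta>)" and w: "w \<in> tangent_space TM (p, \<zeta>)"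
    and U: "U \<in> vector_fields A" "U p = base_vector v" and Y: "Y \<in> vector_fields A" "Y p = base_vector w"
  shows "kappa (p, \<zeta>) v w = v (vert Y) - \<zeta> (nab U Y p)"
proof -
  note p = cotangent_pointsD(1)[OF z]
  note ev = extension[OF p base_vector_tangent[OF z v]] and ew = extension[OF p base_vector_tangent[OF z w]]
  have "kappa (p, \<zeta>) v w = v (vert Y) - \<zeta> (nab (extension p (base_vector v)) Y p)"
    unfolding kappa_def fst_conv snd_conv
    by (rule linear_at_cong[OF connector_linear_at[OF z v ev] p ew(1) Y(1)]) (simp add: ew Y)
  also have "\<zeta> (nab (extension p (base_vector v)) Y p) = \<zeta> (nab U Y p)"
    by (rule linear_at_cong[OF covector_nab_linear_at[OF z Y(1)] p ev(1) U(1)]) (simp add: ev U)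
  finally show ?thesis .
qed

lemma base_vector_combination:
  "base_vector (\<lambda>f. a * v f + b * w f) = (\<lambda>f. a * base_vector v f + b * base_vector w f)"
  by (auto simp: base_vector_def)

lemma field_combination:
  assumes X: "X \<in> vector_fields A" and Y: "Y \<in> vector_fields A" and p: "p \<in> points A"
  shows "\<exists>Z\<in>vector_fields A. Z p = (\<lambda>f. a * X p f + b * Y p f) \<and>
    (\<forall>F. linear_at p F \<longrightarrow> F Z = a * F X + b * F Y)"
proof (intro bexI conjI allI impI)
  let ?c = "\<lambda>k q. if q \<in> points A then k else (0 :: real)"
  let ?Z = "vf_add (vf_scale (?c a) X) (vf_scale (?c b) Y)"
  show "?Z \<in> vector_fields A"
    by (intro vf_add_mem vf_scale_mem smooth_const X Y)
  show "?Z p = (\<lambda>f. a * X p f + b * Y p f)"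
    using p by (simp add: vf_add_def vf_scale_def)
  show "F ?Z = a * F X + b * F Y" if F: "linear_at p F" for F
    using p by (simp add: linear_at_add[OF F] linear_at_scale[OF F] vf_scale_mem smooth_const X Y)
qed

lemma kappa_linear_left:
  assumes z: "(p, \<zeta>) \<in> points TM" and v: "v \<in> tangent_space TM (p, \<zeta>)" and v': "v' \<in> tangent_space TM (p, \<zeta>)"
    and w: "w \<in> tangent_space TM (p, \<zeta>)"
  shows "kappa (p, \<zeta>) (\<lambda>f. a * v f + b * v' f) w = a * kappa (p, \<zeta>) v w + b * kappa (p, \<zeta>) v' w"
proof -
  note p = cotangent_pointsD(1)[OF z]
  let ?U = "extension p (base_vector v)" and ?U' = "extension p (base_vector v')" and ?Y = "extension p (base_vector w)"
  note ev = extension[OF p base_vector_tangent[OF z v]] and ev' = extension[OF p base_vector_tangent[OF z v']]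
    and ew = extension[OF p base_vector_tangent[OF z w]]
  obtain W where W: "W \<in> vector_fields A" "W p = (\<lambda>f. a * ?U p f + b * ?U' p f)"
    "\<forall>F. linear_at p F \<longrightarrow> F W = a * F ?U + b * F ?U'"
    using field_combination[OF ev(1) ev'(1) p, of a b] by blast
  have "kappa (p, \<zeta>) (\<lambda>f. a * v f + b * v' f) w = (a * v (vert ?Y) + b * v' (vert ?Y)) - \<zeta> (nab W ?Y p)"
    by (rule kappa_eq[OF z cot.tangent_space_combination[OF v v'] w W(1) _ ew]) (simp add: W(2) ev ev' base_vector_combination)
  also have "\<zeta> (nab W ?Y p) = a * \<zeta> (nab ?U ?Y p) + b * \<zeta> (nab ?U' ?Y p)"
    by (rule W(3)[rule_format, OF covector_nab_linear_at[OF z ew(1)]])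
  finally show ?thesis
    unfolding kappa_eq[OF z v w ev ew] kappa_eq[OF z v' w ev' ew] by (simp add: algebra_simps)
qed

lemma kappa_linear_right:
  assumes z: "(p, \<zeta>) \<in> points TM" and v: "v \<in> tangent_space TM (p, \<zeta>)" and w: "w \<in> tangent_space TM (p, \<zeta>)"
    and w': "w' \<in> tangent_space TM (p, \<zeta>)"
  shows "kappa (p, \<zeta>) v (\<lambda>f. a * w f + b * w' f) = a * kappa (p, \<zeta>) v w + b * kappa (p, \<zeta>) v w'"
proof -
  note p = cotangent_pointsD(1)[OF z]
  let ?U = "extension p (base_vector v)" and ?Y = "extension p (base_vector w)" and ?Y' = "extension p (base_vector w')"
  note ev = extension[OF p base_vector_tangent[OF z v]] and ew' = extension[OF p base_vector_tangent[OF z w']]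
    and ew = extension[OF p base_vector_tangent[OF z w]]
  obtain W where W: "W \<in> vector_fields A" "W p = (\<lambda>f. a * ?Y p f + b * ?Y' p f)"
    "\<forall>F. linear_at p F \<longrightarrow> F W = a * F ?Y + b * F ?Y'"
    using field_combination[OF ew(1) ew'(1) p, of a b] by blast
  have "kappa (p, \<zeta>) v (\<lambda>f. a * w f + b * w' f) = v (vert W) - \<zeta> (nab ?U W p)"
    by (rule kappa_eq[OF z v cot.tangent_space_combination[OF w w'] ev W(1)]) (simp add: W(2) ew ew' base_vector_combination)
  also have "\<dots> = a * (v (vert ?Y) - \<zeta> (nab ?U ?Y p)) + b * (v (vert ?Y') - \<zeta> (nab ?U ?Y' p))"
    by (rule W(3)[rule_format, OF connector_linear_at[OF z v ev]])
  finally show ?thesis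
    unfolding kappa_eq[OF z v w ev ew] kappa_eq[OF z v w' ev ew'] .
qed

lemma kappa_horizontal_left:
  assumes z: "(p, \<zeta>) \<in> points TM" and w: "w \<in> tangent_space TM (p, \<zeta>)" and Y: "Y \<in> vector_fields A"
  shows "kappa (p, \<zeta>) (hl Y (p, \<zeta>)) w = 0"
proof -
  note ew = extension[OF cotangent_pointsD(1)[OF z] base_vector_tangent[OF z w]]
  note h = horizontal_lift[OF Y]
  show ?thesis
    using kappa_eq[OF z cot.vector_fieldD(1)[OF h(1) z] w Y h(3)[OF z, symmetric] ew] h(2)[OF ew(1)] z
    by (simp add: vertical_apply)
qed

lemma kappa_horizontal_right:
  assumes z: "(p, \<zeta>) \<in> points TM" and v: "v \<in> tangent_space TM (p, \<zeta>)" and Y: "Y \<in> vector_fields A"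
    and U: "U \<in> vector_fields A" "U p = base_vector v"
  shows "kappa (p, \<zeta>) v (hl Y (p, \<zeta>)) = v (vert Y) - \<zeta> (nab U Y p)"
  using kappa_eq[OF z v cot.vector_fieldD(1)[OF horizontal_lift(1)[OF Y] z] U Y horizontal_lift(3)[OF Y z, symmetric]] .

lemma kappa_vertical_right:
  assumes z: "(p, \<zeta>) \<in> points TM" and v: "v \<in> tangent_space TM (p, \<zeta>)" and w: "w \<in> tangent_space TM (p, \<zeta>)"
    and "base_vector w = (\<lambda>f. 0)"
  shows "kappa (p, \<zeta>) v w = 0"
proof -
  note p = cotangent_pointsD(1)[OF z]
  note ev = extension[OF p base_vector_tangent[OF z v]]
  have "kappa (p, \<zeta>) v w = v (vert (\<lambda>p f. 0)) - \<zeta> (nab (extension p (base_vector v)) (\<lambda>p f. 0) p)"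
    by (rule kappa_eq[OF z v w ev vf_zero_mem]) (simp add: assms(4))
  also have "\<dots> = 0"
    by (rule linear_at_vanish[OF connector_linear_at[OF z v ev] p vf_zero_mem refl])
  finally show ?thesis .
qed

lemma kappa_vertical_left:
  assumes z: "(p, \<zeta>) \<in> points TM" and v: "v \<in> tangent_space TM (p, \<zeta>)" and w: "w \<in> tangent_space TM (p, \<zeta>)"
    and v0: "base_vector v = (\<lambda>f. 0)" and Y: "Y \<in> vector_fields A" "Y p = base_vector w"
  shows "kappa (p, \<zeta>) v w = v (vert Y)"
proof -
  have "\<zeta> (nab (\<lambda>p f. 0) Y p) = 0"
    by (rule linear_at_vanish[OF covector_nab_linear_at[OF z Y(1)] cotangent_pointsD(1)[OF z] vf_zero_mem refl])
  then show ?thesis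
    using kappa_eq[OF z v w vf_zero_mem _ Y] v0 by simp
qed

text \<open>
Expanding both projections in a frame on the base needs one factor \<open>\<eta>\<close> for each of them; the
expansion has smooth coefficients.
\<close>

lemma kappa_smooth:
  assumes P: "P \<in> vector_fields TM" and R: "R \<in> vector_fields TM"
  shows "(\<lambda>z. if z \<in> points TM then kappa z (P z) (R z) else 0) \<in> smooth_functions TM" (is "?K \<in> _")
proof (rule cot.smooth_local)
  fix z assume "z \<in> points TM"
  moreover obtain p \<zeta> where z: "z = (p, \<zeta>)" by (cases z)
  ultimately have zp: "(p, \<zeta>) \<in> points TM" by simp
  obtain \<eta> x E where fr: "frame_at p \<eta> x E"
    using frame_exists[OF cotangent_pointsD(1)[OF zp]] .
  note D = frame_atD[OF fr]
  let ?r = "\<lambda>w. \<Sum>b\<in>Basis. R w (pb (x b)) * (pb \<eta> w * P w (vert (E b)) -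
      (\<Sum>a\<in>Basis. P w (pb (x a)) * vert (nab (E a) (E b)) w))"
  have "(\<lambda>w. (pb \<eta> w * pb \<eta> w) * ?K w) = ?r"
  proof
    fix w :: "'a \<times> 'a covector"
    obtain q \<xi> where w: "w = (q, \<xi>)" by (cases w)
    show "(pb \<eta> w * pb \<eta> w) * ?K w = ?r w"
    proof (cases "w \<in> points TM")
      case True
      note wq = True[unfolded w]
      note q = cotangent_pointsD(1)[OF wq]
      note Pw = cot.vector_fieldD(1)[OF P wq] and Rw = cot.vector_fieldD(1)[OF R wq]
      define U where "U = extension q (base_vector (P w))"
      define Y where "Y = extension q (base_vector (R w))"
      have U: "U \<in> vector_fields A" "U q = base_vector (P (q, \<xi>))"
        unfolding U_def w by (rule extension[OF q base_vector_tangent[OF wq Pw]])+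
      have Y: "Y \<in> vector_fields A" "Y q = base_vector (R (q, \<xi>))"
        unfolding Y_def w by (rule extension[OF q base_vector_tangent[OF wq Rw]])+
      have Ux: "U q (x a) = P w (pb (x a))" and Yx: "Y q (x a) = R w (pb (x a))" for a
        using D(3)[of a] by (simp_all add: U Y w base_vector_def)
      have "\<eta> q * ?K w = \<eta> q * (P w (vert Y) - \<xi> (nab U Y q))"
        using kappa_eq[OF wq Pw Rw U Y] True by (simp add: w)
      also have "\<dots> = (\<Sum>b\<in>Basis. Y q (x b) * (P w (vert (E b)) - \<xi> (nab U (E b) q)))"
        unfolding w
        by (rule linear_at_frame[OF connector_linear_at[OF wq Pw U] Y(1) fr])
      finally have 1: "\<eta> q * ?K w = (\<Sum>b\<in>Basis. Y q (x b) * (P w (vert (E b)) - \<xi> (nab U (E b) q)))" .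
      have 2: "\<eta> q * \<xi> (nab U (E b) q) = (\<Sum>a\<in>Basis. U q (x a) * \<xi> (nab (E a) (E b) q))" for b
        by (rule linear_at_frame[OF covector_nab_linear_at[OF wq D(4)] U(1) fr])
      have "(pb \<eta> w * pb \<eta> w) * ?K w = \<eta> q * (\<eta> q * ?K w)"
        using True by (simp add: w pullback_apply)
      also have "\<dots> = (\<Sum>b\<in>Basis. Y q (x b) * (\<eta> q * P w (vert (E b)) - \<eta> q * \<xi> (nab U (E b) q)))"
        unfolding 1 by (simp add: sum_distrib_left algebra_simps)
      also have "\<dots> = ?r w"
        unfolding 2 Ux Yx using True by (simp add: w pullback_apply vertical_apply)
      finally show ?thesis .
    next
      case False
      then show ?thesis
        using cot.vector_fieldD(2)[OF R False] by simp
    qed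
  qed
  moreover have "?r \<in> smooth_functions TM"
    by (intro cot.smooth_sum cot.smooth_mult cot.smooth_diff cot.vector_fieldD(3)[OF P] cot.vector_fieldD(3)[OF R]
        pullback_smooth D(1,3) vertical_smooth nab_mem D(4))
  ultimately show "\<exists>\<eta>\<in>smooth_functions TM. \<eta> z \<noteq> 0 \<and> (\<lambda>q. \<eta> q * ?K q) \<in> smooth_functions TM"
    using cot.smooth_mult[OF pullback_smooth[OF D(1)] pullback_smooth[OF D(1)]] D(2) zp
    by (intro bexI[of _ "\<lambda>w. pb \<eta> w * pb \<eta> w"]) (simp_all add: z pullback_apply)
qed simp

definition pw :: "('a \<times> 'a covector) tensor" where
  "pw z vs = (if z \<in> points TM \<and> length vs = 2 \<and> set vs \<subseteq> tangent_space TM z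
     then kappa z (vs ! 0) (vs ! 1) + kappa z (vs ! 1) (vs ! 0) else 0)"

lemma pw_apply:
  assumes "z \<in> points TM" "v \<in> tangent_space TM z" "w \<in> tangent_space TM z"
  shows "pw z [v, w] = kappa z v w + kappa z w v"
  using assms by (simp add: pw_def)

lemma pw_mem: "pw \<in> sym_tensors TM 2"
  unfolding sym_tensors_def mem_Collect_eq
proof (intro conjI allI ballI impI)
  show "pw z vs = 0" if "\<not> (z \<in> points TM \<and> length vs = 2 \<and> set vs \<subseteq> tangent_space TM z)" for z vs
    using that by (simp only: pw_def if_False)
  show "apply_tensor pw Ps \<in> smooth_functions TM" if Ps: "Ps \<in> lists (vector_fields TM)" for Ps
  proof (cases "length Ps = 2")
    case True
    then obtain P R where PR: "Ps = [P, R]"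
      by (auto simp: length_Suc_conv numeral_2_eq_2)
    have P: "P \<in> vector_fields TM" and R: "R \<in> vector_fields TM"
      using Ps PR by auto
    have "apply_tensor pw Ps = (\<lambda>z. (if z \<in> points TM then kappa z (P z) (R z) else 0) +
        (if z \<in> points TM then kappa z (R z) (P z) else 0))"
    proof
      show "apply_tensor pw Ps z = (if z \<in> points TM then kappa z (P z) (R z) else 0) +
          (if z \<in> points TM then kappa z (R z) (P z) else 0)" for z
        using cot.vector_fieldD(1)[OF P] cot.vector_fieldD(1)[OF R] by (simp add: apply_tensor_def PR pw_def)
    qed
    then show ?thesis
      using cot.smooth_add[OF kappa_smooth[OF P R] kappa_smooth[OF R P]] by simp
  next
    case False
    then show ?thesis
      using cot.smooth_zero by (simp add: apply_tensor_def pw_def)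
  qed
  fix z vs assume z: "z \<in> points TM" and vs: "vs \<in> lists (tangent_space TM z)"
  obtain p \<zeta> where zp: "z = (p, \<zeta>)" by (cases z)
  show "pw z ws = pw z vs" if ws: "mset ws = mset vs" for ws
  proof (cases "length vs = 2")
    case True
    then obtain v w where vw: "vs = [v, w]"
      by (auto simp: length_Suc_conv numeral_2_eq_2)
    have "length ws = 2"
      using mset_eq_length[OF ws] True by simp
    then obtain v' w' where vw': "ws = [v', w']"
      by (auto simp: length_Suc_conv numeral_2_eq_2)
    have "(v' = v \<and> w' = w) \<or> (v' = w \<and> w' = v)"
      using ws unfolding vw vw' by (auto simp: add_eq_conv_diff)
    then show ?thesis
      using vw vw' by (auto simp: pw_def)
  next
    case False
    then show ?thesis
      using mset_eq_length[OF ws] by (simp add: pw_def)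
  qed
  show "pw z (vs[i := (\<lambda>f. a * v f + b * w f)]) = a * pw z (vs[i := v]) + b * pw z (vs[i := w])"
    if i: "i < length vs" and v: "v \<in> tangent_space TM z" and w: "w \<in> tangent_space TM z" for i v w a b
  proof (cases "length vs = 2")
    case True
    then obtain s t where st: "vs = [s, t]"
      by (auto simp: length_Suc_conv numeral_2_eq_2)
    then have s: "s \<in> tangent_space TM z" and t: "t \<in> tangent_space TM z"
      using vs by auto
    note lin = kappa_linear_left[OF z[unfolded zp] v[unfolded zp] w[unfolded zp]]
      kappa_linear_right[OF z[unfolded zp] _ v[unfolded zp] w[unfolded zp]]
    consider "i = 0" | "i = 1"
      using i True by linarith
    then show ?thesis
    proof cases
      case 1
      then show ?thesis
        using lin[of t a b] z v w s t cot.tangent_space_combination[OF v w]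
        by (simp add: st pw_apply zp algebra_simps)
    next
      case 2
      then show ?thesis
        using lin[of s a b] z v w s t cot.tangent_space_combination[OF v w]
        by (simp add: st pw_apply zp algebra_simps)
    qed
  next
    case False
    then show ?thesis by (simp add: pw_def)
  qed
qed

lemma lifts_tangent:
  assumes "(p, \<zeta>) \<in> points TM"
  shows "X \<in> vector_fields A \<Longrightarrow> hl X (p, \<zeta>) \<in> tangent_space TM (p, \<zeta>)"
    and "\<alpha> \<in> sym_tensors A 1 \<Longrightarrow> vl \<alpha> (p, \<zeta>) \<in> tangent_space TM (p, \<zeta>)"
  using cot.vector_fieldD(1)[OF _ assms] horizontal_lift(1) vertical_lift(1) by blast+

lemma vf_add_lifts_tangent:
  assumes "(p, \<zeta>) \<in> points TM" "X \<in> vector_fields A" "\<alpha> \<in> sym_tensors A 1"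
  shows "vf_add (hl X) (vl \<alpha>) (p, \<zeta>) \<in> tangent_space TM (p, \<zeta>)"
  by (rule cot.vector_fieldD(1)[OF cot.vf_add_mem[OF horizontal_lift(1)[OF assms(2)] vertical_lift(1)[OF assms(3)]] assms(1)])

lemma kappa_vl_left:
  assumes z: "(p, \<zeta>) \<in> points TM" and w: "w \<in> tangent_space TM (p, \<zeta>)" and \<alpha>: "\<alpha> \<in> sym_tensors A 1"
    and Y: "Y \<in> vector_fields A" "Y p = base_vector w"
  shows "kappa (p, \<zeta>) (vl \<alpha> (p, \<zeta>)) w = apply_tensor \<alpha> [Y] p"
  using kappa_vertical_left[OF z lifts_tangent(2)[OF z \<alpha>] w vertical_lift(3)[OF \<alpha> z] Y] z
  by (simp add: vertical_lift(2)[OF \<alpha> Y(1)] pullback_apply)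

lemma kappa_vl_right:
  assumes z: "(p, \<zeta>) \<in> points TM" and v: "v \<in> tangent_space TM (p, \<zeta>)" and \<alpha>: "\<alpha> \<in> sym_tensors A 1"
  shows "kappa (p, \<zeta>) v (vl \<alpha> (p, \<zeta>)) = 0"
  by (rule kappa_vertical_right[OF z v lifts_tangent(2)[OF z \<alpha>] vertical_lift(3)[OF \<alpha> z]])

lemma vf_add_combination: "vf_add P R z = (\<lambda>f. 1 * P z f + 1 * R z f)"
  by (simp add: vf_add_def)

lemma kappa_lifts:
  assumes z: "(p, \<zeta>) \<in> points TM" and X: "X \<in> vector_fields A" and Y: "Y \<in> vector_fields A"
    and \<alpha>: "\<alpha> \<in> sym_tensors A 1" and \<beta>: "\<beta> \<in> sym_tensors A 1"
  shows "kappa (p, \<zeta>) (vf_add (hl X) (vl \<alpha>) (p, \<zeta>)) (vf_add (hl Y) (vl \<beta>) (p, \<zeta>)) = apply_tensor \<alpha> [Y] p"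
proof -
  note t = lifts_tangent(1)[OF z X] lifts_tangent(2)[OF z \<alpha>] lifts_tangent(1)[OF z Y] lifts_tangent(2)[OF z \<beta>]
  have w: "vf_add (hl Y) (vl \<beta>) (p, \<zeta>) \<in> tangent_space TM (p, \<zeta>)"
    by (rule vf_add_lifts_tangent[OF z Y \<beta>])
  have base: "Y p = base_vector (vf_add (hl Y) (vl \<beta>) (p, \<zeta>))"
    unfolding vf_add_combination base_vector_combination by (simp add: horizontal_lift(3)[OF Y z] vertical_lift(3)[OF \<beta> z])
  have "kappa (p, \<zeta>) (vf_add (hl X) (vl \<alpha>) (p, \<zeta>)) (vf_add (hl Y) (vl \<beta>) (p, \<zeta>)) =
      1 * kappa (p, \<zeta>) (hl X (p, \<zeta>)) (vf_add (hl Y) (vl \<beta>) (p, \<zeta>)) + 1 * kappa (p, \<zeta>) (vl \<alpha> (p, \<zeta>)) (vf_add (hl Y) (vl \<beta>) (p, \<zeta>))"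
    unfolding vf_add_combination[of "hl X"] by (rule kappa_linear_left[OF z t(1,2) w])
  then show ?thesis
    by (simp add: kappa_horizontal_left[OF z w X] kappa_vl_left[OF z w \<alpha> Y base])
qed

lemma pw_lifts:
  assumes X: "X \<in> vector_fields A" and Y: "Y \<in> vector_fields A" and \<alpha>: "\<alpha> \<in> sym_tensors A 1" and \<beta>: "\<beta> \<in> sym_tensors A 1"
  shows "apply_tensor pw [vf_add (hl X) (vl \<alpha>), vf_add (hl Y) (vl \<beta>)] =
    pb (\<lambda>p. apply_tensor \<alpha> [Y] p + apply_tensor \<beta> [X] p)"
proof
  fix z :: "'a \<times> 'a covector"
  obtain p \<zeta> where z: "z = (p, \<zeta>)" by (cases z)
  show "apply_tensor pw [vf_add (hl X) (vl \<alpha>), vf_add (hl Y) (vl \<beta>)] z =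
    pb (\<lambda>p. apply_tensor \<alpha> [Y] p + apply_tensor \<beta> [X] p) z"
  proof (cases "z \<in> points TM")
    case True
    note zp = True[unfolded z]
    show ?thesis
      using pw_apply[OF zp vf_add_lifts_tangent[OF zp X \<alpha>] vf_add_lifts_tangent[OF zp Y \<beta>]]
      by (simp add: apply_tensor_def[of pw] z kappa_lifts[OF zp X Y \<alpha> \<beta>] kappa_lifts[OF zp Y X \<beta> \<alpha>] pullback_apply zp)
  next
    case False
    then show ?thesis
      by (simp add: apply_tensor_def[of pw] pw_def pullback_outside)
  qed
qed

text \<open>
The vertical part of \<open>v\<close> is a covector at \<open>p\<close>; it is the differential of a linear combination of the
coordinate functions of a frame.
\<close>

lemma tangent_decomposition:
  assumes z: "(p, \<zeta>) \<in> points TM" and v: "v \<in> tangent_space TM (p, \<zeta>)"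
  shows "\<exists>X\<in>vector_fields A. \<exists>\<alpha>\<in>sym_tensors A 1. v = vf_add (hl X) (vl \<alpha>) (p, \<zeta>)"
proof -
  note p = cotangent_pointsD(1)[OF z]
  define X where "X = extension p (base_vector v)"
  have X: "X \<in> vector_fields A" "X p = base_vector v"
    unfolding X_def by (rule extension[OF p base_vector_tangent[OF z v]])+
  obtain \<eta> x E where fr: "frame_at p \<eta> x E"
    using frame_exists[OF p] .
  note D = frame_atD[OF fr]
  let ?F = "\<lambda>Y. v (vert Y) - \<zeta> (nab X Y p)"
  define h where "h q = (\<Sum>b\<in>Basis. ?F (E b) * x b q)" for q
  have h: "h \<in> smooth_functions A"
    unfolding h_def by (intro smooth_sum smooth_scale D(3))
  have \<alpha>: "differential A h \<in> sym_tensors A 1"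
    by (rule differential_mem[OF h])
  have F: "Y p h = ?F Y" if Y: "Y \<in> vector_fields A" for Y
  proof -
    note t = vector_fieldD(1)[OF Y p]
    have "Y p h = (\<Sum>b\<in>Basis. Y p (\<lambda>q. ?F (E b) * x b q))"
      unfolding h_def by (rule tangent_sum[OF t]) (rule smooth_scale[OF D(3)])
    also have "\<dots> = (\<Sum>b\<in>Basis. Y p (x b) * ?F (E b))"
      unfolding tangent_scale[OF t D(3)] by (simp add: mult.commute)
    also have "\<dots> = ?F Y"
      by (rule linear_at_expansion[OF connector_linear_at[OF z v X] Y fr, symmetric])
    finally show ?thesis .
  qed
  have "v = vf_add (hl X) (vl (differential A h)) (p, \<zeta>)"
  proof (rule cotangent_tangent_eqI[OF z v vf_add_lifts_tangent[OF z X(1) \<alpha>]])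
    show "base_vector v = base_vector (vf_add (hl X) (vl (differential A h)) (p, \<zeta>))"
      unfolding vf_add_combination base_vector_combination
      by (simp add: horizontal_lift(3)[OF X(1) z] vertical_lift(3)[OF \<alpha> z] X(2))
    fix Y assume Y: "Y \<in> vector_fields A"
    show "v (vert Y) = vf_add (hl X) (vl (differential A h)) (p, \<zeta>) (vert Y)"
      using F[OF Y] z
      by (simp add: vf_add_def horizontal_lift(2)[OF X(1) Y] vertical_lift(2)[OF \<alpha> Y] vertical_apply pullback_apply
          differential_apply[OF p Y])
  qed
  then show ?thesis
    using X(1) \<alpha> by blast
qed

lemma pw_nondegenerate:
  assumes z: "(p, \<zeta>) \<in> points TM" and v: "v \<in> tangent_space TM (p, \<zeta>)"
    and null: "\<And>w. w \<in> tangent_space TM (p, \<zeta>) \<Longrightarrow> pw (p, \<zeta>) [v, w] = 0"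
  shows "v = (\<lambda>f. 0)"
proof -
  note p = cotangent_pointsD(1)[OF z]
  define U where "U = extension p (base_vector v)"
  have U: "U \<in> vector_fields A" "U p = base_vector v"
    unfolding U_def by (rule extension[OF p base_vector_tangent[OF z v]])+
  have "base_vector v f = 0" for f
  proof (cases "f \<in> smooth_functions A")
    case True
    note \<alpha> = differential_mem[OF True]
    have "apply_tensor (differential A f) [U] p = 0"
      using null[OF lifts_tangent(2)[OF z \<alpha>]] pw_apply[OF z v lifts_tangent(2)[OF z \<alpha>]]
      by (simp add: kappa_vl_left[OF z v \<alpha> U] kappa_vl_right[OF z v \<alpha>])
    then show ?thesis
      using differential_apply[OF p U(1), of f] U(2) by simp
  next
    case False
    then show ?thesis by (simp add: base_vector_def)
  qed
  then have base: "base_vector v = (\<lambda>f. 0)" by (rule ext)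
  show ?thesis
  proof (rule cotangent_tangent_eqI[OF z v cot.tangent_space_zero])
    show "base_vector v = base_vector (\<lambda>f. 0)"
      unfolding base by (simp add: base_vector_def fun_eq_iff)
    fix Y assume Y: "Y \<in> vector_fields A"
    note h = lifts_tangent(1)[OF z Y]
    have "kappa (p, \<zeta>) v (hl Y (p, \<zeta>)) = v (vert Y)"
      by (rule kappa_vertical_left[OF z v h base Y horizontal_lift(3)[OF Y z, symmetric]])
    then show "v (vert Y) = 0"
      using null[OF h] pw_apply[OF z v h] by (simp add: kappa_horizontal_left[OF z v Y])
  qed
qed

lemma pw_pseudo_riemannian: "pseudo_riemannian_metric TM pw"
  unfolding pseudo_riemannian_metric_def
proof (intro conjI ballI impI)
  fix z v assume "z \<in> points TM" "v \<in> tangent_space TM z" "\<forall>w\<in>tangent_space TM z. pw z [v, w] = 0"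
  then show "v = (\<lambda>_. 0)"
    using pw_nondegenerate[of "fst z" "snd z" v] by simp
qed (rule pw_mem)

text \<open>
The horizontal lift of \<open>E\<^sub>b\<close> and the vertical lift of \<open>dx\<^sub>b\<close> span hyperbolic planes; adding and subtracting
half of the second vector diagonalizes them.
\<close>

lemma pw_split: "split_signature TM pw"
  unfolding split_signature_def
proof
  fix z assume zTM: "z \<in> points TM"
  obtain p \<zeta> where zp: "z = (p, \<zeta>)" by (cases z)
  note z = zTM[unfolded zp]
  note p = cotangent_pointsD(1)[OF z]
  obtain \<eta> x E where fr: "frame_at p \<eta> x E"
    using frame_exists[OF p] .
  note D = frame_atD[OF fr]
  obtain \<beta> where \<beta>: "bij_betw \<beta> {0..<DIM('e)} (Basis :: 'e set)"
    using ex_bij_betw_nat_finite[OF finite_Basis] by blast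
  have \<beta>B: "\<beta> i \<in> Basis" if "i < DIM('e)" for i
    using bij_betwE[OF \<beta>] that by auto
  have \<beta>inj: "\<beta> i = \<beta> j \<longleftrightarrow> i = j" if "i < DIM('e)" "j < DIM('e)" for i j
    using inj_on_eq_iff[OF bij_betw_imp_inj_on[OF \<beta>]] that by simp
  define l where "l k i = vf_add (hl (E (\<beta> i))) (vl (differential A (\<lambda>q. k * x (\<beta> i) q))) (p, \<zeta>)" for k i
  have form: "differential A (\<lambda>q. k * x b q) \<in> sym_tensors A 1" for k b
    by (intro differential_mem smooth_scale D(3))
  have pwl: "pw z [l k i, l m j] = (if i = j then k + m else 0)" if i: "i < DIM('e)" and j: "j < DIM('e)" for k m i j
  proof -
    have app: "apply_tensor (differential A (\<lambda>q. k * x (\<beta> i) q)) [E (\<beta> j)] p = (if j = i then k else 0)"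
      if "i < DIM('e)" "j < DIM('e)" for k i j
      using tangent_scale[OF vector_fieldD(1)[OF D(4) p] D(3), of "\<beta> j" k "\<beta> i"] D(6)[OF p \<beta>B[OF that(2)] \<beta>B[OF that(1)]]
        \<beta>inj[OF that(2,1)] D(2)
      by (simp add: differential_apply[OF p D(4)])
    have "pw z [l k i, l m j] = apply_tensor (differential A (\<lambda>q. k * x (\<beta> i) q)) [E (\<beta> j)] p +
        apply_tensor (differential A (\<lambda>q. m * x (\<beta> j) q)) [E (\<beta> i)] p"
      using fun_cong[OF pw_lifts[OF D(4)[of "\<beta> i"] D(4)[of "\<beta> j"] form[of k "\<beta> i"] form[of m "\<beta> j"]], of z] z
      by (simp add: apply_tensor_def[of pw] l_def zp pullback_apply)
    then show ?thesis
      using app[OF i j, of k] app[OF j i, of m] by simp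
  qed
  have lt: "l k i \<in> tangent_space TM z" for k i
    unfolding l_def zp by (rule vf_add_lifts_tangent[OF z D(4) form])
  show "\<exists>m e f. 2 * m = DIM('e \<times> 'e) \<and> (\<forall>i<m. e i \<in> tangent_space TM z \<and> f i \<in> tangent_space TM z) \<and>
      (\<forall>i<m. \<forall>j<m. pw z [e i, e j] = (if i = j then 1 else 0) \<and>
        pw z [f i, f j] = (if i = j then - 1 else 0) \<and> pw z [e i, f j] = 0)"
    by (intro exI[of _ "DIM('e)"] exI[of _ "l (1 / 2)"] exI[of _ "l (- (1 / 2))"]) (simp add: pwl lt)
qed

text \<open>
Uniqueness holds because every tangent vector of the cotangent bundle is the value of a sum of a
horizontal and a vertical lift.
\<close>

lemma patterson_walker_metric_eq: "patterson_walker_metric A nab = pw"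
  unfolding patterson_walker_metric_def
proof (rule the_equality)
  show "pseudo_riemannian_metric TM pw \<and> split_signature TM pw \<and>
     (\<forall>X\<in>vector_fields A. \<forall>Y\<in>vector_fields A. \<forall>\<alpha>\<in>sym_tensors A 1. \<forall>\<beta>\<in>sym_tensors A 1.
        apply_tensor pw [vf_add (hl X) (vl \<alpha>), vf_add (hl Y) (vl \<beta>)] =
        pb (\<lambda>p. apply_tensor \<alpha> [Y] p + apply_tensor \<beta> [X] p))"
    using pw_pseudo_riemannian pw_split pw_lifts by simp
  fix g assume "pseudo_riemannian_metric TM g \<and> split_signature TM g \<and>
     (\<forall>X\<in>vector_fields A. \<forall>Y\<in>vector_fields A. \<forall>\<alpha>\<in>sym_tensors A 1. \<forall>\<beta>\<in>sym_tensors A 1.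
        apply_tensor g [vf_add (hl X) (vl \<alpha>), vf_add (hl Y) (vl \<beta>)] =
        pb (\<lambda>p. apply_tensor \<alpha> [Y] p + apply_tensor \<beta> [X] p))"
  then have g: "g \<in> sym_tensors TM 2" and gl: "\<And>X Y \<alpha> \<beta>. X \<in> vector_fields A \<Longrightarrow> Y \<in> vector_fields A \<Longrightarrow>
      \<alpha> \<in> sym_tensors A 1 \<Longrightarrow> \<beta> \<in> sym_tensors A 1 \<Longrightarrow> apply_tensor g [vf_add (hl X) (vl \<alpha>), vf_add (hl Y) (vl \<beta>)] =
        pb (\<lambda>p. apply_tensor \<alpha> [Y] p + apply_tensor \<beta> [X] p)"
    by (simp_all add: pseudo_riemannian_metric_def)
  show "g = pw"
  proof (intro ext)
    fix z vs
    show "g z vs = pw z vs"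
    proof (cases "z \<in> points TM \<and> length vs = 2 \<and> set vs \<subseteq> tangent_space TM z")
      case True
      then obtain v w where vw: "vs = [v, w]"
        by (auto simp: length_Suc_conv numeral_2_eq_2)
      obtain p \<zeta> where zp: "z = (p, \<zeta>)" by (cases z)
      have z: "(p, \<zeta>) \<in> points TM" and v: "v \<in> tangent_space TM (p, \<zeta>)" and w: "w \<in> tangent_space TM (p, \<zeta>)"
        using True by (simp_all add: vw zp)
      obtain X \<alpha> where X: "X \<in> vector_fields A" "\<alpha> \<in> sym_tensors A 1" "v = vf_add (hl X) (vl \<alpha>) (p, \<zeta>)"
        using tangent_decomposition[OF z v] by blast
      obtain Y \<beta> where Y: "Y \<in> vector_fields A" "\<beta> \<in> sym_tensors A 1" "w = vf_add (hl Y) (vl \<beta>) (p, \<zeta>)"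
        using tangent_decomposition[OF z w] by blast
      have "apply_tensor g [vf_add (hl X) (vl \<alpha>), vf_add (hl Y) (vl \<beta>)] z =
          apply_tensor pw [vf_add (hl X) (vl \<alpha>), vf_add (hl Y) (vl \<beta>)] z"
        by (simp only: gl[OF X(1) Y(1) X(2) Y(2)] pw_lifts[OF X(1) Y(1) X(2) Y(2)])
      then show ?thesis
        by (simp add: apply_tensor_def vw X(3) Y(3) zp)
    next
      case False
      then show ?thesis
        using cot.sym_tensor_outside[OF g] cot.sym_tensor_outside[OF pw_mem] by metis
    qed
  qed
qed

end


section \<open>Gradient Killing complete lifts\<close>

context patterson_walker begin

lemma pw_field_form: "cot.field_form (apply_tensor pw)"
  by (rule cot.apply_tensor_field_form[OF cot.sym_tensors_algebra[OF pw_mem]])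

lemma pw_fields:
  assumes "P \<in> vector_fields TM" "R \<in> vector_fields TM" "z \<in> points TM"
  shows "apply_tensor pw [P, R] z = kappa z (P z) (R z) + kappa z (R z) (P z)"
  using pw_apply[OF assms(3) cot.vector_fieldD(1)[OF assms(1,3)] cot.vector_fieldD(1)[OF assms(2,3)]]
  by (simp add: apply_tensor_def)

lemma pw_outside: "z \<notin> points TM \<Longrightarrow> apply_tensor pw Ps z = 0"
  by (simp add: apply_tensor_def pw_def)

lemma pw_commute: "P \<in> vector_fields TM \<Longrightarrow> R \<in> vector_fields TM \<Longrightarrow> apply_tensor pw [P, R] = apply_tensor pw [R, P]"
  by (rule cot.field_formD(3)[OF pw_field_form]) simp_all

text \<open>
The Lie derivative of the metric along \<open>Q\<close>.
\<close>

definition lie_pw :: "('a \<times> 'a covector) vfield \<Rightarrow> ('a \<times> 'a covector) vfield \<Rightarrow> ('a \<times> 'a covector) vfield \<Rightarrow>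
    'a \<times> 'a covector \<Rightarrow> real" where
  "lie_pw Q P R z = Q z (apply_tensor pw [P, R]) - apply_tensor pw [lie_bracket Q P, R] z - apply_tensor pw [P, lie_bracket Q R] z"

lemma killing_iff: "killing TM pw Q \<longleftrightarrow> Q \<in> vector_fields TM \<and>
    (\<forall>P\<in>vector_fields TM. \<forall>R\<in>vector_fields TM. \<forall>z. lie_pw Q P R z = 0)"
  unfolding killing_def lie_pw_def deriv_along_def ..

lemma lie_pw_commute:
  assumes "Q \<in> vector_fields TM" "P \<in> vector_fields TM" "R \<in> vector_fields TM"
  shows "lie_pw Q P R z = lie_pw Q R P z"
  unfolding lie_pw_def
  by (simp add: pw_commute[OF assms(2,3)] pw_commute[OF cot.lie_bracket_mem[OF assms(1,2)] assms(3)]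
      pw_commute[OF assms(2) cot.lie_bracket_mem[OF assms(1,3)]])

lemma lie_pw_linear_at:
  assumes Q: "Q \<in> vector_fields TM" and R: "R \<in> vector_fields TM" and z: "z \<in> points TM"
  shows "cot.linear_at z (\<lambda>P. lie_pw Q P R z)"
proof (rule cot.linear_atI)
  note ff = pw_field_form
  have R1: "[R] \<in> lists (vector_fields TM)" and QR1: "[lie_bracket Q R] \<in> lists (vector_fields TM)"
    using R cot.lie_bracket_mem[OF Q R] by simp_all
  have sm: "apply_tensor pw [P, R] \<in> smooth_functions TM" if "P \<in> vector_fields TM" for P
    by (rule cot.field_formD(1)[OF ff]) (use that R in simp)
  {
    fix P P' assume P: "P \<in> vector_fields TM" and P': "P' \<in> vector_fields TM"
    note L = cot.lie_bracket_mem[OF Q P] cot.lie_bracket_mem[OF Q P']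
    show "lie_pw Q (vf_add P P') R z = lie_pw Q P R z + lie_pw Q P' R z"
      unfolding lie_pw_def cot.lie_bracket_add_right[OF Q P P'] cot.field_form_add[OF ff R1 P P'] cot.field_form_add[OF ff QR1 P P']
        cot.field_form_add[OF ff R1 L]
      by (simp add: cot.vf_apply_add[OF Q sm[OF P] sm[OF P']])
  next
    fix h P assume h: "h \<in> smooth_functions TM" and P: "P \<in> vector_fields TM"
    note L = cot.lie_bracket_mem[OF Q P] and Qh = cot.vector_fieldD(3)[OF Q h]
    show "lie_pw Q (vf_scale h P) R z = h z * lie_pw Q P R z"
      unfolding lie_pw_def cot.lie_bracket_scale_right[OF Q P h] cot.field_form_scale[OF ff R1 h P] cot.field_form_scale[OF ff QR1 h P]
        cot.field_form_add[OF ff R1 cot.vf_scale_mem[OF Qh P] cot.vf_scale_mem[OF h L]]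
        cot.field_form_scale[OF ff R1 Qh P] cot.field_form_scale[OF ff R1 h L]
      by (simp add: cot.vf_apply_mult[OF Q h sm[OF P]] algebra_simps)
  }
qed

text \<open>
A tensor is determined by its values on horizontal and vertical lifts.
\<close>

lemma lie_pw_vanishI:
  assumes Q: "Q \<in> vector_fields TM" and P: "P \<in> vector_fields TM" and R: "R \<in> vector_fields TM"
    and hh: "\<And>Y Z z. Y \<in> vector_fields A \<Longrightarrow> Z \<in> vector_fields A \<Longrightarrow> z \<in> points TM \<Longrightarrow> lie_pw Q (hl Y) (hl Z) z = 0"
    and hv: "\<And>Y \<beta> z. Y \<in> vector_fields A \<Longrightarrow> \<beta> \<in> sym_tensors A 1 \<Longrightarrow> z \<in> points TM \<Longrightarrow> lie_pw Q (hl Y) (vl \<beta>) z = 0"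
    and vv: "\<And>\<alpha> \<beta> z. \<alpha> \<in> sym_tensors A 1 \<Longrightarrow> \<beta> \<in> sym_tensors A 1 \<Longrightarrow> z \<in> points TM \<Longrightarrow> lie_pw Q (vl \<alpha>) (vl \<beta>) z = 0"
  shows "lie_pw Q P R z = 0"
proof (cases "z \<in> points TM")
  case zT: True
  obtain p \<zeta> where zp: "z = (p, \<zeta>)" by (cases z)
  note z = zT[unfolded zp]
  have reduce: "lie_pw Q P R z = 0"
    if P: "P \<in> vector_fields TM" and R: "R \<in> vector_fields TM"
      and h: "\<And>Y. Y \<in> vector_fields A \<Longrightarrow> lie_pw Q (hl Y) R z = 0"
      and v: "\<And>\<beta>. \<beta> \<in> sym_tensors A 1 \<Longrightarrow> lie_pw Q (vl \<beta>) R z = 0" for P R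
  proof -
    obtain Y \<beta> where Y: "Y \<in> vector_fields A" and \<beta>: "\<beta> \<in> sym_tensors A 1" and eq: "P z = vf_add (hl Y) (vl \<beta>) z"
      using tangent_decomposition[OF z cot.vector_fieldD(1)[OF P z]] by (auto simp: zp)
    note hY = horizontal_lift(1)[OF Y] and v\<beta> = vertical_lift(1)[OF \<beta>]
    note lin = lie_pw_linear_at[OF Q R zT]
    have "lie_pw Q P R z = lie_pw Q (vf_add (hl Y) (vl \<beta>)) R z"
      by (rule cot.linear_at_cong[OF lin zT P cot.vf_add_mem[OF hY v\<beta>] eq])
    also have "\<dots> = lie_pw Q (hl Y) R z + lie_pw Q (vl \<beta>) R z"
      by (rule cot.linear_at_add[OF lin hY v\<beta>])
    finally show ?thesis
      using h[OF Y] v[OF \<beta>] by simp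
  qed
  show ?thesis
  proof (rule reduce[OF P R])
    fix Y assume Y: "Y \<in> vector_fields A"
    note hY = horizontal_lift(1)[OF Y]
    show "lie_pw Q (hl Y) R z = 0"
      unfolding lie_pw_commute[OF Q hY R]
    proof (rule reduce[OF R hY])
      show "lie_pw Q (hl Z) (hl Y) z = 0" if "Z \<in> vector_fields A" for Z
        by (rule hh[OF that Y zT])
      show "lie_pw Q (vl \<beta>) (hl Y) z = 0" if "\<beta> \<in> sym_tensors A 1" for \<beta>
        unfolding lie_pw_commute[OF Q vertical_lift(1)[OF that] hY] by (rule hv[OF Y that zT])
    qed
  next
    fix \<alpha> assume \<alpha>: "\<alpha> \<in> sym_tensors A 1"
    note v\<alpha> = vertical_lift(1)[OF \<alpha>]
    show "lie_pw Q (vl \<alpha>) R z = 0"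
      unfolding lie_pw_commute[OF Q v\<alpha> R]
    proof (rule reduce[OF R v\<alpha>])
      show "lie_pw Q (hl Z) (vl \<alpha>) z = 0" if "Z \<in> vector_fields A" for Z
        by (rule hv[OF that \<alpha> zT])
      show "lie_pw Q (vl \<beta>) (vl \<alpha>) z = 0" if "\<beta> \<in> sym_tensors A 1" for \<beta>
        by (rule vv[OF that \<alpha> zT])
    qed
  qed
next
  case False
  then show ?thesis
    using cot.vector_fieldD(2)[OF Q False] by (simp add: lie_pw_def pw_outside)
qed

lemma horizontal_pullback:
  assumes "X \<in> vector_fields A" "f \<in> smooth_functions A"
  shows "hl X z (pb f) = pb (\<lambda>p. X p f) z"
proof (cases "z \<in> points TM")
  case True
  then show ?thesis
    using fun_cong[OF horizontal_lift(3)[OF assms(1), of "fst z" "snd z"], of f] assms(2)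
    by (cases z) (simp add: base_vector_def pullback_apply)
next
  case False
  then show ?thesis
    using cot.vector_fieldD(2)[OF horizontal_lift(1)[OF assms(1)]] by (simp add: pullback_outside)
qed

lemma vertical_pullback:
  assumes "\<alpha> \<in> sym_tensors A 1" "f \<in> smooth_functions A"
  shows "vl \<alpha> z (pb f) = 0"
proof (cases "z \<in> points TM")
  case True
  then show ?thesis
    using fun_cong[OF vertical_lift(3)[OF assms(1), of "fst z" "snd z"], of f] assms(2)
    by (cases z) (simp add: base_vector_def)
next
  case False
  then show ?thesis
    using cot.vector_fieldD(2)[OF vertical_lift(1)[OF assms(1)]] by simp
qed

lemma bracket_horizontal_horizontal:
  assumes X: "X \<in> vector_fields A" and Y: "Y \<in> vector_fields A"
  shows "(p, \<zeta>) \<in> points TM \<Longrightarrow> base_vector (lie_bracket (hl X) (hl Y) (p, \<zeta>)) = lie_bracket X Y p"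
    and "Z \<in> vector_fields A \<Longrightarrow> lie_bracket (hl X) (hl Y) z (vert Z) = vert (nab X (nab Y Z)) z - vert (nab Y (nab X Z)) z"
proof -
  show "lie_bracket (hl X) (hl Y) z (vert Z) = vert (nab X (nab Y Z)) z - vert (nab Y (nab X Z)) z" if Z: "Z \<in> vector_fields A"
    by (simp add: lie_bracket_def deriv_along_def horizontal_lift(2)[OF X] horizontal_lift(2)[OF Y] nab_mem X Y Z)
  assume z: "(p, \<zeta>) \<in> points TM"
  show "base_vector (lie_bracket (hl X) (hl Y) (p, \<zeta>)) = lie_bracket X Y p"
  proof
    fix f
    show "base_vector (lie_bracket (hl X) (hl Y) (p, \<zeta>)) f = lie_bracket X Y p f"
    proof (cases "f \<in> smooth_functions A")
      case True
      then show ?thesis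
        by (simp add: base_vector_def lie_bracket_def deriv_along_def horizontal_pullback X Y vector_fieldD(3)[OF X True]
            vector_fieldD(3)[OF Y True] pullback_apply z)
    next
      case False
      then show ?thesis
        by (simp add: base_vector_def vf_apply_nonsmooth[OF lie_bracket_mem[OF X Y]])
    qed
  qed
qed

lemma bracket_horizontal_vertical:
  assumes X: "X \<in> vector_fields A" and \<beta>: "\<beta> \<in> sym_tensors A 1"
  shows "base_vector (lie_bracket (hl X) (vl \<beta>) z) = (\<lambda>f. 0)"
    and "Z \<in> vector_fields A \<Longrightarrow> lie_bracket (hl X) (vl \<beta>) z (vert Z) =
      pb (\<lambda>p. X p (apply_tensor \<beta> [Z])) z - pb (apply_tensor \<beta> [nab X Z]) z"
proof -
  show "lie_bracket (hl X) (vl \<beta>) z (vert Z) = pb (\<lambda>p. X p (apply_tensor \<beta> [Z])) z - pb (apply_tensor \<beta> [nab X Z]) z"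
    if Z: "Z \<in> vector_fields A"
    by (simp add: lie_bracket_def deriv_along_def horizontal_lift(2)[OF X Z] vertical_lift(2)[OF \<beta>] nab_mem[OF X Z] Z
        horizontal_pullback[OF X one_form_smooth[OF \<beta> Z]])
  show "base_vector (lie_bracket (hl X) (vl \<beta>) z) = (\<lambda>f. 0)"
  proof
    fix f
    show "base_vector (lie_bracket (hl X) (vl \<beta>) z) f = 0"
    proof (cases "f \<in> smooth_functions A")
      case True
      then show ?thesis
        using cot.vf_apply_zero[OF horizontal_lift(1)[OF X]]
        by (simp add: base_vector_def lie_bracket_def deriv_along_def horizontal_pullback[OF X] vertical_pullback[OF \<beta>]
            vector_fieldD(3)[OF X True])
    next
      case False
      then show ?thesis by (simp add: base_vector_def)
    qed
  qed
qed

lemma pw_horizontal_horizontal: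
  assumes Y: "Y \<in> vector_fields A" and Z: "Z \<in> vector_fields A"
  shows "apply_tensor pw [hl Y, hl Z] = (\<lambda>z. 0)"
proof
  fix z :: "'a \<times> 'a covector"
  obtain p \<zeta> where zp: "z = (p, \<zeta>)" by (cases z)
  show "apply_tensor pw [hl Y, hl Z] z = 0"
  proof (cases "z \<in> points TM")
    case True
    note z = True[unfolded zp]
    show ?thesis
      using pw_fields[OF horizontal_lift(1)[OF Y] horizontal_lift(1)[OF Z] True]
      by (simp add: zp kappa_horizontal_left[OF z] lifts_tangent[OF z] Y Z)
  qed (rule pw_outside)
qed

lemma pw_vertical_vertical:
  assumes \<alpha>: "\<alpha> \<in> sym_tensors A 1" and \<beta>: "\<beta> \<in> sym_tensors A 1"
  shows "apply_tensor pw [vl \<alpha>, vl \<beta>] = (\<lambda>z. 0)"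
proof
  fix z :: "'a \<times> 'a covector"
  obtain p \<zeta> where zp: "z = (p, \<zeta>)" by (cases z)
  show "apply_tensor pw [vl \<alpha>, vl \<beta>] z = 0"
  proof (cases "z \<in> points TM")
    case True
    note z = True[unfolded zp]
    show ?thesis
      using pw_fields[OF vertical_lift(1)[OF \<alpha>] vertical_lift(1)[OF \<beta>] True]
      by (simp add: zp kappa_vl_right[OF z lifts_tangent(2)[OF z \<alpha>] \<beta>] kappa_vl_right[OF z lifts_tangent(2)[OF z \<beta>] \<alpha>])
  qed (rule pw_outside)
qed

lemma pw_horizontal_vertical:
  assumes Y: "Y \<in> vector_fields A" and \<beta>: "\<beta> \<in> sym_tensors A 1"
  shows "apply_tensor pw [hl Y, vl \<beta>] = pb (apply_tensor \<beta> [Y])"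
proof
  fix z :: "'a \<times> 'a covector"
  obtain p \<zeta> where zp: "z = (p, \<zeta>)" by (cases z)
  show "apply_tensor pw [hl Y, vl \<beta>] z = pb (apply_tensor \<beta> [Y]) z"
  proof (cases "z \<in> points TM")
    case True
    note z = True[unfolded zp]
    show ?thesis
      using pw_fields[OF horizontal_lift(1)[OF Y] vertical_lift(1)[OF \<beta>] True]
        kappa_vl_left[OF z lifts_tangent(1)[OF z Y] \<beta> Y horizontal_lift(3)[OF Y z, symmetric]]
      by (simp add: zp kappa_vl_right[OF z lifts_tangent(1)[OF z Y] \<beta>] pullback_apply[OF z])
  next
    case False
    then show ?thesis by (simp add: pw_outside pullback_outside)
  qed
qed

lemma pw_horizontal_right:
  assumes P: "P \<in> vector_fields TM" and Y: "Y \<in> vector_fields A" and z: "(p, \<zeta>) \<in> points TM"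
    and U: "U \<in> vector_fields A" "U p = base_vector (P (p, \<zeta>))"
  shows "apply_tensor pw [P, hl Y] (p, \<zeta>) = P (p, \<zeta>) (vert Y) - \<zeta> (nab U Y p)"
  using pw_fields[OF P horizontal_lift(1)[OF Y] z]
  by (simp add: kappa_horizontal_left[OF z cot.vector_fieldD(1)[OF P z] Y] kappa_horizontal_right[OF z cot.vector_fieldD(1)[OF P z] Y U])

lemma pw_vertical_right:
  assumes P: "P \<in> vector_fields TM" and \<beta>: "\<beta> \<in> sym_tensors A 1" and z: "(p, \<zeta>) \<in> points TM"
    and U: "U \<in> vector_fields A" "U p = base_vector (P (p, \<zeta>))"
  shows "apply_tensor pw [P, vl \<beta>] (p, \<zeta>) = apply_tensor \<beta> [U] p"
  using pw_fields[OF P vertical_lift(1)[OF \<beta>] z]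
  by (simp add: kappa_vl_right[OF z cot.vector_fieldD(1)[OF P z] \<beta>] kappa_vl_left[OF z cot.vector_fieldD(1)[OF P z] \<beta> U])

lemma one_form_zero: "\<beta> \<in> sym_tensors A 1 \<Longrightarrow> p \<in> points A \<Longrightarrow> apply_tensor \<beta> [\<lambda>p f. 0] p = 0"
  by (rule linear_at_vanish[OF one_form_linear_at _ vf_zero_mem refl])

lemma covector_nab_zero: "(p, \<zeta>) \<in> points TM \<Longrightarrow> Y \<in> vector_fields A \<Longrightarrow> \<zeta> (nab (\<lambda>p f. 0) Y p) = 0"
  by (rule linear_at_vanish[OF covector_nab_linear_at cotangent_pointsD(1) vf_zero_mem refl])

text \<open>
Horizontal lifts are orthogonal to each other, so only the brackets contribute; the vertical part of \<open>[X\<^sup>h, Y\<^sup>h]\<close> is the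
curvature.
\<close>

lemma lie_pw_horizontal_horizontal:
  assumes X: "X \<in> vector_fields A" and Y: "Y \<in> vector_fields A" and Z: "Z \<in> vector_fields A" and z: "(p, \<zeta>) \<in> points TM"
  shows "lie_pw (hl X) (hl Y) (hl Z) (p, \<zeta>) = - \<zeta> (curvature X Y Z p) - \<zeta> (curvature X Z Y p)"
proof -
  note h = horizontal_lift(1)
  have c: "apply_tensor pw [lie_bracket (hl X) (hl Y), hl Z] (p, \<zeta>) = \<zeta> (curvature X Y Z p)"
    if Y: "Y \<in> vector_fields A" and Z: "Z \<in> vector_fields A" for Y Z
    using pw_horizontal_right[OF cot.lie_bracket_mem[OF h[OF X] h[OF Y]] Z z lie_bracket_mem[OF X Y]
        bracket_horizontal_horizontal(1)[OF X Y z, symmetric]]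
      linear_at_curvature[OF covector_linear_at[OF z] cotangent_pointsD(1)[OF z] X Y Z]
    by (simp add: bracket_horizontal_horizontal(2)[OF X Y Z] vertical_apply[OF z])
  have "apply_tensor pw [hl Y, lie_bracket (hl X) (hl Z)] (p, \<zeta>) = \<zeta> (curvature X Z Y p)"
    unfolding pw_commute[OF h[OF Y] cot.lie_bracket_mem[OF h[OF X] h[OF Z]]] by (rule c[OF Z Y])
  then show ?thesis
    by (simp add: lie_pw_def c[OF Y Z] pw_horizontal_horizontal[OF Y Z] cot.vf_apply_zero[OF h[OF X]])
qed

lemma lie_pw_horizontal_vertical:
  assumes X: "X \<in> vector_fields A" and Y: "Y \<in> vector_fields A" and \<beta>: "\<beta> \<in> sym_tensors A 1" and z: "(p, \<zeta>) \<in> points TM"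
  shows "lie_pw (hl X) (hl Y) (vl \<beta>) (p, \<zeta>) = apply_tensor \<beta> [nab X Y] p - apply_tensor \<beta> [lie_bracket X Y] p"
proof -
  note hX = horizontal_lift(1)[OF X] and hY = horizontal_lift(1)[OF Y] and v\<beta> = vertical_lift(1)[OF \<beta>]
  note br = cot.lie_bracket_mem[OF hX v\<beta>]
  have "apply_tensor pw [lie_bracket (hl X) (hl Y), vl \<beta>] (p, \<zeta>) = apply_tensor \<beta> [lie_bracket X Y] p"
    by (rule pw_vertical_right[OF cot.lie_bracket_mem[OF hX hY] \<beta> z lie_bracket_mem[OF X Y]
        bracket_horizontal_horizontal(1)[OF X Y z, symmetric]])
  moreover have "apply_tensor pw [hl Y, lie_bracket (hl X) (vl \<beta>)] (p, \<zeta>) = X p (apply_tensor \<beta> [Y]) - apply_tensor \<beta> [nab X Y] p"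
    unfolding pw_commute[OF hY br]
    using pw_horizontal_right[OF br Y z vf_zero_mem] bracket_horizontal_vertical(1)[OF X \<beta>]
    by (simp add: bracket_horizontal_vertical(2)[OF X \<beta> Y] pullback_apply[OF z] covector_nab_zero[OF z Y])
  ultimately show ?thesis
    by (simp add: lie_pw_def pw_horizontal_vertical[OF Y \<beta>] horizontal_pullback[OF X one_form_smooth[OF \<beta> Y]] pullback_apply[OF z])
qed

lemma lie_pw_vertical_vertical:
  assumes X: "X \<in> vector_fields A" and \<alpha>: "\<alpha> \<in> sym_tensors A 1" and \<beta>: "\<beta> \<in> sym_tensors A 1" and z: "(p, \<zeta>) \<in> points TM"
  shows "lie_pw (hl X) (vl \<alpha>) (vl \<beta>) (p, \<zeta>) = 0"
proof -
  note hX = horizontal_lift(1)[OF X]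
  have c: "apply_tensor pw [lie_bracket (hl X) (vl \<alpha>), vl \<beta>] (p, \<zeta>) = 0"
    if \<alpha>: "\<alpha> \<in> sym_tensors A 1" and \<beta>: "\<beta> \<in> sym_tensors A 1" for \<alpha> \<beta>
    using pw_vertical_right[OF cot.lie_bracket_mem[OF hX vertical_lift(1)[OF \<alpha>]] \<beta> z vf_zero_mem]
    by (simp add: bracket_horizontal_vertical(1)[OF X \<alpha>] one_form_zero[OF \<beta> cotangent_pointsD(1)[OF z]])
  have "apply_tensor pw [vl \<alpha>, lie_bracket (hl X) (vl \<beta>)] (p, \<zeta>) = 0"
    unfolding pw_commute[OF vertical_lift(1)[OF \<alpha>] cot.lie_bracket_mem[OF hX vertical_lift(1)[OF \<beta>]]] by (rule c[OF \<beta> \<alpha>])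
  then show ?thesis
    by (simp add: lie_pw_def c[OF \<alpha> \<beta>] pw_vertical_vertical[OF \<alpha> \<beta>] cot.vf_apply_zero[OF hX])
qed

lemma complete_lift_parallel:
  assumes X: "X \<in> vector_fields A" and par: "parallel X"
  shows "cl X = hl X"
proof (rule lift_unique[OF complete_lift(1)[OF X] horizontal_lift(1)[OF X]])
  show "deriv_along (cl X) (vert Y) = deriv_along (hl X) (vert Y)" if Y: "Y \<in> vector_fields A" for Y
    by (simp add: deriv_along_def complete_lift(2)[OF X Y] horizontal_lift(2)[OF X Y] parallel_nab[OF par X Y])
qed

lemma parallel_imp_gradient:
  assumes X: "X \<in> vector_fields A" and par: "parallel X"
  shows "contraction (hl X) pw = differential TM (vert X)"
proof (intro ext)
  fix z :: "'a \<times> 'a covector" and vs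
  obtain p \<zeta> where zp: "z = (p, \<zeta>)" by (cases z)
  show "contraction (hl X) pw z vs = differential TM (vert X) z vs"
  proof (cases "z \<in> points TM \<and> length vs = 1 \<and> set vs \<subseteq> tangent_space TM z")
    case True
    then obtain v where v: "vs = [v]" "v \<in> tangent_space TM z"
      by (cases vs) auto
    have z: "(p, \<zeta>) \<in> points TM" and vt: "v \<in> tangent_space TM (p, \<zeta>)"
      using True v by (simp_all add: zp)
    note U = extension[OF cotangent_pointsD(1)[OF z] base_vector_tangent[OF z vt]]
    have "nab (extension p (base_vector v)) X = (\<lambda>p f. 0)"
      using par U(1) by (simp add: parallel_def)
    then have "kappa (p, \<zeta>) v (hl X (p, \<zeta>)) = v (vert X)"
      using kappa_horizontal_right[OF z vt X U] covector_zero[OF cotangent_pointsD(2)[OF z]] by simp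
    then show ?thesis
      using pw_apply[OF z lifts_tangent(1)[OF z X] vt] True
      by (simp add: contraction_def differential_def v(1) zp kappa_horizontal_left[OF z vt X])
  next
    case False
    then show ?thesis
      by (auto simp: contraction_def differential_def pw_def)
  qed
qed

text \<open>
Along \<open>\<beta>\<^sup>v\<close> and \<open>Y\<^sup>h\<close> the derivatives of \<open>F\<close> are \<open>pr\<^sup>*(\<beta>(X))\<close> and \<open>-(\<nabla>\<^sub>Y X)\<^sup>v\<close>. Computing \<open>[Y\<^sup>h, \<beta>\<^sup>v] F\<close> from
these yields \<open>Y(\<beta>(X)) + \<beta>(\<nabla>\<^sub>Y X)\<close>. On the other hand the bracket is vertical, with values
\<open>(\<nabla>\<^sub>Y \<beta>)(X) = Y(\<beta>(X)) - \<beta>(\<nabla>\<^sub>Y X)\<close> as derivative of \<open>F\<close>.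
\<close>

lemma gradient_imp_parallel:
  assumes X: "X \<in> vector_fields A" and F: "F \<in> smooth_functions TM" and grad: "contraction (cl X) pw = differential TM F"
  shows "parallel X"
proof -
  note cX = complete_lift(1)[OF X]
  have dF: "apply_tensor pw [P, cl X] z = P z F" if P: "P \<in> vector_fields TM" for P z
  proof (cases "z \<in> points TM")
    case True
    have "pw z [cl X z, P z] = differential TM F z [P z]"
      using fun_cong[OF fun_cong[OF grad, of z], of "[P z]"] by (simp add: contraction_def)
    then have "apply_tensor pw [cl X, P] z = P z F"
      using cot.vector_fieldD(1)[OF P True] True by (simp add: apply_tensor_def differential_def)
    then show ?thesis
      by (simp add: pw_commute[OF P cX])
  next
    case False
    then show ?thesis
      using cot.vector_fieldD(2)[OF P False] by (simp add: pw_outside)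
  qed
  have vF: "(\<lambda>z. vl \<beta> z F) = pb (apply_tensor \<beta> [X])" if \<beta>: "\<beta> \<in> sym_tensors A 1" for \<beta>
  proof
    fix z :: "'a \<times> 'a covector"
    obtain p \<zeta> where zp: "z = (p, \<zeta>)" by (cases z)
    show "vl \<beta> z F = pb (apply_tensor \<beta> [X]) z"
    proof (cases "z \<in> points TM")
      case True
      note z = True[unfolded zp]
      show ?thesis
        using dF[OF vertical_lift(1)[OF \<beta>], of z] pw_vertical_right[OF cX \<beta> z X complete_lift(3)[OF X z, symmetric]]
        by (simp add: pw_commute[OF vertical_lift(1)[OF \<beta>] cX] zp pullback_apply[OF z])
    next
      case False
      then show ?thesis
        using cot.vector_fieldD(2)[OF vertical_lift(1)[OF \<beta>] False] by (simp add: pullback_outside)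
    qed
  qed
  have hF: "(\<lambda>z. hl Y z F) = (\<lambda>z. - vert (nab Y X) z)" if Y: "Y \<in> vector_fields A" for Y
  proof
    fix z :: "'a \<times> 'a covector"
    obtain p \<zeta> where zp: "z = (p, \<zeta>)" by (cases z)
    show "hl Y z F = - vert (nab Y X) z"
    proof (cases "z \<in> points TM")
      case True
      note z = True[unfolded zp]
      have "vf_diff (nab X Y) (nab Y X) = lie_bracket X Y"
        using torsion_free_apply[OF X Y] by (simp add: vf_diff_def fun_eq_iff)
      then have "\<zeta> (lie_bracket X Y p) = \<zeta> (nab X Y p) - \<zeta> (nab Y X p)"
        using linear_at_diff[OF covector_linear_at[OF z] cotangent_pointsD(1)[OF z] nab_mem[OF X Y] nab_mem[OF Y X]] by simp
      then show ?thesis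
        using dF[OF horizontal_lift(1)[OF Y], of z] pw_horizontal_right[OF cX Y z X complete_lift(3)[OF X z, symmetric]]
        by (simp add: pw_commute[OF horizontal_lift(1)[OF Y] cX] zp complete_lift(2)[OF X Y] vertical_apply[OF z])
    next
      case False
      then show ?thesis
        using cot.vector_fieldD(2)[OF horizontal_lift(1)[OF Y] False] by (simp add: vertical_outside)
    qed
  qed
  have \<beta>0: "apply_tensor \<beta> [nab Y X] p = 0" if Y: "Y \<in> vector_fields A" and \<beta>: "\<beta> \<in> sym_tensors A 1" and p: "p \<in> points A" for Y \<beta> p
  proof -
    \<comment> \<open>The identity is an equality of functions on the base, so it may be read off over the zero section.\<close>
    have z: "(p, \<lambda>v. 0) \<in> points TM"
      using p by (simp add: points_cotangent_atlas cotangent_over_def cotangent_space_def)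
    let ?z = "(p, \<lambda>v :: 'a tangent. 0 :: real)"
    note hY = horizontal_lift(1)[OF Y] and v\<beta> = vertical_lift(1)[OF \<beta>]
    note br = cot.lie_bracket_mem[OF hY v\<beta>]
    have "lie_bracket (hl Y) (vl \<beta>) ?z F = Y p (apply_tensor \<beta> [X]) - vl \<beta> ?z (\<lambda>z. - vert (nab Y X) z)"
      by (simp only: lie_bracket_def deriv_along_def vF[OF \<beta>] hF[OF Y] horizontal_pullback[OF Y one_form_smooth[OF \<beta> X]]
          pullback_apply[OF z])
    also have "vl \<beta> ?z (\<lambda>z. - vert (nab Y X) z) = - apply_tensor \<beta> [nab Y X] p"
      using cot.tangent_scale[OF cot.vector_fieldD(1)[OF v\<beta> z] vertical_smooth[OF nab_mem[OF Y X]], of "-1"]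
      by (simp add: vertical_lift(2)[OF \<beta> nab_mem[OF Y X]] pullback_apply[OF z])
    finally have 1: "lie_bracket (hl Y) (vl \<beta>) ?z F = Y p (apply_tensor \<beta> [X]) + apply_tensor \<beta> [nab Y X] p"
      by simp
    have "kappa ?z (cl X ?z) (lie_bracket (hl Y) (vl \<beta>) ?z) = 0"
      by (rule kappa_vertical_right[OF z cot.vector_fieldD(1)[OF cX z] cot.vector_fieldD(1)[OF br z] bracket_horizontal_vertical(1)[OF Y \<beta>]])
    moreover have "kappa ?z (lie_bracket (hl Y) (vl \<beta>) ?z) (cl X ?z) = Y p (apply_tensor \<beta> [X]) - apply_tensor \<beta> [nab Y X] p"
      using kappa_vertical_left[OF z cot.vector_fieldD(1)[OF br z] cot.vector_fieldD(1)[OF cX z]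
          bracket_horizontal_vertical(1)[OF Y \<beta>] X complete_lift(3)[OF X z, symmetric]]
      by (simp add: bracket_horizontal_vertical(2)[OF Y \<beta> X] pullback_apply[OF z])
    ultimately have "lie_bracket (hl Y) (vl \<beta>) ?z F = Y p (apply_tensor \<beta> [X]) - apply_tensor \<beta> [nab Y X] p"
      using dF[OF br, of ?z] pw_fields[OF br cX z] by simp
    with 1 show ?thesis by simp
  qed
  show ?thesis
    unfolding parallel_def
  proof (intro ballI ext)
    fix Y p f assume Y: "Y \<in> vector_fields A"
    show "nab Y X p f = 0"
    proof (cases "p \<in> points A \<and> f \<in> smooth_functions A")
      case True
      then show ?thesis
        using \<beta>0[OF Y differential_mem, of f p] differential_apply[OF _ nab_mem[OF Y X], of p f] by simp
    next
      case False
      then show ?thesis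
        using vector_fieldD(2)[OF nab_mem[OF Y X], of p] vf_apply_nonsmooth[OF nab_mem[OF Y X]] by auto
    qed
  qed
qed

lemma killing_imp_annihilates_curvature:
  assumes X: "X \<in> vector_fields A" and par: "parallel X" and kill: "killing TM pw (hl X)"
  shows "annihilates_curvature X"
  unfolding annihilates_curvature_def
proof (intro ballI ext)
  fix Y Z p f assume Y: "Y \<in> vector_fields A" and Z: "Z \<in> vector_fields A"
  show "curvature X Y Z p f = 0"
  proof (cases "p \<in> points A")
    case True
    \<comment> \<open>The covector \<open>df\<close>, which reads off the derivative of \<open>f\<close>.\<close>
    let ?\<zeta> = "\<lambda>v. if v \<in> tangent_space A p then v f else 0"
    have z: "(p, ?\<zeta>) \<in> points TM"
      using True by (simp add: points_cotangent_atlas cotangent_over_def cotangent_space_def tangent_space_combination)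
    have "lie_pw (hl X) (hl Y) (hl Z) (p, ?\<zeta>) = 0"
      using kill horizontal_lift(1)[OF Y] horizontal_lift(1)[OF Z] unfolding killing_iff by blast
    then show ?thesis
      using lie_pw_horizontal_horizontal[OF X Y Z z] vector_fieldD(1)[OF curvature_mem[OF X Y Z] True]
      by (simp add: parallel_curvature_symmetric[OF X par Z Y])
  next
    case False
    then show ?thesis
      using vector_fieldD(2)[OF curvature_mem[OF X Y Z]] by simp
  qed
qed

lemma parallel_imp_killing:
  assumes X: "X \<in> vector_fields A" and par: "parallel X" and cur: "annihilates_curvature X"
  shows "killing TM pw (hl X)"
  unfolding killing_iff
proof (intro conjI ballI allI)
  show hX: "hl X \<in> vector_fields TM"
    by (rule horizontal_lift(1)[OF X])
  fix P R z assume P: "P \<in> vector_fields TM" and R: "R \<in> vector_fields TM"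
  show "lie_pw (hl X) P R z = 0"
  proof (rule lie_pw_vanishI[OF hX P R])
    fix z assume zT: "z \<in> points TM"
    obtain p \<zeta> where zp: "z = (p, \<zeta>)" by (cases z)
    note z = zT[unfolded zp]
    show "lie_pw (hl X) (hl Y) (hl Z) z = 0" if Y: "Y \<in> vector_fields A" and Z: "Z \<in> vector_fields A" for Y Z
      using cur Y Z covector_zero[OF cotangent_pointsD(2)[OF z]]
      by (simp add: zp lie_pw_horizontal_horizontal[OF X Y Z z] annihilates_curvature_def)
    show "lie_pw (hl X) (hl Y) (vl \<beta>) z = 0" if Y: "Y \<in> vector_fields A" and \<beta>: "\<beta> \<in> sym_tensors A 1" for Y \<beta>
      by (simp add: zp lie_pw_horizontal_vertical[OF X Y \<beta> z] parallel_nab[OF par X Y])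
    show "lie_pw (hl X) (vl \<alpha>) (vl \<beta>) z = 0" if \<alpha>: "\<alpha> \<in> sym_tensors A 1" and \<beta>: "\<beta> \<in> sym_tensors A 1" for \<alpha> \<beta>
      unfolding zp by (rule lie_pw_vertical_vertical[OF X \<alpha> \<beta> z])
  qed
qed

lemma gradient_killing_iff:
  assumes X: "X \<in> vector_fields A"
  shows "gradient_killing TM (patterson_walker_metric A nab) (cl X) \<longleftrightarrow> parallel X \<and> annihilates_curvature X"
proof
  assume gk: "gradient_killing TM (patterson_walker_metric A nab) (cl X)"
  then obtain F where F: "F \<in> smooth_functions TM" "contraction (cl X) pw = differential TM F" and kill: "killing TM pw (cl X)"
    by (auto simp: gradient_killing_def patterson_walker_metric_eq)
  have par: "parallel X"
    by (rule gradient_imp_parallel[OF X F])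
  with kill show "parallel X \<and> annihilates_curvature X"
    using killing_imp_annihilates_curvature[OF X par] by (simp add: complete_lift_parallel[OF X par])
next
  assume "parallel X \<and> annihilates_curvature X"
  then have par: "parallel X" and cur: "annihilates_curvature X" by auto
  show "gradient_killing TM (patterson_walker_metric A nab) (cl X)"
    unfolding gradient_killing_def patterson_walker_metric_eq complete_lift_parallel[OF X par]
    using parallel_imp_killing[OF X par cur] parallel_imp_gradient[OF X par] vertical_smooth[OF X] by blast
qed

end

theorem theorem5p19:
  fixes A :: "('a, 'e::euclidean_space) atlas"
    and nab :: "'a vfield \<Rightarrow> 'a vfield \<Rightarrow> 'a vfield"
    and X Y :: "'a vfield"
  assumes "smooth_manifold A"
    and "affine_connection A nab"
    and "torsion_free A nab"
    and "X \<in> vector_fields A"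
    and "Y \<in> vector_fields A"
  shows "(operators_eq A (commutator (contraction X) (contraction Y)) zero_operator \<and>
          operators_eq A (commutator (sym_deriv A nab) (sym_deriv A nab)) zero_operator \<and>
          operators_eq A (commutator (contraction X) (sym_deriv A nab)) (sym_lie_deriv A nab X) \<and>
          operators_eq A (commutator (sym_lie_deriv A nab X) (contraction Y))
            (contraction (sym_bracket nab X Y)) \<and>
          operators_eq A (commutator (sym_lie_deriv A nab X) (sym_lie_deriv A nab Y))
            (sym_lie_deriv A nab (sym_bracket nab X Y)) \<and>
          operators_eq A (commutator (sym_deriv A nab) (sym_lie_deriv A nab X)) zero_operator)
     \<longleftrightarrow> gradient_killing (cotangent_atlas A) (patterson_walker_metric A nab) (complete_lift A X)"
proof -
  interpret charted A
    using assms(1) by unfold_locales (simp add: smooth_manifold_def)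
  interpret bump_atlas A
    using assms(1) Hausdorff_chart_bump by unfold_locales (simp add: smooth_manifold_def)
  interpret affine_manifold A nab
    by unfold_locales (rule assms(2))
  interpret torsion_free_manifold A nab
    by unfold_locales (rule assms(3))
  interpret cotangent_charted A
    by unfold_locales (rule cotangent_compatible)
  interpret cot: bump_atlas "cotangent_atlas A"
    by (rule cotangent_bump_atlas)
  interpret patterson_walker A nab
    by unfold_locales
  show ?thesis
    unfolding relations_iff[OF assms(4,5)] gradient_killing_iff[OF assms(4)] ..
qed

end
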